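(* For every $n\geq1$: $\mathrm{SPE}_{\mathfrak{D}_n\cup\overline{\mathfrak{D}_n}}\equiv_W\lim^{(n)}$.
   Context: $f\leq_W g$ iff there are computable partial $K,H$ on $\mathbb{N}^\mathbb{N}$ such that for every realizer $G$ of $g$, $p\mapsto K(\langle p,G(H(p))\rangle)$ realizes $f$; $\equiv_W$ induced equivalence. $\lim:\subseteq\mathbb{N}^\mathbb{N}\to\mathbb{N}^\mathbb{N}$, $\lim(p)(n)=\lim_{i\to\infty}p(\langle n,i\rangle)$. $f\star g$ is the $\leq_W$-maximum of $\{f_0\circ g_0\mid f_0\equiv_W f,g_0\equiv_W g\}$; $\lim^{(0)}=\mathrm{id}$, $\lim^{(n+1)}=\lim^{(n)}\star\lim$. $\mathfrak{D}_m$: sets $D\subseteq\{0,1\}^\mathbb{N}$ for which there are open $U_0,\ldots,U_{m-1}$ with $x\in D\iff\min\{\beta\mid x\in U_\beta\}\not\equiv m\pmod2$ ($\min\emptyset=m$), named by names of the $U_i$ (open sets named by enumerations of words whose cylinders form them); $\overline{\mathfrak{D}_m}$: complements; the union class named by tag plus name. Games: two-player infinite sequential games with choices $\{0,1\}$, turn function $d:\{0,1\}^*\to\{1,2\}$, finitely many outcomes, valuation $v$, linear antagonistic preferences ($\prec_1=\prec_2^{-1}$). Strategy profiles $s:\{0,1\}^*\to\{0,1\}$; play from history $\lambda$: $p_n=\lambda_n$ for $n<|\lambda|$, else $p_n=s(p_{<n})$. Nash equilibrium: no player can unilaterally deviate to a strictly preferred outcome; subgame perfect equilibrium: Nash equilibrium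 of the game started at every history. $\mathrm{SPE}_\Gamma$ takes such a game, named by the number of outcomes, $d$ and preferences as tables, and for each player and upper set $U$ w.r.t. its preference a $\Gamma$-name of $v^{-1}(U)$, and outputs any subgame perfect equilibrium. *)

theory Defs
  imports Main "HOL-Library.Nat_Bijection"
begin

datatype recf = Z | S | Proj nat | Comp recf "recf list" | Prec recf recf | Mn recf

inductive recf_eval :: "recf \<Rightarrow> nat list \<Rightarrow> nat \<Rightarrow> bool" where
  ev_Z: "recf_eval Z xs 0"
| ev_S: "recf_eval S (x # xs) (Suc x)"
| ev_Proj: "i < length xs \<Longrightarrow> recf_eval (Proj i) xs (xs ! i)"
| ev_Comp: "length ys = length gs \<Longrightarrow> (\<forall>i < length gs. recf_eval (gs ! i) xs (ys ! i))
            \<Longrightarrow> recf_eval f ys z \<Longrightarrow> recf_eval (Comp f gs) xs z"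
| ev_Prec0: "recf_eval f xs y \<Longrightarrow> recf_eval (Prec f g) (0 # xs) y"
| ev_PrecS: "recf_eval (Prec f g) (n # xs) y \<Longrightarrow> recf_eval g (y # n # xs) z
            \<Longrightarrow> recf_eval (Prec f g) (Suc n # xs) z"
| ev_Mn: "recf_eval f (n # xs) 0 \<Longrightarrow> (\<forall>m < n. \<exists>y. recf_eval f (m # xs) (Suc y))
            \<Longrightarrow> recf_eval (Mn f) xs n"

definition rec_total2 :: "(nat \<Rightarrow> nat \<Rightarrow> nat) \<Rightarrow> bool" where
  "rec_total2 \<phi> \<longleftrightarrow> (\<exists>c. \<forall>a b. recf_eval c [a, b] (\<phi> a b))"

type_synonym baire = "nat \<Rightarrow> nat"

type_synonym pfun = "baire \<Rightarrow> baire option"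

definition prefix_code :: "baire \<Rightarrow> nat \<Rightarrow> nat" where
  "prefix_code p k = list_encode (map p [0..<k])"

text \<open>Type-2 computability of a partial function K (on its domain):
  a total recursive \<phi> which, given n and a finite prefix of the input,
  answers 0 (no answer yet) or Suc (K(p)(n)), and eventually answers.\<close>
definition computable :: "pfun \<Rightarrow> bool" where
  "computable K \<longleftrightarrow> (\<exists>\<phi>. rec_total2 \<phi> \<and>
     (\<forall>p r. K p = Some r \<longrightarrow> (\<forall>n.
        (\<exists>k. \<phi> n (prefix_code p k) = Suc (r n)) \<and>
        (\<forall>k. \<phi> n (prefix_code p k) \<in> {0, Suc (r n)}))))"

text \<open>Multivalued problems on Baire space (name level); dom f = {p. f p \<noteq> {}}.\<close>
type_synonym problem = "baire \<Rightarrow> baire set"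

definition bpair :: "baire \<Rightarrow> baire \<Rightarrow> baire" where
  "bpair p q = (\<lambda>n. if even n then p (n div 2) else q (n div 2))"

definition realizer :: "pfun \<Rightarrow> problem \<Rightarrow> bool" where
  "realizer G f \<longleftrightarrow> (\<forall>p. f p \<noteq> {} \<longrightarrow> (\<exists>q. G p = Some q \<and> q \<in> f p))"

definition W_le :: "problem \<Rightarrow> problem \<Rightarrow> bool" (infix "\<le>\<^sub>W" 50) where
  "f \<le>\<^sub>W g \<longleftrightarrow> (\<exists>K H. computable K \<and> computable H \<and>
     (\<forall>G. realizer G g \<longrightarrow>
        realizer (\<lambda>p. Option.bind (H p) (\<lambda>h. Option.bind (G h) (\<lambda>q. K (bpair p q)))) f))"

definition W_eq :: "problem \<Rightarrow> problem \<Rightarrow> bool" (infix "\<equiv>\<^sub>W" 50) where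
  "f \<equiv>\<^sub>W g \<longleftrightarrow> f \<le>\<^sub>W g \<and> g \<le>\<^sub>W f"

definition id_prob :: problem where
  "id_prob p = {p}"

definition lim_prob :: problem where
  "lim_prob p = {r. \<forall>n. \<exists>i0. \<forall>i\<ge>i0. p (prod_encode (n, i)) = r n}"

definition comp_prob :: "problem \<Rightarrow> problem \<Rightarrow> problem" where
  "comp_prob f g p = (if g p \<noteq> {} \<and> (\<forall>q\<in>g p. f q \<noteq> {}) then (\<Union>q\<in>g p. f q) else {})"

definition cprod :: "problem \<Rightarrow> problem \<Rightarrow> problem" (infixl "\<star>" 70) where
  "f \<star> g = (SOME h. h \<in> {comp_prob f0 g0 | f0 g0. f0 \<equiv>\<^sub>W f \<and> g0 \<equiv>\<^sub>W g} \<and>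
              (\<forall>k \<in> {comp_prob f0 g0 | f0 g0. f0 \<equiv>\<^sub>W f \<and> g0 \<equiv>\<^sub>W g}. k \<le>\<^sub>W h))"

primrec lim_pow :: "nat \<Rightarrow> problem" where
  "lim_pow 0 = id_prob"
| "lim_pow (Suc n) = lim_pow n \<star> lim_prob"

type_synonym cantor = "nat \<Rightarrow> bool"

definition wcode :: "bool list \<Rightarrow> nat" where
  "wcode w = list_encode (map of_bool w)"

definition cyl :: "bool list \<Rightarrow> cantor set" where
  "cyl w = {x. \<forall>i < length w. x i = w ! i}"

text \<open>q names an open set: q n = Suc (code of word w) enumerates w, q n = 0 enumerates nothing.\<close>
definition open_name :: "baire \<Rightarrow> cantor set \<Rightarrow> bool" where
  "open_name q U \<longleftrightarrow> U = (\<Union>{cyl w | w. \<exists>n. q n = Suc (wcode w)})"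

definition bproj :: "nat \<Rightarrow> baire \<Rightarrow> baire" where
  "bproj i p = (\<lambda>n. p (prod_encode (i, n)))"

definition tail :: "baire \<Rightarrow> baire" where
  "tail q = (\<lambda>n. q (Suc n))"

definition first_idx :: "nat \<Rightarrow> (nat \<Rightarrow> cantor set) \<Rightarrow> cantor \<Rightarrow> nat" where
  "first_idx m U x = (if \<exists>\<beta><m. x \<in> U \<beta> then (LEAST \<beta>. \<beta> < m \<and> x \<in> U \<beta>) else m)"

definition D_name :: "nat \<Rightarrow> baire \<Rightarrow> cantor set \<Rightarrow> bool" where
  "D_name m q D \<longleftrightarrow> (\<exists>U. (\<forall>i<m. open_name (bproj i q) (U i)) \<and>
      D = {x. first_idx m U x mod 2 \<noteq> m mod 2})"

definition DcoD_name :: "nat \<Rightarrow> baire \<Rightarrow> cantor set \<Rightarrow> bool" where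
  "DcoD_name m q A \<longleftrightarrow> (q 0 = 0 \<and> D_name m (tail q) A) \<or> (q 0 = 1 \<and> D_name m (tail q) (- A))"

record game =
  noutc :: nat                          (* outcomes are 0 ..< noutc *)
  turn :: "bool list \<Rightarrow> nat"             (* player 1 or 2 *)
  pref1 :: "nat \<Rightarrow> nat \<Rightarrow> bool"          (* strict preference of player 1: a \<prec>1 b *)
  val :: "cantor \<Rightarrow> nat"

definition wf_game :: "game \<Rightarrow> bool" where
  "wf_game G \<longleftrightarrow> (\<forall>w. turn G w \<in> {1, 2}) \<and> (\<forall>x. val G x < noutc G) \<and>
     (\<forall>a<noutc G. \<not> pref1 G a a) \<and>
     (\<forall>a<noutc G. \<forall>b<noutc G. \<forall>c<noutc G. pref1 G a b \<longrightarrow> pref1 G b c \<longrightarrow> pref1 G a c) \<and>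
     (\<forall>a<noutc G. \<forall>b<noutc G. a \<noteq> b \<longrightarrow> pref1 G a b \<or> pref1 G b a)"

text \<open>Antagonistic: player 2's preference is the converse of player 1's.\<close>
definition prefers :: "game \<Rightarrow> nat \<Rightarrow> nat \<Rightarrow> nat \<Rightarrow> bool" where
  "prefers G i a b = (if i = 1 then pref1 G a b else pref1 G b a)"

type_synonym strat = "bool list \<Rightarrow> bool"

primrec play_prefix :: "strat \<Rightarrow> bool list \<Rightarrow> nat \<Rightarrow> bool list" where
  "play_prefix s h 0 = []"
| "play_prefix s h (Suc n) = play_prefix s h n @
     [if n < length h then h ! n else s (play_prefix s h n)]"

definition play :: "strat \<Rightarrow> bool list \<Rightarrow> cantor" where
  "play s h n = play_prefix s h (Suc n) ! n"

definition nash_at :: "game \<Rightarrow> bool list \<Rightarrow> strat \<Rightarrow> bool" where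
  "nash_at G h s \<longleftrightarrow> (\<forall>i\<in>{1, 2}. \<forall>s'. (\<forall>w. turn G w \<noteq> i \<longrightarrow> s' w = s w) \<longrightarrow>
      \<not> prefers G i (val G (play s h)) (val G (play s' h)))"

definition is_SPE :: "game \<Rightarrow> strat \<Rightarrow> bool" where
  "is_SPE G s \<longleftrightarrow> (\<forall>h. nash_at G h s)"

definition upper_set :: "game \<Rightarrow> nat \<Rightarrow> nat set \<Rightarrow> bool" where
  "upper_set G i U \<longleftrightarrow> U \<subseteq> {..<noutc G} \<and>
     (\<forall>a\<in>U. \<forall>b<noutc G. prefers G i a b \<longrightarrow> b \<in> U)"

definition game_name :: "nat \<Rightarrow> baire \<Rightarrow> game \<Rightarrow> bool" where
  "game_name m p G \<longleftrightarrow> wf_game G \<and>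
     bproj 0 p 0 = noutc G \<and>
     (\<forall>w. bproj 1 p (wcode w) = turn G w) \<and>
     (\<forall>a<noutc G. \<forall>b<noutc G. bproj 2 p (prod_encode (a, b)) = of_bool (pref1 G a b)) \<and>
     (\<forall>i\<in>{1, 2}. \<forall>U. upper_set G i U \<longrightarrow>
        DcoD_name m (bproj (prod_encode (i, set_encode U)) (bproj 3 p)) (val G -` U))"

definition strat_name :: "baire \<Rightarrow> strat \<Rightarrow> bool" where
  "strat_name r s \<longleftrightarrow> (\<forall>w. r (wcode w) = of_bool (s w))"

definition SPE_prob :: "nat \<Rightarrow> problem" where
  "SPE_prob m p = {r. \<exists>G s. game_name m p G \<and> is_SPE G s \<and> strat_name r s}"

end

theory Submission
  imports Defs
begin

text \<open>
  Computable functions commute with limits, so \<open>lim\<^sup>(\<^sup>n\<^sup>)\<close> is equivalent to the \<open>n\<close>-fold composition of \<open>lim\<close>,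
  and reducing a problem to it means solving the problem by \<open>n\<close> limits applied to a computable preimage.

  For the upper bound, the winning regions of a \<open>\<DD>\<^sub>n\<close> game are built up index by index: \<open>Y\<^sub>\<beta>\<close> is the region from
  which the player favouring \<open>\<beta>\<close> can, outside \<open>Y\<^sub>\<beta>\<^sub>-\<^sub>1\<close>, force a visit to \<open>U\<^sub>\<beta>\<close> or to \<open>Y\<^sub>\<beta>\<^sub>-\<^sub>2\<close>. By compactness
  membership in \<open>Y\<^sub>\<beta>\<close> has finite certificates, so each region costs one limit, and following the least certificate
  is a winning strategy. The value of a position is the best outcome that player 1 can guarantee; both players
  following the win/lose strategies that preserve the current value is a subgame perfect equilibrium.

  For the lower bound, \<open>n\<close> limits are computable from the answers to queries \<open>\<exists>m\<^sub>1 \<not> \<exists>m\<^sub>2 \<not> \<dots> R\<close> with \<open>n\<close>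
  quantifiers. In a game in which the players alternately name the witnesses, player 1 may opt out for an
  intermediate outcome, and in every equilibrium does so exactly if the answer is negative.
\<close>

text \<open>The number of limits has to come out exactly. For the upper bound, index
  \<open>n\<close> is free: nothing has to be reached there, so once the regions of the
  \<open>n\<close> smaller indices are known, levels and moves are found by plain search. One limit
  treats all outcomes and positions at once, so their number does not count. Gluing the win/lose
  strategies works because the value of the position changes in one direction only while the player
  concerned follows the strategy, hence finitely often. For the lower bound, the graph of an
  \<open>n\<close>-fold limit takes \<open>n + 1\<close> quantifiers, one too many; but the
  statement that the inner limit still differs from a candidate value after a given stage takes
  \<open>n\<close>, and a search for a negative answer recovers the limit. The answers must be
  visible in the strategy. In a win/lose game any move is part of some equilibrium at a lost
  position; the opt-out outcome lies strictly between the others, so that the move after the query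
  reveals the answer. Subgame perfection lets one game hold all queries, also off the line of
  play.\<close>

section \<open>Total recursive functions of a fixed number of arguments\<close>

definition rec_fn :: "nat => (nat list => nat) => bool" where
  "rec_fn m f \<longleftrightarrow> (\<exists>c. \<forall>xs. length xs = m --> recf_eval c xs (f xs))"

lemma rec_fn_cong:
  assumes "rec_fn m f" "\<And>xs. length xs = m ==> f xs = g xs"
  shows "rec_fn m g"
  using assms unfolding rec_fn_def by auto

lemma rec_fn_nth: "i < m ==> rec_fn m (\<lambda>xs. xs ! i)"
  unfolding rec_fn_def by (rule exI[of _ "Proj i"]) (auto intro: ev_Proj)

lemma rec_fn_comp:
  assumes f: "rec_fn (length gs) f" and g: "\<forall>g\<in>set gs. rec_fn m g"
  shows "rec_fn m (\<lambda>xs. f (map (\<lambda>g. g xs) gs))"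
proof -
  from f obtain c where c: "\<And>xs. length xs = length gs ==> recf_eval c xs (f xs)"
    unfolding rec_fn_def by auto
  from g obtain d where d: "\<And>g xs. g \<in> set gs ==> length xs = m ==> recf_eval (d g) xs (g xs)"
    unfolding rec_fn_def by metis
  show ?thesis unfolding rec_fn_def
  proof (intro exI[of _ "Comp c (map d gs)"] allI impI)
    fix xs :: "nat list" assume l: "length xs = m"
    show "recf_eval (Comp c (map d gs)) xs (f (map (\<lambda>g. g xs) gs))"
      by (rule ev_Comp[where ys = "map (\<lambda>g. g xs) gs"]) (use c d l in auto)
  qed
qed

lemma rec_fn_Suc: "rec_fn m F ==> rec_fn m (\<lambda>xs. Suc (F xs))"
proof -
  assume F: "rec_fn m F"
  have "rec_fn 1 (\<lambda>xs. Suc (xs ! 0))" unfolding rec_fn_def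
    by (rule exI[of _ S]) (auto simp: length_Suc_conv intro: ev_S)
  with rec_fn_comp[of "[F]" "\<lambda>xs. Suc (xs ! 0)" m] F show ?thesis by simp
qed

lemma rec_fn_const: "rec_fn m (\<lambda>xs. k)"
proof (induction k)
  case 0
  show ?case unfolding rec_fn_def by (rule exI[of _ Z]) (auto intro: ev_Z)
next
  case (Suc k)
  then show ?case by (rule rec_fn_Suc)
qed

lemma rec_fn_app1:
  assumes "rec_fn 1 (\<lambda>ys. f (ys ! 0))" "rec_fn m F"
  shows "rec_fn m (\<lambda>xs. f (F xs))"
  using rec_fn_comp[of "[F]" "\<lambda>ys. f (ys ! 0)" m] assms by simp

lemma rec_total2_iff: "rec_total2 f \<longleftrightarrow> rec_fn 2 (\<lambda>ys. f (ys ! 0) (ys ! 1))"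
proof
  assume "rec_total2 f"
  then obtain c where c: "\<And>a b. recf_eval c [a, b] (f a b)" unfolding rec_total2_def by auto
  then show "rec_fn 2 (\<lambda>ys. f (ys ! 0) (ys ! 1))" unfolding rec_fn_def
    by (intro exI[of _ c]) (auto simp: numeral_2_eq_2 length_Suc_conv)
next
  assume "rec_fn 2 (\<lambda>ys. f (ys ! 0) (ys ! 1))"
  then obtain c where c: "\<And>xs. length xs = 2 ==> recf_eval c xs (f (xs ! 0) (xs ! 1))"
    unfolding rec_fn_def by auto
  show "rec_total2 f" unfolding rec_total2_def
  proof (intro exI[of _ c] allI)
    fix a b show "recf_eval c [a, b] (f a b)" using c[of "[a, b]"] by simp
  qed
qed

lemma rec_fn_app2:
  assumes "rec_total2 f" "rec_fn m F" "rec_fn m G"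
  shows "rec_fn m (\<lambda>xs. f (F xs) (G xs))"
  using rec_fn_comp[of "[F, G]" "\<lambda>ys. f (ys ! 0) (ys ! 1)" m] assms
  by (simp add: rec_total2_iff numeral_2_eq_2)

text \<open>In \<open>ev_PrecS\<close> the step function receives the previous value and the counter
  in front of the parameters; this provides for step functions that look only at the
  parameters.\<close>

lemma rec_fn_shift:
  assumes "rec_fn m F" shows "rec_fn (Suc (Suc m)) (\<lambda>xs. F (drop 2 xs))"
proof -
  let ?gs = "map (\<lambda>i xs. xs ! (i + 2)) [0..<m]"
  have "rec_fn (Suc (Suc m)) (\<lambda>xs. F (map (\<lambda>g. g xs) ?gs))"
    by (rule rec_fn_comp) (use assms in \<open>auto intro!: rec_fn_nth\<close>)
  then show ?thesis
    by (rule rec_fn_cong) (auto intro!: arg_cong[where f = F] nth_equalityI simp: comp_def)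
qed

lemma rec_fn_rec:
  assumes A: "rec_fn m A" and B: "rec_fn (Suc (Suc m)) (\<lambda>ys. B (drop 2 ys) (ys ! 1) (ys ! 0))"
    and N: "rec_fn m N"
  shows "rec_fn m (\<lambda>xs. rec_nat (A xs) (B xs) (N xs))"
proof -
  from A obtain a where a: "\<And>xs. length xs = m ==> recf_eval a xs (A xs)"
    unfolding rec_fn_def by auto
  from B obtain b where b: "\<And>ys. length ys = Suc (Suc m) ==>
      recf_eval b ys (B (drop 2 ys) (ys ! 1) (ys ! 0))" unfolding rec_fn_def by auto
  have P: "recf_eval (Prec a b) (k # xs) (rec_nat (A xs) (B xs) k)" if "length xs = m" for k xs
  proof (induction k)
    case 0
    show ?case using a[OF that] by (auto intro: ev_Prec0)
  next
    case (Suc k)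
    show ?case using ev_PrecS[OF Suc, of "B xs k (rec_nat (A xs) (B xs) k)"]
        b[of "_ # k # xs"] that by simp
  qed
  have "rec_fn (Suc m) (\<lambda>ys. rec_nat (A (tl ys)) (B (tl ys)) (hd ys))" unfolding rec_fn_def
    by (rule exI[of _ "Prec a b"]) (auto simp: length_Suc_conv P)
  then have "rec_fn m (\<lambda>xs. (\<lambda>ys. rec_nat (A (tl ys)) (B (tl ys)) (hd ys))
      (map (\<lambda>g. g xs) (N # map (\<lambda>i xs. xs ! i) [0..<m])))"
    by (intro rec_fn_comp) (use N in \<open>auto intro: rec_fn_nth\<close>)
  moreover have "map (\<lambda>g. g xs) (map (\<lambda>i xs. xs ! i) [0..<m]) = xs" if "length xs = m" for xs :: "nat list"
    by (rule nth_equalityI) (use that in auto)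
  ultimately show ?thesis
    by (elim rec_fn_cong) (simp add: comp_def)
qed

lemma rec_fn_if:
  assumes "rec_fn m C" "rec_fn m A" "rec_fn m B"
  shows "rec_fn m (\<lambda>xs. if C xs = 0 then A xs else B xs)"
proof -
  have "rec_fn m (\<lambda>xs. rec_nat (A xs) (\<lambda>_ _. B xs) (C xs))"
    by (intro rec_fn_rec assms rec_fn_shift)
  moreover have "rec_nat (A xs) (\<lambda>_ _. B xs) (C xs) = (if C xs = 0 then A xs else B xs)" for xs
    by (cases "C xs") auto
  ultimately show ?thesis by simp
qed

lemma rec_fn_pred: "rec_fn m F ==> rec_fn m (\<lambda>xs. F xs - 1)"
proof -
  assume F: "rec_fn m F"
  have "rec_fn m (\<lambda>xs. rec_nat 0 (\<lambda>k _. k) (F xs))"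
    by (intro rec_fn_rec F rec_fn_const rec_fn_nth) simp
  moreover have "rec_nat 0 (\<lambda>k _. k) n = n - 1" for n by (cases n) auto
  ultimately show ?thesis by simp
qed

lemma rec_fn_minus: "rec_fn m F ==> rec_fn m G ==> rec_fn m (\<lambda>xs. F xs - G xs)"
proof -
  assume F: "rec_fn m F" and G: "rec_fn m G"
  have "rec_fn m (\<lambda>xs. rec_nat (F xs) (\<lambda>_ y. y - 1) (G xs))"
    by (intro rec_fn_rec F G rec_fn_pred rec_fn_nth) simp
  moreover have "rec_nat a (\<lambda>_ y. y - 1) n = a - n" for a n :: nat by (induction n) auto
  ultimately show ?thesis by simp
qed

lemma rec_fn_plus: "rec_fn m F ==> rec_fn m G ==> rec_fn m (\<lambda>xs. F xs + G xs)"
proof -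
  assume F: "rec_fn m F" and G: "rec_fn m G"
  have "rec_fn m (\<lambda>xs. rec_nat (F xs) (\<lambda>_ y. Suc y) (G xs))"
    by (intro rec_fn_rec F G rec_fn_Suc rec_fn_nth) simp
  moreover have "rec_nat a (\<lambda>_ y. Suc y) n = a + n" for a n :: nat by (induction n) auto
  ultimately show ?thesis by simp
qed

lemma rec_fn_triangle: "rec_fn m F ==> rec_fn m (\<lambda>xs. triangle (F xs))"
proof -
  assume F: "rec_fn m F"
  have "rec_fn m (\<lambda>xs. rec_nat 0 (\<lambda>k y. y + Suc k) (F xs))"
    by (intro rec_fn_rec F rec_fn_plus rec_fn_Suc rec_fn_nth rec_fn_const) simp_all
  moreover have "rec_nat 0 (\<lambda>k y. y + Suc k) n = triangle n" for n :: nat by (induction n) auto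
  ultimately show ?thesis by simp
qed

section \<open>Pairing and list codes\<close>

abbreviation pr :: "nat => nat => nat" where "pr a b \<equiv> prod_encode (a, b)"
definition pfst :: "nat => nat" where "pfst n = fst (prod_decode n)"
definition psnd :: "nat => nat" where "psnd n = snd (prod_decode n)"

lemma pfst_pr [simp]: "pfst (pr a b) = a" and psnd_pr [simp]: "psnd (pr a b) = b"
  and pr_pfst_psnd [simp]: "pr (pfst n) (psnd n) = n"
  by (auto simp: pfst_def psnd_def)

lemma rec_fn_pr: "rec_fn m F ==> rec_fn m G ==> rec_fn m (\<lambda>xs. pr (F xs) (G xs))"
  unfolding prod_encode_def by (simp add: rec_fn_plus rec_fn_triangle)

text \<open>The number of the diagonal on which \<open>n\<close> lies in Cantor's pairing. Walking
  up from 0 and moving on whenever the next triangular number is reached makes the inverse of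
  pairing primitive recursive.\<close>

definition troot :: "nat => nat" where
  "troot = rec_nat 0 (\<lambda>k y. if triangle (Suc y) - Suc k = 0 then Suc y else y)"

lemma troot: "triangle (troot n) \<le> n \<and> n \<le> triangle (troot n) + troot n"
  unfolding troot_def by (induction n) auto

lemma psnd_pfst_troot: "pfst n = n - triangle (troot n)" "psnd n = troot n - pfst n"
proof -
  define j where "j = n - triangle (troot n)"
  have j: "n = triangle (troot n) + j" "j \<le> troot n" using troot[of n] by (auto simp: j_def)
  have "prod_encode (j, troot n - j) = n" using j by (simp add: prod_encode_def)
  then have "prod_decode n = (j, troot n - j)" by (metis prod_encode_inverse)
  then show "pfst n = n - triangle (troot n)" "psnd n = troot n - pfst n"
    by (auto simp: pfst_def psnd_def j_def)
qed

lemma rec_fn_troot: "rec_fn m F ==> rec_fn m (\<lambda>xs. troot (F xs))"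
  unfolding troot_def
  by (intro rec_fn_rec rec_fn_if rec_fn_minus rec_fn_triangle rec_fn_Suc rec_fn_nth rec_fn_const) simp_all

lemma rec_fn_pfst: "rec_fn m F ==> rec_fn m (\<lambda>xs. pfst (F xs))"
  by (subst psnd_pfst_troot, intro rec_fn_minus rec_fn_triangle rec_fn_troot)

lemma rec_fn_psnd: "rec_fn m F ==> rec_fn m (\<lambda>xs. psnd (F xs))"
  by (subst psnd_pfst_troot, intro rec_fn_minus rec_fn_troot rec_fn_pfst)

text \<open>On the code 0 of the empty list these return the junk value 0.\<close>

definition lhd :: "nat => nat" where "lhd l = pfst (l - 1)"
definition ltl :: "nat => nat" where "ltl l = psnd (l - 1)"
definition ldrop :: "nat => nat => nat" where "ldrop l = rec_nat l (\<lambda>_. ltl)"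
definition lnth :: "nat => nat => nat" where "lnth l i = lhd (ldrop l i)"

lemma ltl_list_encode: "ltl (list_encode xs) = list_encode (tl xs)"
proof -
  have "psnd 0 = 0" using psnd_pr[of 0 0] by (simp add: prod_encode_def)
  then show ?thesis by (cases xs) (auto simp: ltl_def)
qed

lemma ldrop_list_encode: "ldrop (list_encode xs) i = list_encode (drop i xs)"
  unfolding ldrop_def by (induction i) (auto simp: ltl_list_encode drop_Suc tl_drop)

lemma list_encode_eq_0: "list_encode xs = 0 \<longleftrightarrow> xs = []"
  by (cases xs) auto

lemma ldrop_eq_0: "ldrop (list_encode xs) i = 0 \<longleftrightarrow> length xs \<le> i"
  by (simp add: ldrop_list_encode list_encode_eq_0)

lemma lnth_list_encode: "i < length xs ==> lnth (list_encode xs) i = xs ! i"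
  by (simp add: lnth_def ldrop_list_encode lhd_def Cons_nth_drop_Suc[symmetric])

lemma rec_fn_ldrop: "rec_fn m F ==> rec_fn m G ==> rec_fn m (\<lambda>xs. ldrop (F xs) (G xs))"
  unfolding ldrop_def ltl_def
  by (intro rec_fn_rec rec_fn_psnd rec_fn_pred rec_fn_nth) simp_all

lemma rec_fn_lnth: "rec_fn m F ==> rec_fn m G ==> rec_fn m (\<lambda>xs. lnth (F xs) (G xs))"
  unfolding lnth_def lhd_def by (intro rec_fn_pfst rec_fn_pred rec_fn_ldrop)

lemma length_le_list_encode: "length xs \<le> list_encode xs"
proof (induction xs)
  case (Cons x xs)
  then show ?case using le_prod_encode_2[of "list_encode xs" x] by simp
qed simp

section \<open>Uniform computability relative to an oracle\<close>

text \<open>Demanding the answer at all late stages, not just at one as in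
  \<open>computable\<close>, keeps the answers of several subcomputations available at a common
  stage, so that they can be combined.\<close>

definition settles :: "(nat => nat) => nat => bool" where
  "settles u y \<longleftrightarrow> (\<forall>\<^sub>F k in sequentially. u k = Suc y) \<and> (\<forall>k. u k \<in> {0, Suc y})"

lemma settles_const: "settles (\<lambda>k. Suc y) y"
  by (simp add: settles_def)

lemma settles_eq: "settles u y ==> u k \<noteq> 0 ==> u k = Suc y"
  unfolding settles_def by (metis empty_iff insert_iff)

lemma settles_ex: "settles u y ==> \<exists>k. u k \<noteq> 0"
  unfolding settles_def eventually_sequentially by (metis nat.distinct(1) order.refl)

lemma settlesI:
  "(\<forall>\<^sub>F k in sequentially. u k = Suc y) ==> (\<And>k. u k \<noteq> 0 ==> u k = Suc y) ==> settles u y"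
  unfolding settles_def by blast

lemma settles_bind:
  assumes u: "settles u y" and v: "settles (v y) z"
  shows "settles (\<lambda>k. if u k = 0 then 0 else v (u k - 1) k) z"
proof (rule settlesI)
  have "\<forall>\<^sub>F k in sequentially. u k = Suc y" "\<forall>\<^sub>F k in sequentially. v y k = Suc z"
    using u v by (simp_all add: settles_def)
  then show "\<forall>\<^sub>F k in sequentially. (if u k = 0 then 0 else v (u k - 1) k) = Suc z"
    by eventually_elim simp
next
  fix k assume nz: "(if u k = 0 then 0 else v (u k - 1) k) \<noteq> 0"
  then have "u k \<noteq> 0" by (simp split: if_splits)
  from settles_eq[OF u this] nz settles_eq[OF v, of k]
  show "(if u k = 0 then 0 else v (u k - 1) k) = Suc z" by simp
qed

text \<open>Two readings are used throughout: \<open>F\<close> as a functional on Baire space with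
  domain \<open>D\<close>, and \<open>F p\<close> as a number function computable from the oracle
  \<open>p\<close>, uniformly in \<open>p\<close>. Programs are built in the second reading.\<close>

definition comp_on :: "baire set => (baire => nat => nat) => bool" where
  "comp_on D F \<longleftrightarrow>
     (\<exists>\<phi>. rec_total2 \<phi> \<and> (\<forall>p\<in>D. \<forall>x. settles (\<lambda>k. \<phi> x (prefix_code p k)) (F p x)))"

lemma comp_onI:
  assumes "rec_fn 2 (\<lambda>ys. \<phi> (ys ! 0) (ys ! 1))"
    and "\<And>p x. p \<in> D ==> settles (\<lambda>k. \<phi> x (prefix_code p k)) (F p x)"
  shows "comp_on D F"
  unfolding comp_on_def rec_total2_iff using assms by blast

lemma comp_onE:
  assumes "comp_on D F"
  obtains \<phi> where "rec_total2 \<phi>" "\<And>p x. p \<in> D ==> settles (\<lambda>k. \<phi> x (prefix_code p k)) (F p x)"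
  using assms unfolding comp_on_def by blast

lemma comp_on_cong: "comp_on D F ==> (\<And>p x. p \<in> D ==> F p x = G p x) ==> comp_on D G"
  unfolding comp_on_def by simp

lemma comp_on_subset: "comp_on D F ==> D' \<subseteq> D ==> comp_on D' F"
  unfolding comp_on_def by blast

lemma comp_on_id: "comp_on D (\<lambda>p x. x)"
  by (rule comp_onI[where \<phi> = "\<lambda>x _. Suc x"]) (auto intro!: rec_fn_Suc rec_fn_nth settles_const)

lemma comp_on_const: "comp_on D (\<lambda>p x. c)"
  by (rule comp_onI[where \<phi> = "\<lambda>x _. Suc c"]) (auto intro!: rec_fn_const settles_const)

lemma comp_on_subst:
  assumes "comp_on D F" "comp_on D G"
  shows "comp_on D (\<lambda>p x. F p (G p x))"
proof -
  obtain \<phi> where f: "rec_total2 \<phi>" "\<And>p x. p \<in> D ==> settles (\<lambda>k. \<phi> x (prefix_code p k)) (F p x)"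
    using comp_onE[OF assms(1)] by metis
  obtain \<psi> where g: "rec_total2 \<psi>" "\<And>p x. p \<in> D ==> settles (\<lambda>k. \<psi> x (prefix_code p k)) (G p x)"
    using comp_onE[OF assms(2)] by metis
  show ?thesis
  proof (rule comp_onI[where \<phi> = "\<lambda>x s. if \<psi> x s = 0 then 0 else \<phi> (\<psi> x s - 1) s"])
    show "rec_fn 2 (\<lambda>ys. if \<psi> (ys ! 0) (ys ! 1) = 0 then 0 else \<phi> (\<psi> (ys ! 0) (ys ! 1) - 1) (ys ! 1))"
      by (intro rec_fn_if rec_fn_app2[OF f(1)] rec_fn_app2[OF g(1)] rec_fn_pred rec_fn_const rec_fn_nth) auto
    fix p x assume p: "p \<in> D"
    show "settles (\<lambda>k. if \<psi> x (prefix_code p k) = 0 then 0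
        else \<phi> (\<psi> x (prefix_code p k) - 1) (prefix_code p k)) (F p (G p x))"
      by (rule settles_bind[where v = "\<lambda>y k. \<phi> y (prefix_code p k)", OF g(2)[OF p] f(2)[OF p]])
  qed
qed

lemma comp_on_rec1:
  assumes "rec_fn 1 (\<lambda>ys. f (ys ! 0))" "comp_on D F"
  shows "comp_on D (\<lambda>p x. f (F p x))"
proof (rule comp_on_subst[of D "\<lambda>p x. f x", OF _ assms(2)])
  show "comp_on D (\<lambda>p. f)"
    by (rule comp_onI[where \<phi> = "\<lambda>x _. Suc (f x)"])
      (auto intro!: rec_fn_Suc rec_fn_app1[OF assms(1)] rec_fn_nth settles_const)
qed

lemma comp_on_pr:
  assumes "comp_on D F" "comp_on D G"
  shows "comp_on D (\<lambda>p x. pr (F p x) (G p x))"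
proof -
  obtain \<phi> where f: "rec_total2 \<phi>" "\<And>p x. p \<in> D ==> settles (\<lambda>k. \<phi> x (prefix_code p k)) (F p x)"
    using comp_onE[OF assms(1)] by metis
  obtain \<psi> where g: "rec_total2 \<psi>" "\<And>p x. p \<in> D ==> settles (\<lambda>k. \<psi> x (prefix_code p k)) (G p x)"
    using comp_onE[OF assms(2)] by metis
  show ?thesis
  proof (rule comp_onI[where \<phi> = "\<lambda>x s. if \<phi> x s = 0 then 0 else if \<psi> x s = 0 then 0
      else Suc (pr (\<phi> x s - 1) (\<psi> x s - 1))"])
    show "rec_fn 2 (\<lambda>ys. if \<phi> (ys ! 0) (ys ! 1) = 0 then 0 else if \<psi> (ys ! 0) (ys ! 1) = 0 then 0
      else Suc (pr (\<phi> (ys ! 0) (ys ! 1) - 1) (\<psi> (ys ! 0) (ys ! 1) - 1)))"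
      by (intro rec_fn_if rec_fn_app2[OF f(1)] rec_fn_app2[OF g(1)] rec_fn_Suc rec_fn_pr rec_fn_pred
          rec_fn_const rec_fn_nth) auto
    fix p x assume p: "p \<in> D"
    have "settles (\<lambda>k. if \<psi> x (prefix_code p k) = 0 then 0
        else Suc (pr y (\<psi> x (prefix_code p k) - 1))) (pr y (G p x))" for y
      by (rule settles_bind[where v = "\<lambda>z k. Suc (pr y z)", OF g(2)[OF p] settles_const])
    then show "settles (\<lambda>k. if \<phi> x (prefix_code p k) = 0 then 0 else if \<psi> x (prefix_code p k) = 0 then 0
        else Suc (pr (\<phi> x (prefix_code p k) - 1) (\<psi> x (prefix_code p k) - 1))) (pr (F p x) (G p x))"
      by (rule settles_bind[where v = "\<lambda>y k. if \<psi> x (prefix_code p k) = 0 then 0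
        else Suc (pr y (\<psi> x (prefix_code p k) - 1))", OF f(2)[OF p]])
  qed
qed

lemma comp_on_pfst: "comp_on D F ==> comp_on D (\<lambda>p x. pfst (F p x))"
  by (rule comp_on_rec1) (auto intro: rec_fn_pfst rec_fn_nth)

lemma comp_on_psnd: "comp_on D F ==> comp_on D (\<lambda>p x. psnd (F p x))"
  by (rule comp_on_rec1) (auto intro: rec_fn_psnd rec_fn_nth)

lemma comp_on_rec2:
  assumes "rec_total2 f" "comp_on D F" "comp_on D G"
  shows "comp_on D (\<lambda>p x. f (F p x) (G p x))"
proof -
  have "comp_on D (\<lambda>p x. (\<lambda>z. f (pfst z) (psnd z)) (pr (F p x) (G p x)))"
    by (rule comp_on_rec1)
      (auto intro!: rec_fn_app2[OF assms(1)] rec_fn_pfst rec_fn_psnd rec_fn_nth comp_on_pr assms(2,3))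
  then show ?thesis by simp
qed

lemma comp_on_Suc: "comp_on D F ==> comp_on D (\<lambda>p x. Suc (F p x))"
  by (rule comp_on_rec1) (auto intro: rec_fn_Suc rec_fn_nth)

text \<open>A program sees the code of the prefix but not its length; as the code eventually exceeds
  any bound, it can double as the number of steps to run.\<close>

lemma eventually_prefix_code_ge: "\<forall>\<^sub>F k in sequentially. m \<le> prefix_code p k"
  unfolding eventually_sequentially prefix_code_def
  using length_le_list_encode order.trans by (metis diff_zero length_map length_upt)

lemma comp_on_oracle:
  assumes "comp_on D F"
  shows "comp_on D (\<lambda>p x. p (F p x))"
proof (rule comp_on_subst[of D "\<lambda>p. p", OF _ assms])
  show "comp_on D (\<lambda>p. p)"
  proof (rule comp_onI[where \<phi> = "\<lambda>x s. if ldrop s x = 0 then 0 else Suc (lnth s x)"])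
    show "rec_fn 2 (\<lambda>ys. if ldrop (ys ! 1) (ys ! 0) = 0 then 0 else Suc (lnth (ys ! 1) (ys ! 0)))"
      by (intro rec_fn_if rec_fn_ldrop rec_fn_lnth rec_fn_Suc rec_fn_const rec_fn_nth) auto
    fix p :: baire and x
    have eq: "(if ldrop (prefix_code p k) x = 0 then 0 else Suc (lnth (prefix_code p k) x)) =
        (if x < k then Suc (p x) else 0)" for k
      by (simp add: prefix_code_def ldrop_eq_0 lnth_list_encode)
    show "settles (\<lambda>k. if ldrop (prefix_code p k) x = 0 then 0 else Suc (lnth (prefix_code p k) x)) (p x)"
      unfolding eq
    proof (rule settlesI)
      show "\<forall>\<^sub>F k in sequentially. (if x < k then Suc (p x) else 0) = Suc (p x)"
        using eventually_gt_at_top[of x] by eventually_elim simp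
    qed (simp split: if_splits)
  qed
qed

lemma comp_on_rec_nat:
  assumes "comp_on D A" and "comp_on D (\<lambda>p z. B p (pfst z) (pfst (psnd z)) (psnd (psnd z)))" and "comp_on D N"
  shows "comp_on D (\<lambda>p x. rec_nat (A p x) (B p x) (N p x))"
proof -
  obtain \<alpha> where a: "rec_total2 \<alpha>" "\<And>p x. p \<in> D ==> settles (\<lambda>k. \<alpha> x (prefix_code p k)) (A p x)"
    using comp_onE[OF assms(1)] by metis
  obtain \<nu> where n: "rec_total2 \<nu>" "\<And>p x. p \<in> D ==> settles (\<lambda>k. \<nu> x (prefix_code p k)) (N p x)"
    using comp_onE[OF assms(3)] by metis
  obtain \<beta> where b: "rec_total2 \<beta>" "\<And>p x. p \<in> D ==> settles (\<lambda>k. \<beta> x (prefix_code p k))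
        (B p (pfst x) (pfst (psnd x)) (psnd (psnd x)))"
    using comp_onE[OF assms(2)] by metis
  define \<rho> where "\<rho> x s = rec_nat (\<alpha> x s) (\<lambda>k y. if y = 0 then 0 else \<beta> (pr x (pr k (y - 1))) s)" for x s
  have \<rho>: "settles (\<lambda>k. \<rho> x (prefix_code p k) i) (rec_nat (A p x) (B p x) i)" if p: "p \<in> D" for p x i
  proof (induction i)
    case 0
    show ?case using a(2)[OF p] by (simp add: \<rho>_def)
  next
    case (Suc i)
    have "settles (\<lambda>k. \<beta> (pr x (pr i y)) (prefix_code p k)) (B p x i y)" for y
      using b(2)[OF p, of "pr x (pr i y)"] by simp
    from settles_bind[where v = "\<lambda>y k. \<beta> (pr x (pr i y)) (prefix_code p k)", OF Suc this]
    moreover have "\<rho> x s (Suc i) = (if \<rho> x s i = 0 then 0 else \<beta> (pr x (pr i (\<rho> x s i - 1))) s)" for s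
      by (simp add: \<rho>_def)
    ultimately show ?case by simp
  qed
  show ?thesis
  proof (rule comp_onI[where \<phi> = "\<lambda>x s. if \<nu> x s = 0 then 0 else \<rho> x s (\<nu> x s - 1)"])
    show "rec_fn 2 (\<lambda>ys. if \<nu> (ys ! 0) (ys ! 1) = 0 then 0 else \<rho> (ys ! 0) (ys ! 1) (\<nu> (ys ! 0) (ys ! 1) - 1))"
      unfolding \<rho>_def
      by (intro rec_fn_if rec_fn_rec rec_fn_app2[OF n(1)] rec_fn_app2[OF a(1)] rec_fn_app2[OF b(1)] rec_fn_pr rec_fn_pred
          rec_fn_const rec_fn_nth rec_fn_shift[OF rec_fn_nth]) auto
    fix p x assume p: "p \<in> D"
    show "settles (\<lambda>k. if \<nu> x (prefix_code p k) = 0 then 0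
        else \<rho> x (prefix_code p k) (\<nu> x (prefix_code p k) - 1)) (rec_nat (A p x) (B p x) (N p x))"
      by (rule settles_bind[where v = "\<lambda>i k. \<rho> x (prefix_code p k) i", OF n(2)[OF p] \<rho>[OF p]])
  qed
qed

text \<open>The search may not skip an argument whose value is still unknown: a later zero reported
  too early would have to be revised, which \<open>settles\<close> forbids. Hence the search gets
  stuck there and waits for a longer prefix.\<close>

lemma comp_on_Least_zero:
  assumes "comp_on D (\<lambda>p z. P p (pfst z) (psnd z))" and ex: "\<And>p x. p \<in> D ==> \<exists>m. P p x m = 0"
  shows "comp_on D (\<lambda>p x. LEAST m. P p x m = 0)"
proof -
  obtain \<phi> where f: "rec_total2 \<phi>"
    "\<And>p x. p \<in> D ==> settles (\<lambda>k. \<phi> x (prefix_code p k)) (P p (pfst x) (psnd x))"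
    using comp_onE[OF assms(1)] by metis
  have f2: "settles (\<lambda>k. \<phi> (pr x m) (prefix_code p k)) (P p x m)" if "p \<in> D" for p x m
    using f(2)[OF that, of "pr x m"] by simp
  \<comment> \<open>The state of the search is 0 while it runs, 1 once it is stuck and \<open>m + 2\<close> once it has found \<open>m\<close>.\<close>
  define \<rho> where "\<rho> x s = rec_nat 0 (\<lambda>k y. if y = 0 then
      (if \<phi> (pr x k) s = 0 then 1 else if \<phi> (pr x k) s - 1 = 0 then k + 2 else 0) else y)" for x s
  have zero: "\<phi> (pr x j) s - 1 \<noteq> 0" if "\<rho> x s i = 0" "j < i" for x s i j
    using that by (induction i) (auto simp: \<rho>_def less_Suc_eq split: if_splits)
  have ok: "\<rho> x (prefix_code p k) i \<in> {0, 1, (LEAST m. P p x m = 0) + 2}" if p: "p \<in> D" for p x k i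
  proof (induction i)
    case 0
    show ?case by (simp add: \<rho>_def)
  next
    case (Suc i)
    let ?s = "prefix_code p k"
    show ?case
    proof (cases "\<rho> x ?s i = 0 \<and> \<phi> (pr x i) ?s \<noteq> 0 \<and> \<phi> (pr x i) ?s - 1 = 0")
      case False
      then show ?thesis using Suc by (auto simp: \<rho>_def)
    next
      case True
      have "P p x i = 0" using True settles_eq[OF f2[OF p], of x i k] by simp
      moreover have "P p x j \<noteq> 0" if "j < i" for j
      proof -
        have "\<phi> (pr x j) ?s - 1 \<noteq> 0" using zero True that by blast
        then show ?thesis using settles_eq[OF f2[OF p], of x j k] by (cases "\<phi> (pr x j) ?s = 0") auto
      qed
      ultimately have "(LEAST m. P p x m = 0) = i" by (intro Least_equality) (metis not_le)+
      then show ?thesis using True by (simp add: \<rho>_def)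
    qed
  qed
  have ev: "\<forall>\<^sub>F k in sequentially. \<rho> x (prefix_code p k) (prefix_code p k) = (LEAST m. P p x m = 0) + 2"
    if p: "p \<in> D" for p x
  proof -
    define m where "m = (LEAST m. P p x m = 0)"
    have m: "P p x m = 0" "\<And>j. j < m ==> P p x j \<noteq> 0"
      using ex[OF p] LeastI_ex[of "\<lambda>m. P p x m = 0"] not_less_Least unfolding m_def by blast+
    have "\<forall>\<^sub>F k in sequentially. \<forall>j\<in>{..m}. \<phi> (pr x j) (prefix_code p k) = Suc (P p x j)"
      by (subst eventually_ball_finite_distrib) (use f2[OF p] in \<open>auto simp: settles_def\<close>)
    then show ?thesis using eventually_prefix_code_ge[of "Suc m" p]
    proof eventually_elim
      case (elim k)
      let ?s = "prefix_code p k"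
      have z: "i \<le> m ==> \<rho> x ?s i = 0" for i
      proof (induction i)
        case (Suc i)
        then show ?case using elim(1) m(2)[of i] by (simp add: \<rho>_def)
      qed (simp add: \<rho>_def)
      have "\<rho> x ?s (Suc m + d) = m + 2" for d
      proof (induction d)
        case 0
        show ?case using z[of m] elim(1) m(1) by (simp add: \<rho>_def)
      next
        case (Suc d)
        then show ?case by (simp add: \<rho>_def)
      qed
      from this[of "?s - Suc m"] elim(2) show ?case by (simp add: m_def)
    qed
  qed
  show ?thesis
  proof (rule comp_onI[where \<phi> = "\<lambda>x s. \<rho> x s s - 1"])
    show "rec_fn 2 (\<lambda>ys. \<rho> (ys ! 0) (ys ! 1) (ys ! 1) - 1)"
      unfolding \<rho>_def
      by (intro rec_fn_pred rec_fn_rec rec_fn_if rec_fn_app2[OF f(1)] rec_fn_pr rec_fn_plus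
          rec_fn_const rec_fn_nth rec_fn_shift[OF rec_fn_nth]) auto
    fix p x assume p: "p \<in> D"
    show "settles (\<lambda>k. \<rho> x (prefix_code p k) (prefix_code p k) - 1) (LEAST m. P p x m = 0)"
    proof (rule settlesI)
      from ev[OF p, of x]
      show "\<forall>\<^sub>F k in sequentially. \<rho> x (prefix_code p k) (prefix_code p k) - 1 = Suc (LEAST m. P p x m = 0)"
        by eventually_elim simp
      fix k assume "\<rho> x (prefix_code p k) (prefix_code p k) - 1 \<noteq> 0"
      then show "\<rho> x (prefix_code p k) (prefix_code p k) - 1 = Suc (LEAST m. P p x m = 0)"
        using ok[OF p, of x k "prefix_code p k"] by auto
    qed
  qed
qed

section \<open>Closure properties of oracle computability\<close>

named_theorems comp_intros

lemmas [comp_intros] = comp_on_id comp_on_const comp_on_pr comp_on_pfst comp_on_psnd comp_on_Suc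
  comp_on_oracle comp_on_rec_nat

lemma
  assumes "comp_on D F" "comp_on D G"
  shows comp_on_plus [comp_intros]: "comp_on D (\<lambda>p x. F p x + G p x)"
    and comp_on_minus [comp_intros]: "comp_on D (\<lambda>p x. F p x - G p x)"
    and comp_on_ldrop [comp_intros]: "comp_on D (\<lambda>p x. ldrop (F p x) (G p x))"
    and comp_on_lnth [comp_intros]: "comp_on D (\<lambda>p x. lnth (F p x) (G p x))"
  by (rule comp_on_rec2[OF _ assms];
      auto simp: rec_total2_iff intro!: rec_fn_plus rec_fn_minus rec_fn_ldrop rec_fn_lnth rec_fn_nth)+

lemma comp_on_times [comp_intros]:
  assumes "comp_on D F" "comp_on D G" shows "comp_on D (\<lambda>p x. F p x * G p x)"
proof -
  have "comp_on D (\<lambda>p x. rec_nat 0 (\<lambda>_ y. y + F p x) (G p x))"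
    by (intro comp_intros assms comp_on_subst[OF assms(1)])
  moreover have "rec_nat 0 (\<lambda>_ y. y + a) n = a * n" for a n :: nat by (induction n) auto
  ultimately show ?thesis by simp
qed

lemma comp_on_power [comp_intros]:
  assumes "comp_on D F" "comp_on D G" shows "comp_on D (\<lambda>p x. F p x ^ G p x)"
proof -
  have "comp_on D (\<lambda>p x. rec_nat 1 (\<lambda>_ y. y * F p x) (G p x))"
    by (intro comp_intros assms comp_on_subst[OF assms(1)])
  moreover have "rec_nat 1 (\<lambda>_ y. y * a) n = a ^ n" for a n :: nat by (induction n) auto
  ultimately show ?thesis by simp
qed

lemma comp_on_if [comp_intros]:
  assumes "comp_on D (\<lambda>p x. of_bool (C p x))" "comp_on D A" "comp_on D B"
  shows "comp_on D (\<lambda>p x. if C p x then A p x else B p x)"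
proof -
  have "comp_on D (\<lambda>p x. rec_nat (B p x) (\<lambda>_ _. A p x) (of_bool (C p x)))"
    by (intro comp_intros assms comp_on_subst[OF assms(2)])
  then show ?thesis by (rule comp_on_cong) simp
qed

lemma comp_on_less [comp_intros]:
  assumes "comp_on D F" "comp_on D G" shows "comp_on D (\<lambda>p x. of_bool (F p x < G p x))"
  by (rule comp_on_cong[where F = "\<lambda>p x. 1 - (1 - (G p x - F p x))"], intro comp_intros assms) auto

lemma comp_on_not [comp_intros]:
  assumes "comp_on D (\<lambda>p x. of_bool (P p x))" shows "comp_on D (\<lambda>p x. of_bool (\<not> P p x))"
  by (rule comp_on_cong[where F = "\<lambda>p x. 1 - of_bool (P p x)"], intro comp_intros assms) auto

lemma comp_on_conj [comp_intros]:
  assumes "comp_on D (\<lambda>p x. of_bool (P p x))" "comp_on D (\<lambda>p x. of_bool (Q p x))"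
  shows "comp_on D (\<lambda>p x. of_bool (P p x \<and> Q p x))"
  by (rule comp_on_cong[where F = "\<lambda>p x. of_bool (P p x) * of_bool (Q p x)"], intro comp_intros assms) auto

lemma comp_on_disj [comp_intros]:
  assumes "comp_on D (\<lambda>p x. of_bool (P p x))" "comp_on D (\<lambda>p x. of_bool (Q p x))"
  shows "comp_on D (\<lambda>p x. of_bool (P p x \<or> Q p x))"
  by (rule comp_on_cong[where F = "\<lambda>p x. of_bool (\<not> (\<not> P p x \<and> \<not> Q p x))"], intro comp_intros assms) auto

lemma comp_on_imp [comp_intros]:
  assumes "comp_on D (\<lambda>p x. of_bool (P p x))" "comp_on D (\<lambda>p x. of_bool (Q p x))"
  shows "comp_on D (\<lambda>p x. of_bool (P p x --> Q p x))"
  by (rule comp_on_cong[where F = "\<lambda>p x. of_bool (\<not> P p x \<or> Q p x)"], intro comp_intros assms) auto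

lemma comp_on_le [comp_intros]:
  assumes "comp_on D F" "comp_on D G" shows "comp_on D (\<lambda>p x. of_bool (F p x \<le> G p x))"
  unfolding not_less[symmetric] by (intro comp_intros assms)

lemma comp_on_eq [comp_intros]:
  fixes F G :: "baire => nat => nat"
  assumes "comp_on D F" "comp_on D G" shows "comp_on D (\<lambda>p x. of_bool (F p x = G p x))"
  unfolding order_eq_iff by (intro comp_intros assms)

lemma comp_on_bex [comp_intros]:
  assumes "comp_on D (\<lambda>p z. of_bool (P p (pfst z) (psnd z)))" "comp_on D N"
  shows "comp_on D (\<lambda>p x. of_bool (\<exists>m<N p x. P p x m))"
proof -
  have P: "comp_on D (\<lambda>p z. of_bool (P p (pfst z) (pfst (psnd z))))"
    using comp_on_subst[OF assms(1), of "\<lambda>p z. pr (pfst z) (pfst (psnd z))"]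
    by (simp add: comp_intros)
  have "comp_on D (\<lambda>p x. rec_nat 0 (\<lambda>m y. if P p x m then 1 else y) (N p x))"
    by (intro comp_intros assms P)
  moreover have "rec_nat 0 (\<lambda>m y. if Q m then 1 else y) n = (of_bool (\<exists>m<n. Q m) :: nat)" for Q n
    by (induction n) (auto simp: less_Suc_eq)
  ultimately show ?thesis by simp
qed

lemma comp_on_ball [comp_intros]:
  assumes "comp_on D (\<lambda>p z. of_bool (P p (pfst z) (psnd z)))" "comp_on D N"
  shows "comp_on D (\<lambda>p x. of_bool (\<forall>m<N p x. P p x m))"
  by (rule comp_on_cong[where F = "\<lambda>p x. of_bool (\<not> (\<exists>m<N p x. \<not> P p x m))"], intro comp_intros assms) auto

lemma comp_on_Least [comp_intros]:
  assumes "comp_on D (\<lambda>p z. of_bool (P p (pfst z) (psnd z)))" "\<And>p x. p \<in> D ==> \<exists>m. P p x m"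
  shows "comp_on D (\<lambda>p x. LEAST m. P p x m)"
proof -
  have "comp_on D (\<lambda>p x. LEAST m. (of_bool (\<not> P p x m) :: nat) = 0)"
    by (rule comp_on_Least_zero) (auto intro: comp_on_not assms)
  then show ?thesis by simp
qed

lemma comp_on_div2 [comp_intros]:
  assumes "comp_on D F" shows "comp_on D (\<lambda>p x. F p x div 2)"
proof -
  have "comp_on D (\<lambda>p x. LEAST m. F p x < 2 * m + 2)"
    by (intro comp_intros comp_on_subst[OF assms]) presburger
  moreover have "(LEAST m. n < 2 * m + 2) = n div 2" for n :: nat
    by (rule Least_equality) auto
  ultimately show ?thesis by simp
qed

lemma comp_on_even [comp_intros]:
  assumes "comp_on D F" shows "comp_on D (\<lambda>p x. of_bool (even (F p x)))"
proof -
  have "comp_on D (\<lambda>p x. of_bool (2 * (F p x div 2) = F p x))" by (intro comp_intros assms)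
  moreover have "2 * (n div 2) = n \<longleftrightarrow> even n" for n :: nat by presburger
  ultimately show ?thesis by simp
qed

lemma comp_on_mod2 [comp_intros]:
  assumes "comp_on D F" shows "comp_on D (\<lambda>p x. F p x mod 2)"
proof -
  have "comp_on D (\<lambda>p x. F p x - 2 * (F p x div 2))" by (intro comp_intros assms)
  then show ?thesis by (rule comp_on_cong) (simp add: minus_mult_div_eq_mod)
qed

lemma comp_on_sum [comp_intros]:
  assumes "comp_on D (\<lambda>p z. F p (pfst z) (psnd z))" "comp_on D N"
  shows "comp_on D (\<lambda>p x. \<Sum>m<N p x. F p x m)"
proof -
  have F: "comp_on D (\<lambda>p z. F p (pfst z) (pfst (psnd z)))"
    using comp_on_subst[OF assms(1), of "\<lambda>p z. pr (pfst z) (pfst (psnd z))"]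
    by (simp add: comp_intros)
  have "comp_on D (\<lambda>p x. rec_nat 0 (\<lambda>m y. y + F p x m) (N p x))"
    by (intro comp_intros assms F)
  moreover have "rec_nat 0 (\<lambda>m y. y + f m) n = (\<Sum>m<n. f m)" for f :: "nat => nat" and n
    by (induction n) auto
  ultimately show ?thesis by simp
qed

lemma set_decode_iff: "a \<in> set_decode f \<longleftrightarrow> odd (rec_nat f (\<lambda>_ y. y div 2) a)"
proof -
  have "rec_nat f (\<lambda>_ y. y div 2) a = f div 2 ^ a"
    by (induction a) (auto simp: div_mult2_eq[symmetric] mult.commute)
  then show ?thesis by (simp add: set_decode_def)
qed

lemma comp_on_set_decode [comp_intros]:
  assumes "comp_on D F" "comp_on D G"
  shows "comp_on D (\<lambda>p x. of_bool (F p x \<in> set_decode (G p x)))"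
  unfolding set_decode_iff by (intro comp_intros assms)

text \<open>Codes of lists grow at the head, so the recursion starts with the last entry; this is
  the reason for the reversed index.\<close>

lemma comp_on_map_upt [comp_intros]:
  assumes "comp_on D (\<lambda>p z. F p (pfst z) (psnd z))" "comp_on D N"
  shows "comp_on D (\<lambda>p x. list_encode (map (F p x) [0..<N p x]))"
proof -
  have F: "comp_on D (\<lambda>p z. F p (pfst z) (N p (pfst z) - Suc (pfst (psnd z))))"
    using comp_on_subst[OF assms(1), of "\<lambda>p z. pr (pfst z) (N p (pfst z) - Suc (pfst (psnd z)))"]
    by (simp add: comp_intros comp_on_subst[OF assms(2)])
  have "comp_on D (\<lambda>p x. rec_nat 0 (\<lambda>k y. Suc (pr (F p x (N p x - Suc k)) y)) (N p x))"
    by (intro comp_intros assms F)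
  moreover have "k \<le> n ==> rec_nat 0 (\<lambda>k y. Suc (pr (f (n - Suc k)) y)) k = list_encode (map f [n - k..<n])"
    for f n k
  proof (induction k)
    case (Suc k)
    then have "[n - Suc k..<n] = (n - Suc k) # [n - k..<n]"
      by (metis Suc_diff_Suc diff_less less_eq_Suc_le upt_conv_Cons zero_less_Suc less_le_trans)
    with Suc show ?case by simp
  qed simp
  from this[OF order.refl] have "rec_nat 0 (\<lambda>k y. Suc (pr (f (n - Suc k)) y)) n = list_encode (map f [0..<n])"
    for f n by simp
  ultimately show ?thesis by simp
qed

text \<open>While \<open>comp_on_subst\<close> substitutes for the number argument, here the oracle
  itself is replaced. Prefixes of the new oracle can be computed, so one can search for the first of
  them on which the program for \<open>F\<close> answers, and a program that settles never answers
  wrongly.\<close>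

lemma comp_on_compose:
  assumes F: "comp_on E F" and G: "comp_on D (\<lambda>p z. G p (pfst z) (psnd z))" and H: "comp_on D H"
    and GE: "\<And>p x. p \<in> D ==> G p x \<in> E"
  shows "comp_on D (\<lambda>p x. F (G p x) (H p x))"
proof -
  obtain \<phi> where f: "rec_total2 \<phi>" "\<And>p x. p \<in> E ==> settles (\<lambda>k. \<phi> x (prefix_code p k)) (F p x)"
    using comp_onE[OF F] by metis
  have G': "comp_on D (\<lambda>p z. G p (A p z) (B p z))" if "comp_on D A" "comp_on D B" for A B
    using comp_on_subst[OF G, of "\<lambda>p z. pr (A p z) (B p z)"] that by (simp add: comp_intros)
  let ?P = "\<lambda>p x m. \<phi> (H p x) (prefix_code (G p x) m) \<noteq> 0"
  have ex: "\<exists>m. ?P p x m" if "p \<in> D" for p x by (rule settles_ex[OF f(2)[OF GE[OF that]]])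
  have P: "comp_on D (\<lambda>p z. of_bool (?P p (pfst z) (psnd z)))" unfolding prefix_code_def
    by (intro comp_intros comp_on_rec2[OF f(1)] comp_on_subst[OF H] G')
  have "comp_on D (\<lambda>p x. \<phi> (H p x) (prefix_code (G p x) (LEAST m. ?P p x m)) - 1)"
    unfolding prefix_code_def
    by (intro comp_intros comp_on_rec2[OF f(1)] H G' comp_on_subst[OF comp_on_Least] P[unfolded prefix_code_def])
      (use ex in \<open>auto simp: prefix_code_def\<close>)
  then show ?thesis
  proof (rule comp_on_cong)
    fix p x assume p: "p \<in> D"
    have "?P p x (LEAST m. ?P p x m)" using ex[OF p] by (rule LeastI_ex)
    from settles_eq[OF f(2)[OF GE[OF p]] this]
    show "\<phi> (H p x) (prefix_code (G p x) (LEAST m. ?P p x m)) - 1 = F (G p x) (H p x)" by simp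
  qed
qed

lemma comp_on_comp:
  assumes F: "comp_on E F" and G: "comp_on D G" and GE: "\<And>p. p \<in> D ==> G p \<in> E"
  shows "comp_on D (\<lambda>p. F (G p))"
  by (rule comp_on_compose[OF F, of D "\<lambda>p x. G p" "\<lambda>p x. x"])
    (auto intro!: comp_intros comp_on_subst[OF G] GE)

text \<open>The program behind \<open>computable\<close> may fall silent again after answering.
  Searching for the first prefix with an answer makes the answer permanent.\<close>

lemma computable_iff_comp_on: "computable K \<longleftrightarrow> comp_on (dom K) (\<lambda>p. the (K p))"
proof
  assume "computable K"
  then obtain \<phi> where f: "rec_total2 \<phi>" and ex: "\<And>p r n. K p = Some r ==> \<exists>k. \<phi> n (prefix_code p k) = Suc (r n)"
    and ok: "\<And>p r n k. K p = Some r ==> \<phi> n (prefix_code p k) \<in> {0, Suc (r n)}"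
    unfolding computable_def by blast
  have "comp_on (dom K) (\<lambda>p n. \<phi> n (list_encode (map p [0..<LEAST k. \<phi> n (list_encode (map p [0..<k])) \<noteq> 0])) - 1)"
  proof (intro comp_intros comp_on_rec2[OF f] comp_on_subst[OF comp_on_Least])
    fix p x assume "p \<in> dom K"
    then show "\<exists>m. \<phi> x (list_encode (map p [0..<m])) \<noteq> 0"
      using ex[of p _ x] by (auto simp: prefix_code_def) (metis zero_less_Suc)
  qed
  then show "comp_on (dom K) (\<lambda>p. the (K p))"
  proof (rule comp_on_cong)
    fix p n assume "p \<in> dom K"
    then obtain r where r: "K p = Some r" by auto
    have "\<exists>k. \<phi> n (prefix_code p k) \<noteq> 0" using ex[OF r, of n] by (metis nat.distinct(1))
    then have "\<phi> n (prefix_code p (LEAST k. \<phi> n (prefix_code p k) \<noteq> 0)) \<noteq> 0" by (rule LeastI_ex)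
    then have "\<phi> n (prefix_code p (LEAST k. \<phi> n (prefix_code p k) \<noteq> 0)) = Suc (r n)"
      using ok[OF r, of n "LEAST k. \<phi> n (prefix_code p k) \<noteq> 0"] by simp
    then show "\<phi> n (list_encode (map p [0..<LEAST k. \<phi> n (list_encode (map p [0..<k])) \<noteq> 0])) - 1 = the (K p) n"
      using r by (simp add: prefix_code_def)
  qed
next
  assume "comp_on (dom K) (\<lambda>p. the (K p))"
  then obtain \<phi> where f: "rec_total2 \<phi>"
    and F: "\<And>p x. p \<in> dom K ==> settles (\<lambda>k. \<phi> x (prefix_code p k)) (the (K p) x)"
    using comp_onE by metis
  show "computable K" unfolding computable_def
  proof (intro exI[of _ \<phi>] conjI allI impI f)
    fix p r n assume "K p = Some r"
    with F[of p n] have s: "settles (\<lambda>k. \<phi> n (prefix_code p k)) (r n)" by auto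
    show "\<exists>k. \<phi> n (prefix_code p k) = Suc (r n)" using settles_ex[OF s] settles_eq[OF s] by blast
    show "\<phi> n (prefix_code p k) \<in> {0, Suc (r n)}" for k using s by (simp add: settles_def)
  qed
qed

section \<open>Codes of words\<close>

definition llen :: "nat => nat" where "llen l = (LEAST i. ldrop l i = 0)"

lemma llen_list_encode [simp]: "llen (list_encode xs) = length xs"
  unfolding llen_def ldrop_eq_0 by (rule Least_equality) auto

lemma comp_on_llen [comp_intros]:
  assumes "comp_on D F" shows "comp_on D (\<lambda>p x. llen (F p x))"
  unfolding llen_def
proof (intro comp_intros comp_on_subst[OF assms])
  show "\<exists>m. ldrop (F p x) m = 0" for p x
    using ldrop_eq_0[of "list_decode (F p x)"] by auto
qed

definition lsnoc :: "nat => nat => nat" where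
  "lsnoc l b = list_encode (map (\<lambda>i. if i < llen l then lnth l i else b) [0..<Suc (llen l)])"

lemma lsnoc_list_encode: "lsnoc (list_encode xs) b = list_encode (xs @ [b])"
  unfolding lsnoc_def
  by (intro arg_cong[where f = list_encode] nth_equalityI)
    (auto simp: lnth_list_encode nth_append less_Suc_eq simp del: upt_Suc)

lemma comp_on_lsnoc [comp_intros]:
  assumes "comp_on D F" "comp_on D G" shows "comp_on D (\<lambda>p x. lsnoc (F p x) (G p x))"
  unfolding lsnoc_def by (intro comp_intros assms comp_on_subst[OF assms(1)] comp_on_subst[OF assms(2)])

definition lprefix :: "nat => nat => bool" where
  "lprefix v u \<longleftrightarrow> (\<exists>k<Suc (llen u). v = list_encode (map (lnth u) [0..<k]))"

lemma lprefix_list_encode: "lprefix v (list_encode xs) \<longleftrightarrow> (\<exists>k\<le>length xs. v = list_encode (take k xs))"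
proof -
  have "k \<le> length xs ==> map (lnth (list_encode xs)) [0..<k] = take k xs" for k
    by (rule nth_equalityI) (auto simp: lnth_list_encode)
  then show ?thesis unfolding lprefix_def by (auto simp: less_Suc_eq_le)
qed

lemma comp_on_lprefix [comp_intros]:
  assumes "comp_on D F" "comp_on D G" shows "comp_on D (\<lambda>p x. of_bool (lprefix (F p x) (G p x)))"
  unfolding lprefix_def by (intro comp_intros assms comp_on_subst[OF assms(1)] comp_on_subst[OF assms(2)])

lemma inj_wcode: "wcode v = wcode w \<longleftrightarrow> v = w"
proof
  assume "wcode v = wcode w"
  then have "map of_bool v = (map of_bool w :: nat list)" by (simp add: wcode_def list_encode_eq)
  then show "v = w" by (rule map_injective) (auto intro!: injI simp: of_bool_def split: if_splits)
qed simp

lemma llen_wcode [simp]: "llen (wcode w) = length w"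
  and lnth_wcode: "i < length w ==> lnth (wcode w) i = of_bool (w ! i)"
  and lsnoc_wcode: "lsnoc (wcode w) (of_bool b) = wcode (w @ [b])"
  and lprefix_wcode: "lprefix v (wcode w) \<longleftrightarrow> (\<exists>k\<le>length w. v = wcode (take k w))"
  by (auto simp: wcode_def lnth_list_encode lsnoc_list_encode lprefix_list_encode take_map)

section \<open>Iterated limits\<close>

definition is_lim :: "baire => baire => bool" where
  "is_lim q r \<longleftrightarrow> (\<forall>n. \<forall>\<^sub>F i in sequentially. q (pr n i) = r n)"

primrec limN :: "nat => baire => baire => bool" where
  "limN 0 q r \<longleftrightarrow> q = r"
| "limN (Suc n) q r \<longleftrightarrow> (\<exists>s. is_lim q s \<and> limN n s r)"

lemma is_lim_unique: "is_lim q r ==> is_lim q s ==> r = s"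
proof
  fix n assume "is_lim q r" "is_lim q s"
  then have "\<forall>\<^sub>F i in sequentially. q (pr n i) = r n" "\<forall>\<^sub>F i in sequentially. q (pr n i) = s n"
    by (auto simp: is_lim_def)
  then have "\<forall>\<^sub>F i in sequentially. r n = s n" by eventually_elim simp
  then show "r n = s n" by simp
qed

lemma limN_unique: "limN n q r ==> limN n q s ==> r = s"
  by (induction n arbitrary: q) (auto dest: is_lim_unique)

lemma limN_add: "limN m q r ==> limN n r s ==> limN (m + n) q s"
  by (induction m arbitrary: q) auto

text \<open>A value of \<open>K r\<close> depends on a finite prefix of \<open>r\<close>, on which
  late approximations agree with \<open>r\<close>. Running \<open>K\<close> on the
  \<open>i\<close>-th approximation with prefixes of length at most \<open>i\<close> gives a total
  \<open>K'\<close>, although the approximations themselves may lie outside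
  \<open>E\<close>.\<close>

lemma lim_commute:
  assumes "comp_on E K"
  shows "\<exists>K'. comp_on UNIV K' \<and> (\<forall>q r. is_lim q r --> r \<in> E --> is_lim (K' q) (K r))"
proof -
  obtain \<phi> where f: "rec_total2 \<phi>" "\<And>p x. p \<in> E ==> settles (\<lambda>k. \<phi> x (prefix_code p k)) (K p x)"
    using comp_onE[OF assms] by metis
  define A where "A q x k = \<phi> (pfst x) (prefix_code (\<lambda>m. q (pr m (psnd x))) k)" for q x k
  define K' where "K' q x = A q x (LEAST k. A q x k \<noteq> 0 \<or> psnd x \<le> k) - 1" for q x
  have "comp_on UNIV K'" unfolding K'_def A_def prefix_code_def
    by (intro comp_intros comp_on_rec2[OF f(1)] comp_on_subst[OF comp_on_Least]) auto
  moreover have "is_lim (K' q) (K r)" if l: "is_lim q r" and r: "r \<in> E" for q r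
    unfolding is_lim_def
  proof
    fix n
    define k where "k = (LEAST k. \<phi> n (prefix_code r k) \<noteq> 0)"
    have k: "\<phi> n (prefix_code r k) \<noteq> 0" unfolding k_def by (rule LeastI_ex[OF settles_ex[OF f(2)[OF r]]])
    have lk: "\<phi> n (prefix_code r j) = 0" if "j < k" for j
      using not_less_Least that unfolding k_def by blast
    have "\<forall>\<^sub>F i in sequentially. \<forall>m\<in>{..<k}. q (pr m i) = r m"
      by (subst eventually_ball_finite_distrib) (use l in \<open>auto simp: is_lim_def\<close>)
    then show "\<forall>\<^sub>F i in sequentially. K' q (pr n i) = K r n"
      using eventually_ge_at_top[of k]
    proof eventually_elim
      case (elim i)
      have A: "A q (pr n i) j = \<phi> n (prefix_code r j)" if "j \<le> k" for j
      proof -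
        have "map (\<lambda>m. q (pr m i)) [0..<j] = map r [0..<j]" using elim(1) that by auto
        then show ?thesis unfolding A_def prefix_code_def by (simp only: pfst_pr psnd_pr)
      qed
      have "(LEAST k. A q (pr n i) k \<noteq> 0 \<or> i \<le> k) = k"
      proof (rule Least_equality)
        show "k \<le> j" if "A q (pr n i) j \<noteq> 0 \<or> i \<le> j" for j
          using that A[of j] lk[of j] elim(2) by (metis le_cases not_less order.trans)
      qed (use A k in auto)
      then have "K' q (pr n i) = \<phi> n (prefix_code r k) - 1" using A[of k] by (simp add: K'_def)
      with settles_eq[OF f(2)[OF r] k] show ?case by simp
    qed
  qed
  ultimately show ?thesis by blast
qed

lemma limN_commute:
  assumes "comp_on E K"
  shows "\<exists>K'. comp_on {q. \<exists>r\<in>E. limN n q r} K' \<and> (\<forall>q r. limN n q r --> r \<in> E --> limN n (K' q) (K r))"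
proof (induction n)
  case 0
  show ?case by (rule exI[of _ K]) (use assms in auto)
next
  case (Suc n)
  then obtain K1 where K1: "comp_on {q. \<exists>r\<in>E. limN n q r} K1"
    "\<And>q r. limN n q r ==> r \<in> E ==> limN n (K1 q) (K r)" by blast
  from lim_commute[OF K1(1)] obtain K2 where K2: "comp_on UNIV K2"
    "\<And>q r. is_lim q r ==> \<exists>s\<in>E. limN n r s ==> is_lim (K2 q) (K1 r)" by auto
  show ?case
  proof (intro exI[of _ K2] conjI allI impI)
    show "comp_on {q. \<exists>r\<in>E. limN (Suc n) q r} K2" by (rule comp_on_subset[OF K2(1)]) simp
    show "limN (Suc n) (K2 q) (K r)" if "limN (Suc n) q r" "r \<in> E" for q r
      using that K1(2) K2(2) by fastforce
  qed
qed

text \<open>A normal form in which all limits are taken at the end. Keeping to it means that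
  computable post-processing has to be moved in front of the limits.\<close>

definition limcomp :: "nat => baire set => (baire => baire) => bool" where
  "limcomp n D F \<longleftrightarrow> (\<exists>H. comp_on D H \<and> (\<forall>p\<in>D. limN n (H p) (F p)))"

lemma limcomp_0: "comp_on D F ==> limcomp 0 D F"
  unfolding limcomp_def by auto

lemma limcomp_subset: "limcomp n D F ==> D' \<subseteq> D ==> limcomp n D' F"
  unfolding limcomp_def using comp_on_subset by blast

lemma limcomp_post:
  assumes "comp_on E K" "limcomp n D F" "\<And>p. p \<in> D ==> F p \<in> E"
  shows "limcomp n D (\<lambda>p. K (F p))"
proof -
  from limN_commute[OF assms(1), of n] obtain K' where K': "comp_on {q. \<exists>r\<in>E. limN n q r} K'"
    "\<And>q r. limN n q r ==> r \<in> E ==> limN n (K' q) (K r)" by blast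
  from assms(2) obtain H where H: "comp_on D H" "\<And>p. p \<in> D ==> limN n (H p) (F p)"
    unfolding limcomp_def by auto
  have "comp_on D (\<lambda>p. K' (H p))" by (rule comp_on_comp[OF K'(1) H(1)]) (use H(2) assms(3) in auto)
  moreover have "\<forall>p\<in>D. limN n (K' (H p)) (K (F p))" using K'(2) H(2) assms(3) by auto
  ultimately show ?thesis unfolding limcomp_def by blast
qed

lemma limcomp_comp:
  assumes "limcomp m E F" "limcomp n D G" "\<And>p. p \<in> D ==> G p \<in> E"
  shows "limcomp (n + m) D (\<lambda>p. F (G p))"
proof -
  from assms(1) obtain H where H: "comp_on E H" "\<And>p. p \<in> E ==> limN m (H p) (F p)"
    unfolding limcomp_def by auto
  from limcomp_post[OF H(1) assms(2,3)] obtain J where "comp_on D J" "\<And>p. p \<in> D ==> limN n (J p) (H (G p))"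
    unfolding limcomp_def by auto
  then show ?thesis unfolding limcomp_def using H(2) assms(3) limN_add by (intro exI[of _ J]) blast
qed

text \<open>The truth value of the search bounded by \<open>i\<close> changes at most once as
  \<open>i\<close> grows, so one limit decides an existential question about a decidable
  matrix.\<close>

lemma limcomp_jump:
  assumes "comp_on D (\<lambda>p z. of_bool (P p (pfst z) (psnd z)))"
  shows "limcomp 1 D (\<lambda>p x. of_bool (\<exists>m. P p x m))"
proof -
  have P: "comp_on D (\<lambda>p z. of_bool (P p (pfst (pfst z)) (psnd z)))"
    using comp_on_subst[OF assms, of "\<lambda>p z. pr (pfst (pfst z)) (psnd z)"] by (simp add: comp_intros)
  show ?thesis unfolding limcomp_def
  proof (intro exI[of _ "\<lambda>p z. of_bool (\<exists>m<psnd z. P p (pfst z) m)"] conjI ballI)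
    show "comp_on D (\<lambda>p z. of_bool (\<exists>m<psnd z. P p (pfst z) m))"
      by (intro comp_intros P)
  next
    fix p assume "p \<in> D"
    have "\<forall>\<^sub>F i in sequentially. (\<exists>m<i. P p x m) = (\<exists>m. P p x m)" for x
    proof (cases "\<exists>m. P p x m")
      case True
      then obtain m where "P p x m" by blast
      then have "(\<exists>m<i. P p x m) = (\<exists>m. P p x m)" if "m < i" for i using that by blast
      then show ?thesis using eventually_gt_at_top[of m] by (rule eventually_mono[rotated])
    qed simp
    then have "\<forall>\<^sub>F i in sequentially. of_bool (\<exists>m<i. P p x m) = (of_bool (\<exists>m. P p x m) :: nat)" for x
      by (rule eventually_mono[where P = "\<lambda>i. (\<exists>m<i. P p x m) = (\<exists>m. P p x m)"]) simp
    then show "limN 1 (\<lambda>z. of_bool (\<exists>m<psnd z. P p (pfst z) m)) (\<lambda>x. of_bool (\<exists>m. P p x m))"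
      by (simp add: is_lim_def)
  qed
qed

definition bfst :: "baire => baire" where "bfst q n = q (2 * n)"
definition bsnd :: "baire => baire" where "bsnd q n = q (2 * n + 1)"

lemma bfst_bpair [simp]: "bfst (bpair p q) = p" and bsnd_bpair [simp]: "bsnd (bpair p q) = q"
  by (auto simp: bfst_def bsnd_def bpair_def)

lemma comp_on_bpair:
  assumes "comp_on D F" "comp_on D G" shows "comp_on D (\<lambda>p. bpair (F p) (G p))"
  unfolding bpair_def by (intro comp_intros comp_on_subst[OF assms(1)] comp_on_subst[OF assms(2)])

lemma comp_on_bfst: "comp_on D bfst" and comp_on_bsnd: "comp_on D bsnd"
  unfolding bfst_def bsnd_def by (intro comp_intros)+

text \<open>The original input has to survive \<open>n\<close> limits; \<open>B\<close> repeats
  \<open>p\<close> as a constant sequence beside the sequence in \<open>q\<close>.\<close>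

lemma limN_bpair:
  "\<exists>M. comp_on UNIV M \<and> (\<forall>p q r. limN n q r --> limN n (M (bpair p q)) (bpair p r))"
proof (induction n)
  case 0
  show ?case by (rule exI[of _ "\<lambda>p. p"]) (auto intro: comp_intros)
next
  case (Suc n)
  then obtain M where M: "comp_on UNIV M" "\<And>p q r. limN n q r ==> limN n (M (bpair p q)) (bpair p r)"
    by blast
  from lim_commute[OF M(1)] obtain M' where M': "comp_on UNIV M'" "\<And>q r. is_lim q r ==> is_lim (M' q) (M r)"
    by auto
  define B where "B s z = (if even (pfst z) then bfst s (pfst z div 2) else bsnd s (pr (pfst z div 2) (psnd z)))"
    for s z
  have B: "is_lim (B (bpair p q)) (bpair p r)" if "is_lim q r" for p q r
    using that by (auto simp: is_lim_def B_def bpair_def[of p r])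
  have "comp_on UNIV B" unfolding B_def bfst_def bsnd_def by (intro comp_intros)
  then have "comp_on UNIV (\<lambda>s. M' (B s))" by (intro comp_on_comp[OF M'(1)]) auto
  moreover have "limN (Suc n) (M' (B (bpair p q))) (bpair p r)" if "limN (Suc n) q r" for p q r
    using that B M(2) M'(2) by (meson limN.simps(2))
  ultimately show ?case by blast
qed

lemma limcomp_bpair:
  assumes "limcomp n D F" shows "limcomp n D (\<lambda>p. bpair p (F p))"
proof -
  obtain M where M: "comp_on UNIV M" "\<And>p q r. limN n q r ==> limN n (M (bpair p q)) (bpair p r)"
    using limN_bpair[of n] by blast
  obtain H where H: "comp_on D H" "\<And>p. p \<in> D ==> limN n (H p) (F p)"
    using assms unfolding limcomp_def by auto
  have "comp_on D (\<lambda>p. M (bpair p (H p)))"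
    by (rule comp_on_comp[OF M(1)]) (auto intro!: comp_on_bpair H(1) comp_intros)
  then show ?thesis unfolding limcomp_def using M(2) H(2) by blast
qed

section \<open>Weihrauch reducibility to iterated limits\<close>

text \<open>A concrete representative, in place of the \<open>SOME\<close> in
  \<open>cprod\<close>.\<close>

primrec lim_iter :: "nat => problem" where
  "lim_iter 0 = id_prob"
| "lim_iter (Suc n) = comp_prob (lim_iter n) lim_prob"

lemma lim_prob_iff: "r \<in> lim_prob p \<longleftrightarrow> is_lim p r"
  by (simp add: lim_prob_def is_lim_def eventually_sequentially)

lemma lim_iter_iff: "r \<in> lim_iter n p \<longleftrightarrow> limN n p r"
proof (induction n arbitrary: p)
  case (Suc n)
  have "r \<in> lim_iter (Suc n) p \<longleftrightarrow> (\<exists>s. is_lim p s \<and> r \<in> lim_iter n s)"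
  proof (cases "\<exists>s. is_lim p s")
    case True
    then obtain s where s: "is_lim p s" by blast
    then have "lim_prob p = {s}" using is_lim_unique by (auto simp: lim_prob_iff)
    then have "lim_iter (Suc n) p = lim_iter n s" by (auto simp: comp_prob_def)
    then show ?thesis using s is_lim_unique by metis
  next
    case False
    then have "lim_prob p = {}" by (auto simp: lim_prob_iff)
    then show ?thesis using False by (simp add: comp_prob_def)
  qed
  with Suc show ?case by simp
qed (auto simp: id_prob_def)

lemma lim_iter_1: "lim_iter 1 = lim_prob"
  by (rule ext, rule set_eqI) (simp add: lim_iter_iff lim_prob_iff del: lim_iter.simps)

text \<open>Limits are unique, so every realizer returns exactly \<open>F p\<close>, and the outer
  function need only extract it from the pair.\<close>

lemma W_le_lim_iterI:
  assumes "limcomp n {p. f p \<noteq> {}} F" "\<And>p. f p \<noteq> {} ==> F p \<in> f p"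
  shows "f \<le>\<^sub>W lim_iter n"
proof -
  from assms(1) obtain H where H: "comp_on {p. f p \<noteq> {}} H" "\<And>p. f p \<noteq> {} ==> limN n (H p) (F p)"
    unfolding limcomp_def by auto
  let ?H = "\<lambda>p. if f p \<noteq> {} then Some (H p) else None"
  let ?K = "\<lambda>p. Some (bsnd p)"
  show ?thesis unfolding W_le_def
  proof (rule exI[of _ ?K], rule exI[of _ ?H], intro conjI allI impI)
    show "computable ?K" by (simp add: computable_iff_comp_on comp_on_bsnd)
    have "dom ?H = {p. f p \<noteq> {}}" by (auto split: if_splits)
    then show "computable ?H" unfolding computable_iff_comp_on
      using comp_on_cong[OF H(1), of "\<lambda>p. the (if f p \<noteq> {} then Some (H p) else None)"] by auto
  next
    fix G assume G: "realizer G (lim_iter n)"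
    show "realizer (\<lambda>p. Option.bind (?H p) (\<lambda>h. Option.bind (G h) (\<lambda>q. ?K (bpair p q)))) f"
      unfolding realizer_def
    proof (intro allI impI)
      fix p assume p: "f p \<noteq> {}"
      have "F p \<in> lim_iter n (H p)" using H(2)[OF p] by (simp add: lim_iter_iff)
      then obtain q where "G (H p) = Some q" "q \<in> lim_iter n (H p)" using G unfolding realizer_def by blast
      then have "G (H p) = Some (F p)" using H(2)[OF p] limN_unique by (auto simp: lim_iter_iff)
      then show "\<exists>q. Option.bind (?H p) (\<lambda>h. Option.bind (G h) (\<lambda>q. ?K (bpair p q))) = Some q \<and> q \<in> f p"
        using p assms(2) by simp
    qed
  qed
qed

text \<open>The outer function \<open>K\<close> is pushed in front of the limits by
  \<open>limcomp_post\<close>. It also reads the input \<open>p\<close>, which is why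
  \<open>p\<close> is carried along with \<open>limcomp_bpair\<close>.\<close>

lemma W_le_lim_iterD:
  assumes "f \<le>\<^sub>W lim_iter n"
  shows "\<exists>F. limcomp n {p. f p \<noteq> {}} F \<and> (\<forall>p. f p \<noteq> {} --> F p \<in> f p)"
proof -
  from assms obtain K H where K: "computable K" and H: "computable H" and R: "\<And>G. realizer G (lim_iter n) ==>
      realizer (\<lambda>p. Option.bind (H p) (\<lambda>h. Option.bind (G h) (\<lambda>q. K (bpair p q)))) f"
    unfolding W_le_def by blast
  define G where "G q = (if lim_iter n q = {} then None else Some (SOME r. limN n q r))" for q
  have G: "limN n q r" if "G q = Some r" for q r
    
  proof -
    from that have "lim_iter n q \<noteq> {}" and r: "r = (SOME r. limN n q r)" by (auto simp: G_def split: if_splits)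
    then obtain s where "limN n q s" by (auto simp: lim_iter_iff[symmetric])
    then show ?thesis unfolding r by (rule someI[of "limN n q"])
  qed
  have "realizer G (lim_iter n)" unfolding realizer_def
    using G by (auto simp: lim_iter_iff G_def)
  from R[OF this] have ex: "\<exists>h q r. H p = Some h \<and> G h = Some q \<and> K (bpair p q) = Some r \<and> r \<in> f p"
    if "f p \<noteq> {}" for p
    using that unfolding realizer_def by (auto simp: bind_eq_Some_conv)
  define Q where "Q p = the (G (the (H p)))" for p
  have "limcomp n {p. f p \<noteq> {}} Q" unfolding limcomp_def
  proof (intro exI[of _ "\<lambda>p. the (H p)"] conjI ballI)
    show "comp_on {p. f p \<noteq> {}} (\<lambda>p. the (H p))"
      using H[unfolded computable_iff_comp_on] by (rule comp_on_subset) (use ex in blast)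
    show "limN n (the (H p)) (Q p)" if "p \<in> {p. f p \<noteq> {}}" for p
      using ex[of p] that G by (auto simp: Q_def)
  qed
  from limcomp_post[OF K[unfolded computable_iff_comp_on] limcomp_bpair[OF this]]
  have "limcomp n {p. f p \<noteq> {}} (\<lambda>p. the (K (bpair p (Q p))))"
    using ex by (force simp: Q_def)
  moreover have "the (K (bpair p (Q p))) \<in> f p" if "f p \<noteq> {}" for p
    using ex[OF that] by (auto simp: Q_def)
  ultimately show ?thesis by blast
qed

lemma W_le_refl: "f \<le>\<^sub>W f"
  unfolding W_le_def
proof (rule exI[of _ "\<lambda>p. Some (bsnd p)"], rule exI[of _ Some], intro conjI allI impI)
  show "computable (\<lambda>p. Some (bsnd p))" "computable Some"
    by (simp_all add: computable_iff_comp_on comp_on_bsnd comp_intros)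
qed (simp add: realizer_def)

lemma W_le_trans:
  assumes "f \<le>\<^sub>W g" "g \<le>\<^sub>W h"
  shows "f \<le>\<^sub>W h"
proof -
  from assms(1) obtain K H where K: "computable K" and H: "computable H" and KH: "\<And>G. realizer G g ==>
      realizer (\<lambda>p. Option.bind (H p) (\<lambda>h. Option.bind (G h) (\<lambda>q. K (bpair p q)))) f"
    unfolding W_le_def by blast
  from assms(2) obtain K' H' where K': "computable K'" and H': "computable H'" and KH': "\<And>G. realizer G h ==>
      realizer (\<lambda>p. Option.bind (H' p) (\<lambda>h. Option.bind (G h) (\<lambda>q. K' (bpair p q)))) g"
    unfolding W_le_def by blast
  let ?H = "\<lambda>p. Option.bind (H p) H'"
  let ?K = "\<lambda>x. Option.bind (H (bfst x)) (\<lambda>a. Option.bind (K' (bpair a (bsnd x))) (\<lambda>r. K (bpair (bfst x) r)))"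
  note [simp] = bind_eq_Some_conv
  show ?thesis unfolding W_le_def
  proof (rule exI[of _ ?K], rule exI[of _ ?H], intro conjI allI impI)
    have H1: "comp_on (dom ?H) (\<lambda>p. the (H p))"
      using H[unfolded computable_iff_comp_on] by (rule comp_on_subset) auto
    have "comp_on (dom ?H) (\<lambda>p. the (H' (the (H p))))"
      by (rule comp_on_comp[OF H'[unfolded computable_iff_comp_on] H1]) auto
    then show "computable ?H" unfolding computable_iff_comp_on
      by (rule comp_on_cong) auto
  next
    have "comp_on (dom ?K) (\<lambda>x. the (H (bfst x)))"
      by (rule comp_on_comp[OF H[unfolded computable_iff_comp_on] comp_on_bfst]) auto
    then have "comp_on (dom ?K) (\<lambda>x. the (K' (bpair (the (H (bfst x))) (bsnd x))))"
      by (intro comp_on_comp[OF K'[unfolded computable_iff_comp_on] comp_on_bpair] comp_on_bsnd) auto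
    then have "comp_on (dom ?K) (\<lambda>x. the (K (bpair (bfst x) (the (K' (bpair (the (H (bfst x))) (bsnd x)))))))"
      by (intro comp_on_comp[OF K[unfolded computable_iff_comp_on] comp_on_bpair] comp_on_bfst) auto
    then show "computable ?K" unfolding computable_iff_comp_on
      by (rule comp_on_cong) auto
  next
    fix G assume "realizer G h"
    from KH[OF KH'[OF this]]
    show "realizer (\<lambda>p. Option.bind (?H p) (\<lambda>h. Option.bind (G h) (\<lambda>q. ?K (bpair p q)))) f"
      unfolding realizer_def by fastforce
  qed
qed

lemma comp_prob_le_lim_iter:
  assumes "f \<le>\<^sub>W lim_iter n" "g \<le>\<^sub>W lim_prob"
  shows "comp_prob f g \<le>\<^sub>W lim_iter (Suc n)"
proof -
  obtain F where F: "limcomp n {p. f p \<noteq> {}} F" "\<And>p. f p \<noteq> {} ==> F p \<in> f p"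
    using W_le_lim_iterD[OF assms(1)] by blast
  obtain G where G: "limcomp 1 {p. g p \<noteq> {}} G" "\<And>p. g p \<noteq> {} ==> G p \<in> g p"
    using W_le_lim_iterD[of g 1] assms(2) unfolding lim_iter_1 by blast
  let ?D = "{p. comp_prob f g p \<noteq> {}}"
  have D: "g p \<noteq> {}" "\<forall>q\<in>g p. f q \<noteq> {}" if "p \<in> ?D" for p
    using that unfolding comp_prob_def by (auto split: if_splits)
  have "limcomp (1 + n) ?D (\<lambda>p. F (G p))"
    by (rule limcomp_comp[OF F(1) limcomp_subset[OF G(1)]]) (use D G(2) in auto)
  moreover have "F (G p) \<in> comp_prob f g p" if "p \<in> ?D" for p
    using D[OF that] F(2)[of "G p"] G(2)[of p] by (auto simp: comp_prob_def)
  ultimately show ?thesis using W_le_lim_iterI[where f = "comp_prob f g" and n = "Suc n"] by simp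
qed

text \<open>The \<open>SOME\<close> in \<open>cprod\<close> is meaningful only if a maximum exists;
  \<open>lim_iter (Suc n)\<close> is one by \<open>comp_prob_le_lim_iter\<close>, and any two maxima
  are equivalent.\<close>

lemma lim_pow_eq_lim_iter: "lim_pow n \<equiv>\<^sub>W lim_iter n"
proof (induction n)
  case 0
  show ?case by (simp add: W_eq_def W_le_refl)
next
  case (Suc n)
  let ?X = "{comp_prob f g | f g. f \<equiv>\<^sub>W lim_pow n \<and> g \<equiv>\<^sub>W lim_prob}"
  have in_X: "lim_iter (Suc n) \<in> ?X" using Suc W_le_refl[of lim_prob] unfolding lim_iter.simps W_eq_def by blast
  have max: "k \<le>\<^sub>W lim_iter (Suc n)" if "k \<in> ?X" for k
    using that comp_prob_le_lim_iter Suc W_le_trans unfolding W_eq_def by blast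
  from in_X max have "\<exists>h. h \<in> ?X \<and> (\<forall>k\<in>?X. k \<le>\<^sub>W h)" by blast
  then have "lim_pow (Suc n) \<in> ?X \<and> (\<forall>k\<in>?X. k \<le>\<^sub>W lim_pow (Suc n))"
    unfolding lim_pow.simps cprod_def by (rule someI_ex)
  then show ?case using in_X max unfolding W_eq_def by blast
qed

section \<open>Plays\<close>

definition pre :: "cantor => nat => bool list" where "pre x n = map x [0..<n]"

lemma length_pre [simp]: "length (pre x n) = n"
  and pre_Suc: "pre x (Suc n) = pre x n @ [x n]"
  and pre_0 [simp]: "pre x 0 = []"
  by (auto simp: pre_def)

lemma take_pre: "m \<le> n ==> take m (pre x n) = pre x m"
  by (simp add: pre_def take_map)

lemma inj_pre: "inj (pre x)"
  by (rule injI) (metis length_pre)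

lemma play_prefix_eq_pre: "play_prefix s h n = pre (play s h) n"
proof (induction n)
  case (Suc n)
  have len: "length (play_prefix s h m) = m" for m by (induction m) auto
  have "play s h n = (if n < length h then h ! n else s (play_prefix s h n))"
    unfolding play_def using len[of n] by (simp add: nth_append)
  with Suc show ?case by (simp add: pre_Suc)
qed simp

lemma play_rec: "play s h n = (if n < length h then h ! n else s (pre (play s h) n))"
proof -
  have "play s h n = (play_prefix s h n @ [if n < length h then h ! n else s (play_prefix s h n)]) ! n"
    by (simp add: play_def)
  also have "\<dots> = (if n < length h then h ! n else s (pre (play s h) n))"
    unfolding play_prefix_eq_pre by (simp add: nth_append)
  finally show ?thesis .
qed

lemma pre_play_length [simp]: "pre (play s h) (length h) = h"
  by (rule nth_equalityI) (auto simp: pre_def play_rec)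

lemma play_unique:
  assumes "\<And>n. n < length h ==> x n = h ! n" "\<And>n. length h \<le> n ==> x n = s (pre x n)"
  shows "play s h = x"
proof -
  have "pre (play s h) n = pre x n" for n
  proof (induction n)
    case (Suc n)
    have "play s h n = x n" by (subst play_rec) (simp add: Suc assms)
    with Suc show ?case by (simp add: pre_Suc)
  qed simp
  then show ?thesis by (intro ext) (metis (no_types) pre_Suc append1_eq_conv)
qed

lemma play_from_prefix:
  assumes "length h \<le> n"
  shows "play s (pre (play s h) n) = play s h"
proof (rule play_unique)
  show "play s h m = s (pre (play s h) m)" if "length (pre (play s h) n) \<le> m" for m
    using that assms by (subst play_rec) auto
qed (simp add: pre_def)

lemma eventually_const_decseq:
  fixes f :: "nat => nat"
  assumes "\<And>n. k \<le> n ==> f (Suc n) \<le> f n"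
  obtains m where "k \<le> m" "\<And>n. m \<le> n ==> f n = f m" "f m \<le> f k"
proof -
  have mono: "f n \<le> f m" if "k \<le> m" "m \<le> n" for m n
    using that(2,1) by (induction n rule: dec_induct) (use assms in \<open>auto intro: order.trans\<close>)
  define P where "P y \<longleftrightarrow> (\<exists>m\<ge>k. f m = y)" for y
  have "P (LEAST y. P y)" by (rule LeastI[of P "f k"]) (auto simp: P_def)
  then obtain m where m: "k \<le> m" "f m = (LEAST y. P y)" by (auto simp: P_def)
  have "f m \<le> f n" if "m \<le> n" for n
    unfolding m(2) by (rule Least_le) (use that m(1) order.trans in \<open>unfold P_def, blast\<close>)
  with mono m(1) show thesis by (intro that[of m]) (auto intro: antisym)
qed

lemma eventually_const_incseq:
  fixes f :: "nat => nat"
  assumes "\<And>n. k \<le> n ==> f n \<le> f (Suc n)" and bnd: "\<And>n. f n \<le> B"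
  obtains m where "k \<le> m" "\<And>n. m \<le> n ==> f n = f m" "f k \<le> f m"
proof -
  have "B - f (Suc n) \<le> B - f n" if "k \<le> n" for n using assms(1)[OF that] by simp
  from eventually_const_decseq[of k "\<lambda>n. B - f n", OF this] obtain m where
    "k \<le> m" "\<And>n. m \<le> n ==> B - f n = B - f m" "B - f m \<le> B - f k" by blast
  moreover have "f n = f m" if "m \<le> n" for n
    using calculation(2)[OF that] bnd[of n] bnd[of m] by arith
  moreover have "f k \<le> f m" using calculation(3) bnd[of k] bnd[of m] by arith
  ultimately show thesis by (intro that[of m])
qed

section \<open>Subgame perfect equilibria from solved win/lose games\<close>

text \<open>\<open>W\<close> is the winning region of the player \<open>a\<close> who wants the play to end up in \<open>A\<close>.
  One map \<open>\<tau>\<close> serves as positional strategy for both players, each using it in their own region.\<close>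
definition solves :: "(bool list => nat) => nat => cantor set => bool list set => strat => bool" where
  "solves t a A W \<tau> \<longleftrightarrow>
     (\<forall>w\<in>W. if t w = a then w @ [\<tau> w] \<in> W else \<forall>b. w @ [b] \<in> W) \<and>
     (\<forall>w\<in>-W. if t w = a then \<forall>b. w @ [b] \<notin> W else w @ [\<tau> w] \<notin> W) \<and>
     (\<forall>x k. (\<forall>n\<ge>k. pre x n \<in> W \<and> (t (pre x n) = a --> x n = \<tau> (pre x n))) --> x \<in> A) \<and>
     (\<forall>x k. (\<forall>n\<ge>k. pre x n \<notin> W \<and> (t (pre x n) \<noteq> a --> x n = \<tau> (pre x n))) --> x \<notin> A)"

lemma solves_in: "solves t a A W \<tau> ==> w \<in> W ==> (t w = a ==> b = \<tau> w) ==> w @ [b] \<in> W"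
  and solves_out: "solves t a A W \<tau> ==> w \<notin> W ==> (t w \<noteq> a ==> b = \<tau> w) ==> w @ [b] \<notin> W"
  by (cases "t w = a"; auto simp: solves_def)+

lemma solves_win: "solves t a A W \<tau> ==> (\<And>n. k \<le> n ==> pre x n \<in> W) ==>
    (\<And>n. k \<le> n ==> t (pre x n) = a ==> x n = \<tau> (pre x n)) ==> x \<in> A"
  and solves_lose: "solves t a A W \<tau> ==> (\<And>n. k \<le> n ==> pre x n \<notin> W) ==>
    (\<And>n. k \<le> n ==> t (pre x n) \<noteq> a ==> x n = \<tau> (pre x n)) ==> x \<notin> A"
  unfolding solves_def by blast+

lemma solves_complement:
  assumes "solves t 2 (- A) W \<tau>" "\<And>w. t w \<in> {1, 2}"
  shows "solves t 1 A (- W) \<tau>"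
proof -
  have t: "t w = 1 \<longleftrightarrow> t w \<noteq> 2" for w using assms(2)[of w] by auto
  note * = assms(1)
  show ?thesis unfolding solves_def
  proof (intro conjI ballI allI impI)
    show "if t w = 1 then w @ [\<tau> w] \<in> - W else \<forall>b. w @ [b] \<in> - W" if "w \<in> - W" for w
      using solves_out[OF *, of w] that t[of w] by auto
    show "if t w = 1 then \<forall>b. w @ [b] \<notin> - W else w @ [\<tau> w] \<notin> - W" if "w \<in> - (- W)" for w
      using solves_in[OF *, of w] that t[of w] by auto
    show "x \<in> A" if "\<forall>n\<ge>k. pre x n \<in> - W \<and> (t (pre x n) = 1 --> x n = \<tau> (pre x n))" for x k
      using solves_lose[OF *, of k x] that t by auto
    show "x \<notin> A" if "\<forall>n\<ge>k. pre x n \<notin> - W \<and> (t (pre x n) \<noteq> 1 --> x n = \<tau> (pre x n))" for x k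
      using solves_win[OF *, of k x] that t by auto
  qed
qed

text \<open>From a position in \<open>W\<close> outside \<open>X\<close>, let the attacker follow
  \<open>\<tau>\<close> and the opponent \<open>\<sigma>\<close>. The play stays in \<open>W\<close>
  and outside \<open>X\<close>, hence ends in \<open>A\<close> but not in \<open>B\<close>.\<close>

lemma solves_mono:
  assumes "solves t a A W \<tau>" "solves t a B X \<sigma>" "A \<subseteq> B"
  shows "W \<subseteq> X"
proof (rule ccontr)
  assume "\<not> W \<subseteq> X"
  then obtain h where h: "h \<in> W" "h \<notin> X" by auto
  define s where "s w = (if t w = a then \<tau> w else \<sigma> w)" for w
  let ?x = "play s h"
  have step: "?x n = s (pre ?x n)" if "length h \<le> n" for n using that by (subst play_rec) auto
  have in_WX: "pre ?x n \<in> W \<and> pre ?x n \<notin> X" if "length h \<le> n" for n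
    using that
  proof (induction n rule: dec_induct)
    case base
    show ?case using h by simp
  next
    case (step n)
    have "?x n = s (pre ?x n)" using step(1) by (subst play_rec) auto
    then show ?case
      using step(3) solves_in[OF assms(1), of "pre ?x n" "?x n"] solves_out[OF assms(2), of "pre ?x n" "?x n"]
      unfolding pre_Suc s_def by simp
  qed
  have "?x \<in> A" by (rule solves_win[OF assms(1), of "length h"]) (use in_WX step s_def in auto)
  moreover have "?x \<notin> B" by (rule solves_lose[OF assms(2), of "length h"]) (use in_WX step s_def in auto)
  ultimately show False using assms(3) by auto
qed

section \<open>Ranks of outcomes and the gluing of win/lose strategies\<close>

definition rk :: "game => nat => nat" where
  "rk G c = card {b. b < noutc G \<and> pref1 G b c}"

lemma wf_game_irrefl: "wf_game G ==> b < noutc G ==> \<not> pref1 G b b"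
  and wf_game_trans: "wf_game G ==> b < noutc G ==> c < noutc G ==> d < noutc G ==>
    pref1 G b c ==> pref1 G c d ==> pref1 G b d"
  and wf_game_total: "wf_game G ==> b < noutc G ==> c < noutc G ==> b \<noteq> c ==> pref1 G b c \<or> pref1 G c b"
  and wf_game_val: "wf_game G ==> val G x < noutc G"
  and wf_game_turn: "wf_game G ==> turn G w = 1 \<or> turn G w = 2"
  unfolding wf_game_def by (blast | simp)+

lemma pref1_iff_rk:
  assumes wf: "wf_game G" and "b < noutc G" "c < noutc G"
  shows "pref1 G b c \<longleftrightarrow> rk G b < rk G c"
proof -
  have lt: "rk G b < rk G c" if "pref1 G b c" "b < noutc G" "c < noutc G" for b c
    unfolding rk_def
  proof (rule psubset_card_mono)
    show "{d. d < noutc G \<and> pref1 G d b} \<subset> {d. d < noutc G \<and> pref1 G d c}"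
    proof
      show "{d. d < noutc G \<and> pref1 G d b} \<subseteq> {d. d < noutc G \<and> pref1 G d c}"
        using wf_game_trans[OF wf _ that(2,3) _ that(1)] by auto
      show "{d. d < noutc G \<and> pref1 G d b} \<noteq> {d. d < noutc G \<and> pref1 G d c}"
        using wf_game_irrefl[OF wf that(2)] that by auto
    qed
  qed simp
  show ?thesis
  proof
    assume *: "rk G b < rk G c"
    then have "b \<noteq> c" by auto
    then have "pref1 G b c \<or> pref1 G c b" using wf_game_total[OF assms] by auto
    then show "pref1 G b c" using lt[of c b] * assms by auto
  qed (rule lt[OF _ assms(2,3)])
qed

lemma rk_inj:
  assumes "wf_game G" "b < noutc G" "c < noutc G" "rk G b = rk G c"
  shows "b = c"
  using assms pref1_iff_rk[of G b c] pref1_iff_rk[of G c b] wf_game_total[of G b c] by auto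

definition at_least :: "game => nat => nat set" where
  "at_least G c = {b. b < noutc G \<and> (b = c \<or> pref1 G c b)}"

lemma upper_set_at_least:
  assumes "wf_game G" "c < noutc G" shows "upper_set G 1 (at_least G c)"
  unfolding upper_set_def
proof (intro conjI ballI allI impI)
  fix a b assume "a \<in> at_least G c" "b < noutc G" "prefers G 1 a b"
  then show "b \<in> at_least G c" using wf_game_trans[OF assms, of a b] unfolding at_least_def prefers_def by auto
qed (auto simp: at_least_def)

definition is_best :: "game => nat set => nat => bool" where
  "is_best G C c \<longleftrightarrow> c < noutc G \<and> c \<in> C \<and> (\<forall>b<noutc G. pref1 G c b --> b \<notin> C)"

definition is_next :: "game => nat => nat => bool" where
  "is_next G c d \<longleftrightarrow> d < noutc G \<and> pref1 G c d \<and> (\<forall>b<noutc G. pref1 G c b --> \<not> pref1 G b d)"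

lemma is_best_ex:
  assumes wf: "wf_game G" and "\<exists>c<noutc G. c \<in> C"
  shows "\<exists>c. is_best G C c"
proof -
  let ?S = "{c. c < noutc G \<and> c \<in> C}"
  have fin: "finite (rk G ` ?S)" by simp
  moreover have "rk G ` ?S \<noteq> {}" using assms(2) by auto
  ultimately have "Max (rk G ` ?S) \<in> rk G ` ?S" by (rule Max_in)
  then obtain c where c: "c \<in> ?S" "rk G c = Max (rk G ` ?S)" by auto
  have "b \<notin> C" if "b < noutc G" "pref1 G c b" for b
  proof
    assume "b \<in> C"
    then have "rk G b \<le> rk G c" unfolding c(2) using that fin by (intro Max_ge) auto
    with that c(1) show False using pref1_iff_rk[OF wf, of c b] by auto
  qed
  with c(1) show ?thesis unfolding is_best_def by blast
qed

lemma is_next_ex: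
  assumes wf: "wf_game G" and "c < noutc G" "\<exists>d<noutc G. pref1 G c d"
  shows "\<exists>d. is_next G c d"
proof -
  define P where "P d \<longleftrightarrow> d < noutc G \<and> pref1 G c d" for d
  obtain d0 where "P d0" using assms(3) by (auto simp: P_def)
  from ex_has_least_nat[of P, OF this, of "rk G"] obtain d where d: "P d" and min: "\<And>b. P b ==> rk G d \<le> rk G b"
    by blast
  have "\<not> pref1 G b d" if "b < noutc G" "pref1 G c b" for b
    using min[of b] that d pref1_iff_rk[OF wf, of b d] by (auto simp: P_def)
  with d have "is_next G c d" unfolding is_next_def P_def by blast
  then show ?thesis by blast
qed

text \<open>\<open>v w\<close> is the value of \<open>w\<close>. Player 1 defends \<open>v w\<close>
  itself, player 2 fights the next better outcome \<open>u w\<close>, if there is one. The value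
  cannot fall while player 1 follows \<open>s\<close> and cannot rise while player 2 does. Ranging
  over finitely many outcomes it stabilizes, and from then on a single \<open>\<tau> c\<close> is
  followed, so that the win/lose solution decides the tail.\<close>

lemma is_SPE_from_solutions:
  fixes v u :: "bool list => nat"
  assumes wf: "wf_game G"
    and sol: "\<And>c. c < noutc G ==> solves (turn G) 1 (val G -` at_least G c) (W c) (\<tau> c)"
    and v: "\<And>w. is_best G {c. w \<in> W c} (v w)"
    and u: "\<And>w. \<exists>d<noutc G. pref1 G (v w) d ==> is_next G (v w) (u w)"
    and s1: "\<And>w. turn G w = 1 ==> s w = \<tau> (v w) w"
    and s2: "\<And>w. turn G w = 2 ==> \<exists>d<noutc G. pref1 G (v w) d ==> s w = \<tau> (u w) w"
  shows "is_SPE G s"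
proof -
  have v_less: "v w < noutc G" and v_in: "w \<in> W (v w)" for w
    using v[of w] by (auto simp: is_best_def)
  have val_less: "val G x < noutc G" for x using wf by (rule wf_game_val)
  have turn: "turn G w = 1 \<or> turn G w = 2" for w using wf by (rule wf_game_turn)
  note rk = pref1_iff_rk[OF wf]
  have nested: "W c \<subseteq> W d" if "c < noutc G" "d < noutc G" "rk G d \<le> rk G c" for c d
  proof (rule solves_mono[OF sol sol])
    show "val G -` at_least G c \<subseteq> val G -` at_least G d"
    proof
      fix x assume "x \<in> val G -` at_least G c"
      then have "rk G c \<le> rk G (val G x)"
        using val_less[of x] rk[OF that(1) val_less[of x]] unfolding at_least_def by auto
      then have "rk G d \<le> rk G (val G x)" using that by simp
      then show "x \<in> val G -` at_least G d"
        using val_less rk_inj[OF wf that(2) val_less] rk[OF that(2) val_less] unfolding at_least_def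
        by (auto simp: le_less)
    qed
  qed fact+
  have W_iff: "w \<in> W c \<longleftrightarrow> rk G c \<le> rk G (v w)" if "c < noutc G" for w c
  proof
    assume "w \<in> W c"
    then have "\<not> pref1 G (v w) c" using v[of w] that by (auto simp: is_best_def)
    then show "rk G c \<le> rk G (v w)" using rk[OF v_less that] by simp
  next
    assume "rk G c \<le> rk G (v w)"
    then show "w \<in> W c" using nested[OF v_less that] v_in by auto
  qed
  have upper: "rk G (val G x) \<le> rk G (v (pre x k))"
    if x: "\<And>n. k \<le> n ==> turn G (pre x n) = 2 ==> x n = s (pre x n)" for x k
  proof -
    have "rk G (v (pre x (Suc n))) \<le> rk G (v (pre x n))" if n: "k \<le> n" for n
    proof (rule ccontr)
      let ?w = "pre x n" and ?c = "v (pre x (Suc n))"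
      assume "\<not> rk G (v (pre x (Suc n))) \<le> rk G (v (pre x n))"
      then have lt: "rk G (v ?w) < rk G ?c" by simp
      have notin: "?w \<notin> W ?c" using W_iff[OF v_less] lt by (simp add: not_le)
      have next_in: "?w @ [x n] \<in> W ?c" using v_in[of "pre x (Suc n)"] by (simp add: pre_Suc)
      show False
      proof (cases "turn G ?w = 1")
        case True
        then show False using solves_out[OF sol[OF v_less] notin] next_in by auto
      next
        case False
        then have t2: "turn G ?w = 2" using turn by blast
        \<comment> \<open>The region of \<open>?c\<close> lies inside the region of the next better
          outcome, and player 2 keeps the play out of the latter.\<close>
        have ex: "\<exists>d<noutc G. pref1 G (v ?w) d" using lt rk[OF v_less v_less] v_less by blast
        note nx = u[OF ex, unfolded is_next_def]
        have ul: "u ?w < noutc G" using nx by blast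
        have "\<not> pref1 G ?c (u ?w)" using nx lt rk[OF v_less v_less] v_less by blast
        then have "rk G (u ?w) \<le> rk G ?c" using rk[OF v_less ul] by simp
        then have "?w @ [x n] \<in> W (u ?w)" using nested[OF v_less ul] next_in by blast
        moreover have "?w \<notin> W (u ?w)" using W_iff[OF ul] nx rk[OF v_less ul] by (simp add: not_le)
        ultimately show False
          using solves_out[OF sol[OF ul], of ?w "x n"] x[OF n t2] s2[OF t2 ex] by auto
      qed
    qed
    from eventually_const_decseq[of k "\<lambda>n. rk G (v (pre x n))", OF this] obtain m where m: "k \<le> m"
      "\<And>n. m \<le> n ==> rk G (v (pre x n)) = rk G (v (pre x m))" "rk G (v (pre x m)) \<le> rk G (v (pre x k))"
      by blast
    let ?c = "v (pre x m)"
    have vc: "v (pre x n) = ?c" if "m \<le> n" for n using rk_inj[OF wf v_less v_less m(2)[OF that]] .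
    have "rk G (val G x) \<le> rk G ?c"
    proof (cases "\<exists>d<noutc G. pref1 G ?c d")
      case False
      then show ?thesis using rk[OF v_less val_less] val_less by (meson not_less)
    next
      case True
      let ?d = "u (pre x m)"
      note nx = u[OF True, unfolded is_next_def]
      have d: "?d < noutc G" using nx by blast
      \<comment> \<open>The hypotheses give \<open>u\<close> only as some next outcome; totality of
        the preference makes it the same one along the tail.\<close>
      have ud: "u (pre x n) = ?d" if "m \<le> n" for n
      proof -
        have "is_next G ?c (u (pre x n))" using u[of "pre x n"] True vc[OF that] by simp
        then have "u (pre x n) < noutc G" "\<not> pref1 G (u (pre x n)) ?d" "\<not> pref1 G ?d (u (pre x n))"
          using nx unfolding is_next_def by auto
        then show ?thesis using wf_game_total[OF wf _ d] by blast
      qed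
      have "x \<notin> val G -` at_least G ?d"
      proof (rule solves_lose[OF sol[OF d], of m])
        fix n assume n: "m \<le> n"
        show "pre x n \<notin> W ?d" using W_iff[OF d] vc[OF n] nx rk[OF v_less d] by (simp add: not_le)
      next
        fix n assume n: "m \<le> n" and "turn G (pre x n) \<noteq> 1"
        then have "turn G (pre x n) = 2" using turn by blast
        with x s2 True show "x n = \<tau> ?d (pre x n)" using vc[OF n] ud[OF n] n m(1) by auto
      qed
      then have "\<not> pref1 G ?d (val G x)" "val G x \<noteq> ?d" using val_less unfolding at_least_def by auto
      then have "pref1 G (val G x) ?d" using wf_game_total[OF wf d val_less[of x]] by metis
      then have "\<not> pref1 G ?c (val G x)" using nx val_less by blast
      then show ?thesis using rk[OF v_less val_less] by simp
    qed
    with m(3) show ?thesis by simp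
  qed
  have lower: "rk G (v (pre x k)) \<le> rk G (val G x)"
    if x: "\<And>n. k \<le> n ==> turn G (pre x n) = 1 ==> x n = s (pre x n)" for x k
  proof -
    have inc: "rk G (v (pre x n)) \<le> rk G (v (pre x (Suc n)))" if n: "k \<le> n" for n
    proof -
      have "pre x n @ [x n] \<in> W (v (pre x n))"
        by (rule solves_in[OF sol[OF v_less] v_in]) (use x[OF n] s1[of "pre x n"] in auto)
      then show ?thesis using W_iff[OF v_less] by (simp add: pre_Suc)
    qed
    have bnd: "rk G c \<le> noutc G" for c unfolding rk_def
      using card_mono[of "{..<noutc G}" "{b. b < noutc G \<and> pref1 G b c}"] by auto
    from eventually_const_incseq[of k "\<lambda>n. rk G (v (pre x n))", OF inc bnd] obtain m where m: "k \<le> m"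
      "\<And>n. m \<le> n ==> rk G (v (pre x n)) = rk G (v (pre x m))" "rk G (v (pre x k)) \<le> rk G (v (pre x m))"
      by blast
    let ?c = "v (pre x m)"
    have vc: "v (pre x n) = ?c" if "m \<le> n" for n using rk_inj[OF wf v_less v_less m(2)[OF that]] .
    have "x \<in> val G -` at_least G ?c"
    proof (rule solves_win[OF sol[OF v_less], of m])
      show "pre x n \<in> W ?c" if "m \<le> n" for n using vc[OF that] v_in[of "pre x n"] by simp
      show "x n = \<tau> ?c (pre x n)" if "m \<le> n" "turn G (pre x n) = 1" for n
        using vc[OF that(1)] x[of n] s1[of "pre x n"] that m(1) by simp
    qed
    then have "rk G ?c \<le> rk G (val G x)" using val_less rk[OF v_less val_less] unfolding at_least_def by auto
    with m(3) show ?thesis by simp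
  qed
  show ?thesis unfolding is_SPE_def nash_at_def
  proof (intro allI ballI impI)
    fix h i s' assume i: "i \<in> {1, 2 :: nat}" and s': "\<forall>w. turn G w \<noteq> i --> s' w = s w"
    have follows: "play s'' h n = s'' (pre (play s'' h) n)" if "length h \<le> n" for s'' n
      using that by (subst play_rec) auto
    have val: "rk G (val G (play s h)) = rk G (v h)"
      using upper[of "length h" "play s h"] lower[of "length h" "play s h"] follows by (simp add: order.antisym)
    show "\<not> prefers G i (val G (play s h)) (val G (play s' h))"
    proof (cases "i = 1")
      case True
      have "rk G (val G (play s' h)) \<le> rk G (v h)"
        using upper[of "length h" "play s' h"] follows[of _ s'] s' True by simp
      then show ?thesis using True val rk[OF val_less val_less] by (simp add: prefers_def)
    next
      case False
      have "rk G (v h) \<le> rk G (val G (play s' h))"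
        using lower[of "length h" "play s' h"] follows[of _ s'] s' False i by simp
      then show ?thesis using False val rk[OF val_less val_less] by (simp add: prefers_def)
    qed
  qed
qed

text \<open>Applied to the worst outcome, this shows that every position has a value.\<close>

lemma lowest_region_UNIV:
  assumes "solves t a UNIV W \<tau>"
  shows "w \<in> W"
proof -
  have "solves t a UNIV UNIV \<tau>" unfolding solves_def by auto
  from solves_mono[OF this assms] show ?thesis by blast
qed

section \<open>Finite levels of the difference hierarchy\<close>

definition attr_ok :: "(bool list => bool) => (nat => bool list => bool) => bool list set => bool list set =>
    bool list set => nat => bool list => bool" where
  "attr_ok mv T V1 V0 F k v \<longleftrightarrow> v \<notin> V1 \<and>
     (v \<in> V0 \<or> T k v \<or> (if mv v then \<exists>b. v @ [b] \<in> F else \<forall>b. v @ [b] \<in> F))"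

text \<open>A certificate \<open>f\<close> codes a finite set of positions, all outside \<open>V1\<close>, within which the mover can force
  a visit to \<open>V0\<close> or to the stage \<open>psnd f\<close> of the target: plays only get longer, so they leave the finite set.\<close>
definition cert :: "(bool list => bool) => (nat => bool list => bool) => bool list set => bool list set =>
    nat => bool list set" where
  "cert mv T V1 V0 f = (let F = {u. wcode u \<in> set_decode (pfst f)} in
     if \<forall>v\<in>F. attr_ok mv T V1 V0 F (psnd f) v then F else {})"

definition attr :: "(bool list => bool) => (nat => bool list => bool) => bool list set => bool list set =>
    bool list set" where
  "attr mv T V1 V0 = (\<Union>f. cert mv T V1 V0 f)"

lemma finite_cert: "finite (cert mv T V1 V0 f)"
proof -
  have "finite (wcode -` set_decode (pfst f))"
    by (rule finite_vimageI) (auto intro: injI simp: inj_wcode)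
  then show ?thesis by (auto simp: cert_def Let_def vimage_def)
qed

lemma cert_ok: "u \<in> cert mv T V1 V0 f ==> attr_ok mv T V1 V0 (cert mv T V1 V0 f) (psnd f) u"
  unfolding cert_def Let_def by (auto split: if_splits)

lemma attrI:
  assumes "finite F" "\<And>v. v \<in> F ==> attr_ok mv T V1 V0 F k v" "u \<in> F"
  shows "u \<in> attr mv T V1 V0"
proof -
  let ?f = "pr (set_encode (wcode ` F)) k"
  have "{u. wcode u \<in> set_decode (pfst ?f)} = F" using assms(1) by (auto simp: inj_wcode)
  then have "cert mv T V1 V0 ?f = F" using assms(2) by (simp add: cert_def)
  then show ?thesis using assms(3) unfolding attr_def by blast
qed

lemma attr_ok_mono:
  assumes "attr_ok mv T V1 V0 F k v" "F \<subseteq> F'" "\<And>k' v. T k v ==> k \<le> k' ==> T k' v" "k \<le> k'"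
  shows "attr_ok mv T V1 V0 F' k' v"
proof -
  have "T k v ==> T k' v" by (rule assms(3)) (use assms(4) in auto)
  with assms(1,2) show ?thesis unfolding attr_ok_def by (cases "mv v") auto
qed

text \<open>A position has only two successors, so at most two certificates are merged into one, at
  the maximum \<open>m\<close> of all stages involved; monotonicity of the target in the stage keeps
  them valid.\<close>

lemma attr_closed:
  assumes mono: "\<And>k k' v. T k v ==> k \<le> k' ==> T k' v" and "v \<notin> V1"
    and "v \<in> V0 \<or> T k v \<or> (if mv v then \<exists>b. v @ [b] \<in> attr mv T V1 V0 else \<forall>b. v @ [b] \<in> attr mv T V1 V0)"
  shows "v \<in> attr mv T V1 V0"
proof -
  define B where "B = {b. v @ [b] \<in> attr mv T V1 V0}"
  have "\<forall>b\<in>B. \<exists>f. v @ [b] \<in> cert mv T V1 V0 f" by (auto simp: B_def attr_def)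
  then obtain f where f: "\<And>b. b \<in> B ==> v @ [b] \<in> cert mv T V1 V0 (f b)" by metis
  define F where "F = insert v (\<Union>b\<in>B. cert mv T V1 V0 (f b))"
  define m where "m = Max (insert k ((\<lambda>b. psnd (f b)) ` B))"
  have m: "k \<le> m" "\<And>b. b \<in> B ==> psnd (f b) \<le> m" by (simp_all add: m_def)
  show ?thesis
  proof (rule attrI[of F])
    show "finite F" unfolding F_def by (auto simp: finite_cert)
    show "v \<in> F" by (simp add: F_def)
    fix u assume "u \<in> F"
    then consider "u = v" | b where "b \<in> B" "u \<in> cert mv T V1 V0 (f b)" by (auto simp: F_def)
    then show "attr_ok mv T V1 V0 F m u"
    proof cases
      case 1
      have F: "v @ [b] \<in> F" if "v @ [b] \<in> attr mv T V1 V0" for b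
        using f[of b] that by (auto simp: F_def B_def)
      have "v \<in> V0 \<or> T m v \<or> (if mv v then \<exists>b. v @ [b] \<in> F else \<forall>b. v @ [b] \<in> F)"
        using assms(3)
      proof (elim disjE)
        assume "T k v"
        then show ?thesis using mono m(1) by blast
      next
        assume "if mv v then \<exists>b. v @ [b] \<in> attr mv T V1 V0 else \<forall>b. v @ [b] \<in> attr mv T V1 V0"
        then show ?thesis using F by (cases "mv v") auto
      qed blast
      with assms(2) show ?thesis unfolding attr_ok_def 1 by blast
    next
      case 2
      show ?thesis
      proof (rule attr_ok_mono[OF cert_ok[OF 2(2)]])
        show "cert mv T V1 V0 (f b) \<subseteq> F" using 2 by (auto simp: F_def)
        show "psnd (f b) \<le> m" using m(2) 2 by blast
      qed (rule mono)
    qed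
  qed
qed

text \<open>Player \<open>a\<close> wants a first index whose parity differs from that of
  \<open>n\<close>, so index \<open>\<beta>\<close> is favoured by \<open>a\<close> or by the
  opponent according to its parity. The predicate expresses that the turn belongs to whoever favours
  \<open>\<beta>\<close>.\<close>

definition mover :: "(bool list => nat) => nat => nat => nat => bool list => bool" where
  "mover t a n \<beta> w \<longleftrightarrow> (t w = a) = (\<beta> mod 2 \<noteq> n mod 2)"

text \<open>\<open>region (\<beta> + 2)\<close> is the set of positions from which the player favouring \<open>\<beta>\<close> can force a play
  whose first index is at most \<open>\<beta>\<close> and of the parity of \<open>\<beta>\<close>; \<open>region 0\<close> and \<open>region 1\<close> are padding.\<close>
fun region :: "(bool list => nat) => nat => nat => (nat => nat => bool list => bool) => nat => bool list set" where
  "region t a n T 0 = {}"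
| "region t a n T (Suc 0) = {}"
| "region t a n T (Suc (Suc \<beta>)) = attr (mover t a n \<beta>) (T \<beta>) (region t a n T (Suc \<beta>)) (region t a n T \<beta>)"

declare region.simps(3) [simp del]

definition region_cert :: "(bool list => nat) => nat => nat => (nat => nat => bool list => bool) => nat => nat =>
    bool list set" where
  "region_cert t a n T \<beta> = cert (mover t a n \<beta>) (T \<beta>) (region t a n T (Suc \<beta>)) (region t a n T \<beta>)"

text \<open>The default \<open>n\<close> agrees with that of \<open>first_idx\<close>. The level is
  an upper estimate of the first index and already has its parity, provided that the favoured player
  plays well.\<close>

definition level :: "(bool list => nat) => nat => nat => (nat => nat => bool list => bool) => bool list => nat" where
  "level t a n T w = (LEAST \<beta>. \<beta> = n \<or> w \<in> region t a n T (Suc (Suc \<beta>)))"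

text \<open>The guard gives 0 at level \<open>n\<close>, where nothing has to be reached.\<close>

definition least_cert :: "(bool list => nat) => nat => nat => (nat => nat => bool list => bool) => bool list => nat" where
  "least_cert t a n T w = (LEAST f. level t a n T w < n --> w \<in> region_cert t a n T (level t a n T w) f)"

text \<open>As long as a successor lies in the least certificate, the move stays inside it.
  Otherwise, at a position of the mover, the set has been entered or the level is \<open>n\<close>,
  and it is enough to keep out of \<open>region (\<beta> + 1)\<close>, the region of the opponent
  for index \<open>\<beta> - 1\<close>.\<close>

definition lstrat :: "(bool list => nat) => nat => nat => (nat => nat => bool list => bool) => strat" where
  "lstrat t a n T w = (let \<beta> = level t a n T w; F = region_cert t a n T \<beta> (least_cert t a n T w) in
     if \<beta> < n \<and> (w @ [False] \<in> F \<or> w @ [True] \<in> F) then w @ [True] \<in> F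
     else w @ [True] \<notin> region t a n T (Suc \<beta>))"

text \<open>The intended meaning of \<open>T \<beta> k w\<close>: among the first \<open>k\<close>
  entries of the name of the \<open>\<beta>\<close>-th open set there is a prefix of
  \<open>w\<close>.\<close>

locale difference_game =
  fixes t :: "bool list => nat" and a n :: nat and T :: "nat => nat => bool list => bool"
  assumes T_mono: "T \<beta> k w ==> k \<le> k' ==> T \<beta> k' w"
    and T_ext: "T \<beta> k w ==> T \<beta> k (w @ [b])"
begin

abbreviation "mv \<equiv> mover t a n"
abbreviation "reg \<equiv> region t a n T"
abbreviation "lev \<equiv> level t a n T"
abbreviation "vc \<equiv> region_cert t a n T"
abbreviation "lc \<equiv> least_cert t a n T"
abbreviation "\<psi> \<equiv> lstrat t a n T"

lemma mover_Suc: "mv (Suc \<beta>) w \<longleftrightarrow> \<not> mv \<beta> w"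
  unfolding mover_def by (auto simp: mod_Suc)

lemma region_iff_cert: "w \<in> reg (Suc (Suc \<beta>)) \<longleftrightarrow> (\<exists>f. w \<in> vc \<beta> f)"
  by (simp add: attr_def region_cert_def region.simps(3))

lemma region_cert_ok:
  assumes "w \<in> vc \<beta> f"
  shows "w \<notin> reg (Suc \<beta>)"
    and "w \<in> reg \<beta> \<or> T \<beta> (psnd f) w \<or> (if mv \<beta> w then \<exists>b. w @ [b] \<in> vc \<beta> f else \<forall>b. w @ [b] \<in> vc \<beta> f)"
  using cert_ok[OF assms[unfolded region_cert_def]] unfolding attr_ok_def region_cert_def by auto

lemma region_closed:
  assumes "w \<notin> reg (Suc \<beta>)"
    and "w \<in> reg \<beta> \<or> T \<beta> k w \<or>
      (if mv \<beta> w then \<exists>b. w @ [b] \<in> reg (Suc (Suc \<beta>)) else \<forall>b. w @ [b] \<in> reg (Suc (Suc \<beta>)))"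
  shows "w \<in> reg (Suc (Suc \<beta>))"
  unfolding region.simps(3)
proof (rule attr_closed[where T = "T \<beta>" and k = k])
  show "T \<beta> j v ==> j \<le> j' ==> T \<beta> j' v" for j j' v by (rule T_mono)
qed (use assms in \<open>auto simp: region.simps(3)\<close>)

lemma region_disjoint: "w \<in> reg \<beta> ==> w \<notin> reg (Suc \<beta>)"
proof (cases \<beta>)
  case (Suc \<gamma>)
  assume "w \<in> reg \<beta>"
  then show ?thesis using region_cert_ok(1) region_iff_cert unfolding Suc by blast
qed simp

lemma region_subset_add2: "reg \<beta> \<subseteq> reg (Suc (Suc \<beta>))"
  using region_closed region_disjoint by blast

lemma region_subset: "reg \<beta> \<subseteq> reg (\<beta> + 2 * d)"
proof (induction d)
  case (Suc d)
  then show ?case using region_subset_add2[of "\<beta> + 2 * d"] by auto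
qed simp

text \<open>For \<open>\<beta> > 0\<close>, \<open>reg (Suc \<beta>)\<close> is the attractor for
  index \<open>\<beta> - 1\<close>, whose mover is the opponent. Read contrapositively, its closure
  property says that the opponent cannot enter it from here and that the mover of
  \<open>\<beta>\<close> need not.\<close>

lemma outside_step:
  assumes "w \<notin> reg (Suc \<beta>)" "w \<notin> reg \<beta>"
  shows "mv \<beta> w ==> \<exists>b. w @ [b] \<notin> reg (Suc \<beta>)" "\<not> mv \<beta> w ==> w @ [b] \<notin> reg (Suc \<beta>)"
proof -
  have "if mv \<beta> w then \<exists>b. w @ [b] \<notin> reg (Suc \<beta>) else \<forall>b. w @ [b] \<notin> reg (Suc \<beta>)"
  proof (cases \<beta>)
    case (Suc \<gamma>)
    show ?thesis
    proof (rule ccontr)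
      assume "\<not> ?thesis"
      then have "if mv \<gamma> w then \<exists>b. w @ [b] \<in> reg (Suc (Suc \<gamma>)) else \<forall>b. w @ [b] \<in> reg (Suc (Suc \<gamma>))"
        unfolding Suc mover_Suc by (cases "mv \<gamma> w") auto
      then show False using region_closed[of w \<gamma>] assms unfolding Suc by blast
    qed
  qed simp
  then show "mv \<beta> w ==> \<exists>b. w @ [b] \<notin> reg (Suc \<beta>)" "\<not> mv \<beta> w ==> w @ [b] \<notin> reg (Suc \<beta>)"
    by (auto split: if_splits)
qed

text \<open>A certificate may rest on \<open>reg \<beta>\<close> instead of the target or the
  successors. That case goes back to index \<open>\<beta> - 2\<close>, which has the same mover,
  hence the induction.\<close>

lemma inside_step:
  assumes "w \<in> reg (Suc (Suc \<beta>))" "\<not> mv \<beta> w"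
  shows "w @ [b] \<in> reg (Suc (Suc \<beta>))"
  using assms
proof (induction \<beta> rule: less_induct)
  case (less \<beta>)
  obtain f where f: "w \<in> vc \<beta> f" using less.prems region_iff_cert by blast
  have out: "w \<notin> reg (Suc \<beta>)" using region_cert_ok(1)[OF f] .
  show ?case
  proof (cases "w \<in> reg \<beta>")
    case True
    then obtain \<gamma> where \<gamma>: "\<beta> = Suc (Suc \<gamma>)" by (metis region.simps(1,2) empty_iff not0_implies_Suc)
    then have "w @ [b] \<in> reg \<beta>" using less.IH[of \<gamma>] True less.prems(2) by (simp add: mover_Suc)
    then show ?thesis using region_subset_add2 by blast
  next
    case False
    then have "T \<beta> (psnd f) w \<or> (\<forall>b. w @ [b] \<in> vc \<beta> f)" using region_cert_ok(2)[OF f] less.prems(2) by auto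
    then show ?thesis
    proof
      assume "T \<beta> (psnd f) w"
      then have "T \<beta> (psnd f) (w @ [b])" by (rule T_ext)
      with outside_step(2)[OF out False less.prems(2)] show ?thesis using region_closed by blast
    qed (use region_iff_cert in blast)
  qed
qed

lemma level_le: "lev w \<le> n"
  unfolding level_def by (rule Least_le) simp

lemma level_in: "lev w < n ==> w \<in> reg (Suc (Suc (lev w)))"
  using LeastI[of "\<lambda>\<beta>. \<beta> = n \<or> w \<in> reg (Suc (Suc \<beta>))" n] unfolding level_def by auto

lemma level_least: "\<beta> < lev w ==> w \<notin> reg (Suc (Suc \<beta>))"
  unfolding level_def by (drule not_less_Least) auto

lemma level_notin: "w \<notin> reg (lev w)" "w \<notin> reg (Suc (lev w))"
proof -
  have *: "w \<notin> reg \<beta>" if "\<beta> < Suc (Suc (lev w))" for \<beta>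
  proof (cases \<beta>)
    case (Suc \<gamma>)
    then show ?thesis using that level_least[of "\<gamma> - 1" w] by (cases \<gamma>) auto
  qed simp
  show "w \<notin> reg (lev w)" "w \<notin> reg (Suc (lev w))" by (rule *, simp)+
qed

text \<open>Regions grow in steps of two, so a drop of the level by an odd amount would put
  \<open>w'\<close> into \<open>reg (Suc (lev w))\<close>.\<close>

lemma level_step:
  assumes w': "w' \<notin> reg (Suc (lev w))" "lev w < n ==> w' \<in> reg (Suc (Suc (lev w)))"
  shows "lev w' \<le> lev w" "lev w' mod 2 = lev w mod 2"
proof -
  show le: "lev w' \<le> lev w"
    unfolding level_def[of t a n T w']
  proof (rule Least_le)
    show "lev w = n \<or> w' \<in> reg (Suc (Suc (lev w)))" using w'(2) level_le[of w] by (cases "lev w = n") auto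
  qed
  show "lev w' mod 2 = lev w mod 2"
  proof (cases "lev w' = lev w")
    case False
    with le have lt: "lev w' < lev w" by simp
    then have in': "w' \<in> reg (Suc (Suc (lev w')))" using level_in level_le[of w] by simp
    show ?thesis
    proof (rule ccontr)
      assume "lev w' mod 2 \<noteq> lev w mod 2"
      moreover obtain d where d: "lev w = lev w' + d" using le le_Suc_ex by blast
      ultimately have "odd d" by (auto elim!: evenE)
      then obtain e where "d = 2 * e + 1" by (elim oddE)
      with d have "Suc (lev w) = Suc (Suc (lev w')) + 2 * e" by simp
      with w'(1) in' region_subset[of "Suc (Suc (lev w'))" e] show False by auto
    qed
  qed simp
qed

lemma least_cert: "lev w < n ==> w \<in> vc (lev w) (lc w)"
proof -
  assume "lev w < n"
  then obtain f where "w \<in> vc (lev w) f" using level_in[of w] region_iff_cert[of w "lev w"] by blast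
  then have "\<exists>f. lev w < n --> w \<in> vc (lev w) f" by blast
  then have "lev w < n --> w \<in> vc (lev w) (lc w)" unfolding least_cert_def by (rule LeastI_ex)
  then show "lev w < n ==> w \<in> vc (lev w) (lc w)" by blast
qed

lemma lstrat_cases:
  assumes "mv (lev w) w"
  obtains "lev w < n" "w @ [\<psi> w] \<in> vc (lev w) (lc w)"
  | "lev w < n" "\<exists>k. T (lev w) k w" "w @ [\<psi> w] \<notin> reg (Suc (lev w))"
  | "lev w = n" "w @ [\<psi> w] \<notin> reg (Suc (lev w))"
proof (cases "lev w < n \<and> (w @ [False] \<in> vc (lev w) (lc w) \<or> w @ [True] \<in> vc (lev w) (lc w))")
  case True
  then have "w @ [\<psi> w] \<in> vc (lev w) (lc w)"
    by (cases "w @ [True] \<in> vc (lev w) (lc w)") (simp_all add: lstrat_def Let_def)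
  with True show thesis by (intro that(1)) auto
next
  case False
  from outside_step(1)[OF level_notin(2,1) assms] obtain b where b: "w @ [b] \<notin> reg (Suc (lev w))" by blast
  have "\<psi> w = (w @ [True] \<notin> reg (Suc (lev w)))" using False by (auto simp: lstrat_def Let_def)
  with b have out: "w @ [\<psi> w] \<notin> reg (Suc (lev w))" by (cases b; cases "\<psi> w") auto
  show thesis
  proof (cases "lev w < n")
    case True
    with False have "\<not> (\<exists>b. w @ [b] \<in> vc (lev w) (lc w))" by (simp add: ex_bool_eq)
    \<comment> \<open>No successor lies in the certificate and minimality of the level excludes
      \<open>reg (lev w)\<close>, so only the target itself remains.\<close>
    with region_cert_ok(2)[OF least_cert[OF True]] level_notin(1)[of w] assms have "\<exists>k. T (lev w) k w" by auto
    then show thesis using that(2) True out by blast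
  qed (use that(3) out level_le[of w] in auto)
qed

text \<open>Only the player favoured by the current level has to follow the strategy; all moves of
  the other one are harmless.\<close>

lemma follow_step:
  assumes "mv (lev w) w ==> b = \<psi> w"
  shows "lev (w @ [b]) \<le> lev w" "lev (w @ [b]) mod 2 = lev w mod 2"
proof -
  have "w @ [b] \<notin> reg (Suc (lev w)) \<and> (lev w < n --> w @ [b] \<in> reg (Suc (Suc (lev w))))"
  proof (cases "mv (lev w) w")
    case True
    then have b: "b = \<psi> w" by (rule assms)
    from True show ?thesis
    proof (cases rule: lstrat_cases)
      case 1
      then have "w @ [b] \<in> reg (Suc (Suc (lev w)))" unfolding region_iff_cert b by blast
      then show ?thesis using region_disjoint by blast
    next
      case 2
      then obtain k where "T (lev w) k (w @ [b])" using T_ext by blast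
      then show ?thesis using 2 region_closed[of "w @ [b]" "lev w" k] unfolding b by blast
    next
      case 3
      then show ?thesis unfolding b by simp
    qed
  next
    case False
    show ?thesis
    proof (cases "lev w < n")
      case True
      then show ?thesis using inside_step[OF level_in False] region_disjoint by blast
    next
      case nl: False
      then show ?thesis using outside_step(2)[OF level_notin(2,1) False] by blast
    qed
  qed
  then show "lev (w @ [b]) \<le> lev w" "lev (w @ [b]) mod 2 = lev w mod 2"
    using level_step by blast+
qed

lemma T_pre_mono: "i \<le> j ==> T \<beta> k (pre x i) ==> T \<beta> k (pre x j)"
  by (induction j rule: dec_induct) (auto simp: pre_Suc T_ext)

text \<open>Once the level is constantly \<open>\<beta>\<close>, no earlier set is ever entered, as
  this would put a prefix into a smaller region. If \<open>\<beta> < n\<close> and its set were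
  never entered, the codes of the least certificates could not increase, so the play would finally
  stay in one finite set of positions.\<close>

lemma eventual_first_index:
  assumes follow: "\<And>i. k \<le> i ==> mv (lev (pre x i)) (pre x i) ==> x i = \<psi> (pre x i)"
    and U: "\<And>\<beta>. \<beta> < n ==> x \<in> U \<beta> \<longleftrightarrow> (\<exists>k i. T \<beta> k (pre x i))"
  shows "first_idx n U x mod 2 = lev (pre x k) mod 2"
proof -
  have step: "lev (pre x (Suc i)) \<le> lev (pre x i)" "lev (pre x (Suc i)) mod 2 = lev (pre x i) mod 2" if "k \<le> i" for i
    using follow_step[of "pre x i" "x i"] follow[OF that] by (simp_all add: pre_Suc)
  from eventually_const_decseq[of k "\<lambda>i. lev (pre x i)", OF step(1)] obtain m where m: "k \<le> m"
    "\<And>i. m \<le> i ==> lev (pre x i) = lev (pre x m)" by blast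
  have par: "lev (pre x i) mod 2 = lev (pre x k) mod 2" if "k \<le> i" for i
    using that by (induction i rule: dec_induct) (simp_all add: step(2))
  define \<beta> where "\<beta> = lev (pre x m)"
  have \<beta>: "lev (pre x i) = \<beta>" if "m \<le> i" for i using m(2)[OF that] by (simp add: \<beta>_def)
  have \<beta>_le: "\<beta> \<le> n" unfolding \<beta>_def by (rule level_le)
  have not_lower: "x \<notin> U \<gamma>" if "\<gamma> < \<beta>" for \<gamma>
  proof
    assume "x \<in> U \<gamma>"
    moreover have "\<gamma> < n" using that \<beta>_le by simp
    ultimately obtain j i where ji: "T \<gamma> j (pre x i)" using U by blast
    define w where "w = pre x (max i m)"
    have w: "T \<gamma> j w" unfolding w_def by (rule T_pre_mono[OF _ ji]) simp
    have lw: "lev w = \<beta>" unfolding w_def by (rule \<beta>) simp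
    have "w \<notin> reg (Suc \<gamma>)"
    proof (cases \<gamma>)
      case (Suc \<delta>)
      then show ?thesis using level_least[of \<delta> w] that lw by simp
    qed simp
    then have "w \<in> reg (Suc (Suc \<gamma>))" using w region_closed by blast
    then show False using level_least[of \<gamma> w] that lw by simp
  qed
  have reach: "x \<in> U \<beta>" if "\<beta> < n"
  proof (rule ccontr)
    assume "x \<notin> U \<beta>"
    then have noT: "\<not> T \<beta> j (pre x i)" for j i using U[OF that] by auto
    have vc: "pre x i \<in> vc \<beta> (lc (pre x i))" if "m \<le> i" for i
      using least_cert[of "pre x i"] \<beta>[OF that] \<open>\<beta> < n\<close> by simp
    have stay: "pre x (Suc i) \<in> vc \<beta> (lc (pre x i))" if i: "m \<le> i" for i
    proof (cases "mv (lev (pre x i)) (pre x i)")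
      case True
      then have xi: "x i = \<psi> (pre x i)" using follow i m(1) by simp
      from True show ?thesis
        by (cases rule: lstrat_cases) (use xi \<beta>[OF i] noT \<open>\<beta> < n\<close> in \<open>auto simp: pre_Suc\<close>)
    next
      case False
      then show ?thesis
        using region_cert_ok(2)[OF vc[OF i]] noT level_notin(1)[of "pre x i"] \<beta>[OF i] by (auto simp: pre_Suc)
    qed
    have "lc (pre x (Suc i)) \<le> lc (pre x i)" if "m \<le> i" for i
      unfolding least_cert_def[of t a n T "pre x (Suc i)"]
      by (rule Least_le) (use stay[OF that] \<beta>[of "Suc i"] that in simp)
    from eventually_const_decseq[of m "\<lambda>i. lc (pre x i)", OF this] obtain l where l: "m \<le> l"
      "\<And>i. l \<le> i ==> lc (pre x i) = lc (pre x l)" by blast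
    have "pre x ` {l..} \<subseteq> vc \<beta> (lc (pre x l))"
    proof (rule image_subsetI)
      fix i assume "i \<in> {l..}"
      then show "pre x i \<in> vc \<beta> (lc (pre x l))" using vc[of i] l(1) l(2)[of i] by simp
    qed
    then have "finite (pre x ` {l..})" using finite_cert unfolding region_cert_def by (rule finite_subset)
    then have "finite {l..}" using finite_imageD inj_pre by (metis inj_on_subset subset_UNIV)
    then show False using infinite_Ici by blast
  qed
  have "first_idx n U x = \<beta>"
  proof (cases "\<beta> < n")
    case True
    have "(LEAST \<gamma>. \<gamma> < n \<and> x \<in> U \<gamma>) = \<beta>"
    proof (rule Least_equality)
      show "\<beta> < n \<and> x \<in> U \<beta>" using True reach by blast
      show "\<beta> \<le> \<gamma>" if "\<gamma> < n \<and> x \<in> U \<gamma>" for \<gamma> using not_lower[of \<gamma>] that by (meson not_less)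
    qed
    then show ?thesis using True reach unfolding first_idx_def by auto
  next
    case False
    then show ?thesis using not_lower \<beta>_le unfolding first_idx_def by auto
  qed
  then show ?thesis using par[OF m(1)] by (simp add: \<beta>_def)
qed

lemma difference_game_solved:
  assumes U: "\<And>\<beta> x. \<beta> < n ==> x \<in> U \<beta> \<longleftrightarrow> (\<exists>k i. T \<beta> k (pre x i))"
  shows "solves t a {x. first_idx n U x mod 2 \<noteq> n mod 2} {w. lev w mod 2 \<noteq> n mod 2} \<psi>"
proof -
  have mv: "mv (lev w) w \<longleftrightarrow> ((t w = a) = (lev w mod 2 \<noteq> n mod 2))" for w by (simp add: mover_def)
  show ?thesis unfolding solves_def
  proof (intro conjI ballI allI impI)
    fix w assume "w \<in> {w. lev w mod 2 \<noteq> n mod 2}"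
    then show "if t w = a then w @ [\<psi> w] \<in> {w. lev w mod 2 \<noteq> n mod 2}
        else \<forall>b. w @ [b] \<in> {w. lev w mod 2 \<noteq> n mod 2}"
      using follow_step(2)[of w] mv[of w] by auto
  next
    fix w assume "w \<in> - {w. lev w mod 2 \<noteq> n mod 2}"
    then show "if t w = a then \<forall>b. w @ [b] \<notin> {w. lev w mod 2 \<noteq> n mod 2}
        else w @ [\<psi> w] \<notin> {w. lev w mod 2 \<noteq> n mod 2}"
      using follow_step(2)[of w] mv[of w] by auto
  next
    fix x k assume *: "\<forall>i\<ge>k. pre x i \<in> {w. lev w mod 2 \<noteq> n mod 2} \<and> (t (pre x i) = a --> x i = \<psi> (pre x i))"
    have "first_idx n U x mod 2 = lev (pre x k) mod 2"
      by (rule eventual_first_index) (use * mv U in auto)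
    then show "x \<in> {x. first_idx n U x mod 2 \<noteq> n mod 2}" using * by auto
  next
    fix x k assume *: "\<forall>i\<ge>k. pre x i \<notin> {w. lev w mod 2 \<noteq> n mod 2} \<and> (t (pre x i) \<noteq> a --> x i = \<psi> (pre x i))"
    have "first_idx n U x mod 2 = lev (pre x k) mod 2"
      by (rule eventual_first_index) (use * mv U in auto)
    then show "x \<notin> {x. first_idx n U x mod 2 \<noteq> n mod 2}" using * by auto
  qed
qed

end

section \<open>Equilibria are computable with iterated limits\<close>

definition name_turn :: "baire => bool list => nat" where "name_turn p w = p (pr 1 (wcode w))"

definition name_pref :: "baire => nat => nat => bool" where "name_pref p c d \<longleftrightarrow> p (pr 2 (pr c d)) = 1"

text \<open>For the name of a game this is \<open>set_encode\<close> of \<open>at_least\<close>, the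
  index under which the name stores that upper set.\<close>

definition upper_code :: "baire => nat => nat" where
  "upper_code p c = (\<Sum>b<p (pr 0 0). if b = c \<or> name_pref p c b then 2 ^ b else 0)"

text \<open>The name that the game name \<open>p\<close> provides for the set of plays whose value is at least \<open>c\<close>
  for player 1; its first entry is the tag.\<close>
definition upper_name :: "baire => nat => nat => nat" where
  "upper_name p c x = p (pr 3 (pr (pr 1 (upper_code p c)) x))"

definition entered_code :: "baire => nat => nat => nat => nat => bool" where
  "entered_code p c \<beta> k u \<longleftrightarrow> (\<exists>i<k. upper_name p c (Suc (pr \<beta> i)) \<noteq> 0 \<and> lprefix (upper_name p c (Suc (pr \<beta> i)) - 1) u)"

definition entered :: "baire => nat => nat => nat => bool list => bool" where
  "entered p c \<beta> k w = entered_code p c \<beta> k (wcode w)"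

text \<open>With tag 1 the name describes the complement, so it is player 2 who plays for the
  described set; \<open>Suc\<close> turns the tag into the player.\<close>

abbreviation attacker :: "baire => nat => nat" where "attacker p c \<equiv> Suc (upper_name p c 0)"
abbreviation "name_region p n c \<equiv> region (name_turn p) (attacker p c) n (entered p c)"
abbreviation "name_level p n c \<equiv> level (name_turn p) (attacker p c) n (entered p c)"
abbreviation "name_strat p n c \<equiv> lstrat (name_turn p) (attacker p c) n (entered p c)"

definition win_region :: "baire => nat => nat => bool list set" where
  "win_region p n c = {w. (name_level p n c w mod 2 \<noteq> n mod 2) = (upper_name p c 0 = 0)}"

text \<open>The alternative \<open>c = p (pr 0 0)\<close>, the number of outcomes, bounds the search
  for every \<open>p\<close>; for the name of a game a proper outcome is found below it.\<close>

definition name_value :: "baire => nat => bool list => nat" where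
  "name_value p n w = (LEAST c. c = p (pr 0 0) \<or>
     (w \<in> win_region p n c \<and> (\<forall>b<p (pr 0 0). name_pref p c b --> w \<notin> win_region p n b)))"

definition next_outcome :: "baire => nat => nat" where
  "next_outcome p c = (LEAST d. d = p (pr 0 0) \<or>
     (name_pref p c d \<and> (\<forall>b<p (pr 0 0). name_pref p c b --> \<not> name_pref p b d)))"

definition eq_strat :: "baire => nat => strat" where
  "eq_strat p n w = (if name_turn p w = 1 then name_strat p n (name_value p n w) w
     else (\<exists>d<p (pr 0 0). name_pref p (name_value p n w) d) \<and> name_strat p n (next_outcome p (name_value p n w)) w)"

lemma difference_game_entered: "difference_game (entered p c)"
proof
  show "entered p c \<beta> k w ==> k \<le> k' ==> entered p c \<beta> k' w" for \<beta> k k' w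
    unfolding entered_def entered_code_def by (meson less_le_trans)
  have "lprefix v (wcode (w @ [b]))" if "lprefix v (wcode w)" for v w b
  proof -
    from that obtain k where "k \<le> length w" "v = wcode (take k w)" unfolding lprefix_wcode by blast
    then show ?thesis unfolding lprefix_wcode by (intro exI[of _ k]) simp
  qed
  then show "entered p c \<beta> k w ==> entered p c \<beta> k (w @ [b])" for \<beta> k w b
    unfolding entered_def entered_code_def by blast
qed

lemma mem_cyl_iff: "x \<in> cyl w \<longleftrightarrow> w = pre x (length w)"
proof -
  have "w = pre x (length w) \<longleftrightarrow> (\<forall>i<length w. w ! i = x i)"
    unfolding list_eq_iff_nth_eq[of w] by (simp add: pre_def)
  then show ?thesis by (auto simp: cyl_def)
qed

lemma mem_Union_cyl: "x \<in> \<Union>{cyl w | w. P w} \<longleftrightarrow> (\<exists>k. P (pre x k))"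
proof
  assume "x \<in> \<Union>{cyl w | w. P w}"
  then obtain w where w: "w = pre x (length w)" "P w" unfolding mem_cyl_iff[symmetric] by blast
  then have "P (pre x (length w))" by simp
  then show "\<exists>k. P (pre x k)" ..
next
  assume "\<exists>k. P (pre x k)"
  moreover have "x \<in> cyl (pre x k)" for k by (simp add: mem_cyl_iff)
  ultimately show "x \<in> \<Union>{cyl w | w. P w}" by blast
qed

lemma open_name_entered:
  assumes "open_name (bproj \<beta> (tail (upper_name p c))) U"
  shows "x \<in> U \<longleftrightarrow> (\<exists>k i. entered p c \<beta> k (pre x i))"
proof -
  have "U = (\<Union>{cyl w | w. \<exists>j. upper_name p c (Suc (pr \<beta> j)) = Suc (wcode w)})"
    using assms unfolding open_name_def bproj_def tail_def .
  then have "x \<in> U \<longleftrightarrow> (\<exists>l j. upper_name p c (Suc (pr \<beta> j)) = Suc (wcode (pre x l)))"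
    by (simp only: mem_Union_cyl)
  also have "\<dots> \<longleftrightarrow> (\<exists>k i. entered p c \<beta> k (pre x i))"
  proof
    assume "\<exists>l j. upper_name p c (Suc (pr \<beta> j)) = Suc (wcode (pre x l))"
    then obtain l j where "upper_name p c (Suc (pr \<beta> j)) = Suc (wcode (pre x l))" by blast
    then have "entered p c \<beta> (Suc j) (pre x l)"
      unfolding entered_def entered_code_def lprefix_wcode
      by (intro exI[of _ j] conjI exI[of _ l]) (simp_all add: take_pre)
    then show "\<exists>k i. entered p c \<beta> k (pre x i)" by blast
  next
    assume "\<exists>k i. entered p c \<beta> k (pre x i)"
    then obtain k i j l where "upper_name p c (Suc (pr \<beta> j)) \<noteq> 0" "l \<le> i"
      "upper_name p c (Suc (pr \<beta> j)) - 1 = wcode (take l (pre x i))"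
      unfolding entered_def entered_code_def lprefix_wcode length_pre by blast
    then have "upper_name p c (Suc (pr \<beta> j)) = Suc (wcode (pre x l))" by (simp add: take_pre)
    then show "\<exists>l j. upper_name p c (Suc (pr \<beta> j)) = Suc (wcode (pre x l))" by blast
  qed
  finally show ?thesis .
qed

lemma solves_DcoD:
  assumes "DcoD_name n (upper_name p c) A" and t: "\<And>w. name_turn p w \<in> {1, 2}"
  shows "solves (name_turn p) 1 A (win_region p n c) (name_strat p n c)"
proof -
  interpret difference_game "name_turn p" "attacker p c" n "entered p c" by (rule difference_game_entered)
  have *: "solves (name_turn p) (attacker p c) B {w. name_level p n c w mod 2 \<noteq> n mod 2} (name_strat p n c)"
    if "D_name n (tail (upper_name p c)) B" for B
  proof -
    from that obtain U where U: "\<forall>i<n. open_name (bproj i (tail (upper_name p c))) (U i)"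
      and B: "B = {x. first_idx n U x mod 2 \<noteq> n mod 2}" unfolding D_name_def by blast
    show ?thesis unfolding B by (rule difference_game_solved) (use U open_name_entered in blast)
  qed
  from assms(1) show ?thesis unfolding DcoD_name_def
  proof (elim disjE conjE)
    assume "upper_name p c 0 = 0" "D_name n (tail (upper_name p c)) A"
    with *[of A] show ?thesis by (simp add: win_region_def)
  next
    assume 1: "upper_name p c 0 = 1" "D_name n (tail (upper_name p c)) (- A)"
    have "solves (name_turn p) 2 (- A) {w. name_level p n c w mod 2 \<noteq> n mod 2} (name_strat p n c)"
      using *[OF 1(2)] 1(1) by (simp add: numeral_2_eq_2)
    from solves_complement[OF this t] show ?thesis using 1(1) by (simp add: win_region_def Collect_neg_eq[symmetric])
  qed
qed

lemma set_encode_sum: "set_encode {b. b < N \<and> P b} = (\<Sum>b<N. if P b then 2 ^ b else 0)"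
  unfolding set_encode_def by (simp add: sum.If_cases Int_def)

lemma is_SPE_eq_strat:
  assumes name: "game_name n p G"
  shows "is_SPE G (eq_strat p n)"
proof -
  have wf: "wf_game G" and N: "p (pr 0 0) = noutc G" and name_turn: "name_turn p w = turn G w"
    and pf0: "\<forall>a<noutc G. \<forall>b<noutc G. bproj 2 p (pr a b) = of_bool (pref1 G a b)" for w
    using name unfolding game_name_def by (simp_all add: bproj_def name_turn_def)
  have pf: "name_pref p b c \<longleftrightarrow> pref1 G b c" if "b < noutc G" "c < noutc G" for b c
    using pf0 that by (simp add: bproj_def name_pref_def)
  have D: "DcoD_name n (\<lambda>x. p (pr 3 (pr (pr 1 (set_encode U)) x))) (val G -` U)" if "upper_set G 1 U" for U
  proof -
    have "DcoD_name n (bproj (pr 1 (set_encode U)) (bproj 3 p)) (val G -` U)"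
      using name that unfolding game_name_def by blast
    then show ?thesis unfolding bproj_def .
  qed
  have turn: "name_turn p = turn G" using name_turn by (rule ext)
  have sol: "solves (turn G) 1 (val G -` at_least G c) (win_region p n c) (name_strat p n c)" if c: "c < noutc G" for c
  proof -
    note upper_set_at_least[OF wf c]
    moreover have "upper_code p c = set_encode (at_least G c)"
    proof -
      have "at_least G c = {b. b < noutc G \<and> (b = c \<or> name_pref p c b)}"
        unfolding at_least_def using pf c by auto
      then show ?thesis by (simp only: set_encode_sum upper_code_def N)
    qed
    ultimately have "DcoD_name n (upper_name p c) (val G -` at_least G c)"
      using D[of "at_least G c"] unfolding upper_name_def[of p c, abs_def] by simp
    from solves_DcoD[OF this] show ?thesis using wf_game_turn[OF wf] unfolding turn by auto
  qed
  have ex: "\<exists>c. is_best G {c. w \<in> win_region p n c} c" for w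
  proof (rule is_best_ex[OF wf])
    have "0 < noutc G" using wf_game_val[OF wf, of "\<lambda>_. False"] by simp
    then obtain c where c: "c < noutc G" and min: "\<And>b. b < noutc G ==> rk G c \<le> rk G b"
      using ex_has_least_nat[of "\<lambda>c. c < noutc G" 0 "rk G"] by blast
    have "val G -` at_least G c = UNIV"
    proof -
      have "val G x \<in> at_least G c" for x
      proof -
        have v: "val G x < noutc G" by (rule wf_game_val[OF wf])
        have "\<not> pref1 G (val G x) c" using min[OF v] pref1_iff_rk[OF wf v c] by simp
        then show ?thesis using wf_game_total[OF wf v c] v unfolding at_least_def by auto
      qed
      then show ?thesis by auto
    qed
    from lowest_region_UNIV[OF sol[OF c, unfolded this]] show "\<exists>c<noutc G. c \<in> {c. w \<in> win_region p n c}"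
      using c by auto
  qed
  have v: "is_best G {c. w \<in> win_region p n c} (name_value p n w)" for w
  proof -
    let ?P = "\<lambda>c. c = p (pr 0 0) \<or> (w \<in> win_region p n c \<and> (\<forall>b<p (pr 0 0). name_pref p c b --> w \<notin> win_region p n b))"
    from ex obtain c where c: "is_best G {c. w \<in> win_region p n c} c" by blast
    then have "?P c" using pf unfolding is_best_def N by auto
    then have "?P (name_value p n w)" "name_value p n w \<le> c" unfolding name_value_def by (rule LeastI, rule Least_le)
    then show ?thesis using c pf unfolding is_best_def N by auto
  qed
  have u: "is_next G (name_value p n w) (next_outcome p (name_value p n w))" if "\<exists>d<noutc G. pref1 G (name_value p n w) d" for w
  proof -
    let ?c = "name_value p n w"
    have c: "?c < noutc G" using v[of w] by (simp add: is_best_def)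
    let ?P = "\<lambda>d. d = p (pr 0 0) \<or> (name_pref p ?c d \<and> (\<forall>b<p (pr 0 0). name_pref p ?c b --> \<not> name_pref p b d))"
    from is_next_ex[OF wf c that] obtain d where d: "is_next G ?c d" by blast
    then have "?P d" using pf c unfolding is_next_def N by auto
    then have "?P (next_outcome p ?c)" "next_outcome p ?c \<le> d" unfolding next_outcome_def by (rule LeastI, rule Least_le)
    then show ?thesis using d pf c unfolding is_next_def N by auto
  qed
  show ?thesis
  proof (rule is_SPE_from_solutions[where v = "name_value p n" and u = "\<lambda>w. next_outcome p (name_value p n w)", OF wf sol v u])
    fix w assume "turn G w = 2" "\<exists>d<noutc G. pref1 G (name_value p n w) d"
    moreover have "name_value p n w < noutc G" using v[of w] by (simp add: is_best_def)
    ultimately show "eq_strat p n w = name_strat p n (next_outcome p (name_value p n w)) w"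
      unfolding eq_strat_def turn N using pf by auto
  qed (auto simp: eq_strat_def turn)
qed

section \<open>Checking certificates and computing moves from the regions\<close>

lemma comp_on_iff [comp_intros]:
  assumes "comp_on D (\<lambda>p x. of_bool (P p x))" "comp_on D (\<lambda>p x. of_bool (Q p x))"
  shows "comp_on D (\<lambda>p x. of_bool (P p x = Q p x))"
  by (rule comp_on_cong[where F = "\<lambda>p x. of_bool ((P p x --> Q p x) \<and> (Q p x --> P p x))"], intro comp_intros assms) auto

lemma comp_on_if_bool [comp_intros]:
  assumes "comp_on D (\<lambda>p x. of_bool (C p x))" "comp_on D (\<lambda>p x. of_bool (P p x))"
    "comp_on D (\<lambda>p x. of_bool (Q p x))"
  shows "comp_on D (\<lambda>p x. of_bool (if C p x then P p x else Q p x))"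
  by (rule comp_on_cong[where F = "\<lambda>p x. if C p x then of_bool (P p x) else of_bool (Q p x)"], intro comp_intros assms) auto

definition is_word :: "nat => bool" where "is_word u \<longleftrightarrow> (\<forall>i<llen u. lnth u i < 2)"

lemma is_word_iff: "is_word u \<longleftrightarrow> (\<exists>w. u = wcode w)"
proof
  assume *: "is_word u"
  have "list_decode u = map of_bool (map (\<lambda>a. a = 1) (list_decode u))"
  proof (rule nth_equalityI)
    fix i assume i: "i < length (list_decode u)"
    then have "lnth u i < 2" using * llen_list_encode[of "list_decode u"] unfolding is_word_def by simp
    then have "list_decode u ! i < 2" using lnth_list_encode[OF i] by simp
    then show "list_decode u ! i = map of_bool (map (\<lambda>a. a = 1) (list_decode u)) ! i" using i by auto
  qed simp
  then have "u = wcode (map (\<lambda>a. a = 1) (list_decode u))"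
    unfolding wcode_def by (metis list_decode_inverse)
  then show "\<exists>w. u = wcode w" by blast
qed (auto simp: is_word_def lnth_wcode)

lemma comp_on_is_word [comp_intros]:
  assumes "comp_on D F" shows "comp_on D (\<lambda>p x. of_bool (is_word (F p x)))"
  unfolding is_word_def by (intro comp_intros assms comp_on_subst[OF assms])

text \<open>Section 0 is the game name \<open>p\<close>, section \<open>i + 1\<close> the characteristic functions of \<open>region i\<close>, for
  \<open>i \<le> j + 1\<close>; each limit adds one region.\<close>
definition lim_oracle :: "baire => nat => nat => baire" where
  "lim_oracle p n j z = (if pfst z = 0 then p (psnd z) else
     of_bool (pfst z \<le> Suc (Suc j) \<and> (\<exists>w. psnd (psnd z) = wcode w \<and> w \<in> name_region p n (pfst (psnd z)) (pfst z - 1))))"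

definition name_of :: "baire => baire" where "name_of q x = q (pr 0 x)"

definition region_at :: "baire => nat => nat => nat => bool" where
  "region_at q i c u \<longleftrightarrow> q (pr (Suc i) (pr c u)) \<noteq> 0"

lemma name_of_lim_oracle [simp]: "name_of (lim_oracle p n j) = p"
  by (rule ext) (simp add: name_of_def lim_oracle_def)

lemma region_at_lim_oracle: "i \<le> Suc j ==> region_at (lim_oracle p n j) i c u \<longleftrightarrow> (\<exists>w. u = wcode w \<and> w \<in> name_region p n c i)"
  by (auto simp: region_at_def lim_oracle_def)

lemma comp_on_name_of [comp_intros]: "comp_on D X ==> comp_on D (\<lambda>q x. name_of q (X q x))"
  unfolding name_of_def by (intro comp_intros)

lemma comp_on_region_at [comp_intros]:
  "comp_on D I ==> comp_on D C ==> comp_on D U ==> comp_on D (\<lambda>q x. of_bool (region_at q (I q x) (C q x) (U q x)))"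
  unfolding region_at_def by (intro comp_intros)

lemma comp_on_name_pref [comp_intros]:
  "comp_on D C ==> comp_on D E ==> comp_on D (\<lambda>q x. of_bool (name_pref (name_of q) (C q x) (E q x)))"
  unfolding name_pref_def by (intro comp_intros)

lemma comp_on_upper_name [comp_intros]:
  assumes "comp_on D C" "comp_on D X" shows "comp_on D (\<lambda>q x. upper_name (name_of q) (C q x) (X q x))"
  unfolding upper_name_def upper_code_def by (intro comp_intros assms comp_on_subst[OF assms(1)])

lemma comp_on_entered_code [comp_intros]:
  assumes "comp_on D C" "comp_on D B" "comp_on D K" "comp_on D U"
  shows "comp_on D (\<lambda>q x. of_bool (entered_code (name_of q) (C q x) (B q x) (K q x) (U q x)))"
  unfolding entered_code_def by (intro comp_intros assms assms[THEN comp_on_subst])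

definition mover_code :: "baire => nat => nat => nat => nat => bool" where
  "mover_code q n c \<beta> u \<longleftrightarrow> (name_of q (pr 1 u) = Suc (upper_name (name_of q) c 0)) = (\<beta> mod 2 \<noteq> n mod 2)"

text \<open>Elements of a decoded set are smaller than its code, so all of them are found below
  \<open>pfst f\<close> and the check is decidable from the oracle. Numbers that code no word are
  passed over, in accordance with \<open>cert\<close>.\<close>

definition cert_code :: "baire => nat => nat => nat => nat => nat => bool" where
  "cert_code q n c \<beta> f u \<longleftrightarrow> u \<in> set_decode (pfst f) \<and>
     (\<forall>v<pfst f. v \<in> set_decode (pfst f) \<and> is_word v --> \<not> region_at q (Suc \<beta>) c v \<and>
       (region_at q \<beta> c v \<or> entered_code (name_of q) c \<beta> (psnd f) v \<or>
        (if mover_code q n c \<beta> v then lsnoc v 0 \<in> set_decode (pfst f) \<or> lsnoc v 1 \<in> set_decode (pfst f)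
         else lsnoc v 0 \<in> set_decode (pfst f) \<and> lsnoc v 1 \<in> set_decode (pfst f))))"

lemma comp_on_cert_code [comp_intros]:
  assumes "comp_on D C" "comp_on D B" "comp_on D F" "comp_on D U"
  shows "comp_on D (\<lambda>q x. of_bool (cert_code q n (C q x) (B q x) (F q x) (U q x)))"
  unfolding cert_code_def mover_code_def by (intro comp_intros assms assms[THEN comp_on_subst])

lemma set_decode_less: "v \<in> set_decode F ==> v < F"
proof -
  assume "v \<in> set_decode F"
  then have "F div 2 ^ v \<noteq> 0" unfolding set_decode_def by (metis (no_types) even_zero mem_Collect_eq)
  then have "2 ^ v \<le> F" by (simp add: div_eq_0_iff not_less)
  then show ?thesis using less_exp[of v] by linarith
qed

text \<open>Checking a certificate for \<open>\<beta>\<close> consults the regions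
  \<open>\<beta>\<close> and \<open>\<beta> + 1\<close>; the oracle at stage \<open>j\<close>
  contains those up to \<open>j + 1\<close>.\<close>

lemma cert_code_iff:
  assumes "\<beta> \<le> j"
  shows "cert_code (lim_oracle p n j) n c \<beta> f (wcode w) \<longleftrightarrow> w \<in> region_cert (name_turn p) (attacker p c) n (entered p c) \<beta> f"
proof -
  define F where "F = {u. wcode u \<in> set_decode (pfst f)}"
  have snoc: "lsnoc (wcode v) 0 = wcode (v @ [False])" "lsnoc (wcode v) 1 = wcode (v @ [True])" for v
    using lsnoc_wcode[of v False] lsnoc_wcode[of v True] by simp_all
  have region_at: "region_at (lim_oracle p n j) (Suc \<beta>) c (wcode v) \<longleftrightarrow> v \<in> name_region p n c (Suc \<beta>)"
    "region_at (lim_oracle p n j) \<beta> c (wcode v) \<longleftrightarrow> v \<in> name_region p n c \<beta>" for v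
    using assms region_at_lim_oracle[of "Suc \<beta>" j p n c "wcode v"] region_at_lim_oracle[of \<beta> j p n c "wcode v"] by (auto simp: inj_wcode)
  have "cert_code (lim_oracle p n j) n c \<beta> f (wcode w) \<longleftrightarrow> wcode w \<in> set_decode (pfst f) \<and>
     (\<forall>v. wcode v \<in> set_decode (pfst f) --> \<not> region_at (lim_oracle p n j) (Suc \<beta>) c (wcode v) \<and>
       (region_at (lim_oracle p n j) \<beta> c (wcode v) \<or> entered_code p c \<beta> (psnd f) (wcode v) \<or>
        (if mover_code (lim_oracle p n j) n c \<beta> (wcode v)
         then lsnoc (wcode v) 0 \<in> set_decode (pfst f) \<or> lsnoc (wcode v) 1 \<in> set_decode (pfst f)
         else lsnoc (wcode v) 0 \<in> set_decode (pfst f) \<and> lsnoc (wcode v) 1 \<in> set_decode (pfst f))))"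
    unfolding cert_code_def is_word_iff name_of_lim_oracle using set_decode_less by blast
  also have "\<dots> \<longleftrightarrow> w \<in> F \<and> (\<forall>v\<in>F. v \<notin> name_region p n c (Suc \<beta>) \<and> (v \<in> name_region p n c \<beta> \<or> entered p c \<beta> (psnd f) v \<or>
      (if mover (name_turn p) (attacker p c) n \<beta> v then \<exists>b. v @ [b] \<in> F else \<forall>b. v @ [b] \<in> F)))"
    unfolding snoc region_at F_def mover_code_def mover_def entered_def name_turn_def name_of_lim_oracle ex_bool_eq all_bool_eq mem_Collect_eq
      Ball_def by (simp only: conj_commute disj_commute)
  also have "\<dots> \<longleftrightarrow> w \<in> region_cert (name_turn p) (attacker p c) n (entered p c) \<beta> f"
    unfolding region_cert_def cert_def attr_ok_def Let_def F_def[symmetric] by auto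
  finally show ?thesis .
qed

text \<open>Existence of a certificate is one existential question about a matrix decidable from the
  oracle. Outcome and position are both part of its argument, so one limit settles the new region
  for all of them.\<close>

lemma limcomp_lim_oracle: "limcomp j UNIV (\<lambda>p. lim_oracle p n j)"
proof (induction j)
  case 0
  have "comp_on UNIV (\<lambda>p z. if pfst z = 0 then p (psnd z) else 0)" by (intro comp_intros)
  moreover have "(if pfst z = 0 then p (psnd z) else 0) = lim_oracle p n 0 z" for p z
  proof -
    have "name_region p n c (pfst z - 1) = {}" if "pfst z \<noteq> 0" "pfst z \<le> 2" for c
    proof -
      have "pfst z - 1 = 0 \<or> pfst z - 1 = Suc 0" using that by arith
      then show ?thesis by auto
    qed
    then show ?thesis by (auto simp: lim_oracle_def numeral_2_eq_2)
  qed
  ultimately have "comp_on UNIV (\<lambda>p. lim_oracle p n 0)" by simp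
  then show ?case by (rule limcomp_0)
next
  case (Suc j)
  define R where "R q z f \<longleftrightarrow> is_word (psnd (psnd z)) \<and> cert_code q n (pfst (psnd z)) j f (psnd (psnd z))" for q z f
  \<comment> \<open>Region \<open>j + 2\<close> is kept in section \<open>j + 3\<close>.\<close>
  define J where "J q z = (if pfst z = Suc (Suc (Suc j)) then of_bool (\<exists>f. R q z f) else q z)" for q z
  have "limcomp 1 UNIV J"
  proof -
    have "comp_on UNIV (\<lambda>q z. of_bool (R q (pfst z) (psnd z)))" unfolding R_def by (intro comp_intros)
    from limcomp_bpair[OF limcomp_jump[OF this]]
    have "limcomp 1 UNIV (\<lambda>q. bpair q (\<lambda>x. of_bool (\<exists>m. R q x m)))" .
    moreover have "comp_on UNIV (\<lambda>r z. if pfst z = Suc (Suc (Suc j)) then bsnd r z else bfst r z)"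
      unfolding bfst_def bsnd_def by (intro comp_intros)
    ultimately have "limcomp 1 UNIV (\<lambda>q. (\<lambda>r z. if pfst z = Suc (Suc (Suc j)) then bsnd r z else bfst r z)
        (bpair q (\<lambda>x. of_bool (\<exists>m. R q x m))))"
      using limcomp_post by blast
    then show ?thesis by (simp add: J_def[abs_def] if_distrib cong: if_cong)
  qed
  from limcomp_comp[OF this Suc] have "limcomp (Suc j) UNIV (\<lambda>p. J (lim_oracle p n j))" by simp
  moreover have "J (lim_oracle p n j) = lim_oracle p n (Suc j)" for p
  proof
    fix z
    show "J (lim_oracle p n j) z = lim_oracle p n (Suc j) z"
    proof (cases "pfst z = Suc (Suc (Suc j))")
      case True
      let ?c = "pfst (psnd z)"
      have "(\<exists>f. R (lim_oracle p n j) z f) \<longleftrightarrow> (\<exists>w. psnd (psnd z) = wcode w \<and> w \<in> name_region p n ?c (Suc (Suc j)))"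
      proof -
        have "(\<exists>f. R (lim_oracle p n j) z f) \<longleftrightarrow>
            (\<exists>w. psnd (psnd z) = wcode w \<and> (\<exists>f. cert_code (lim_oracle p n j) n ?c j f (wcode w)))"
          unfolding R_def is_word_iff by metis
        also have "\<dots> \<longleftrightarrow> (\<exists>w. psnd (psnd z) = wcode w \<and> w \<in> name_region p n ?c (Suc (Suc j)))"
          unfolding cert_code_iff[OF order.refl] region.simps(3) attr_def region_cert_def by simp
        finally show ?thesis .
      qed
      then show ?thesis using True by (simp add: J_def lim_oracle_def)
    next
      case False
      then have "pfst z \<le> Suc (Suc (Suc j)) \<longleftrightarrow> pfst z \<le> Suc (Suc j)" by auto
      with False show ?thesis by (simp add: J_def lim_oracle_def)
    qed
  qed
  ultimately show ?case by simp
qed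

definition level_code :: "baire => nat => nat => nat => nat" where
  "level_code q n c u = (LEAST \<beta>. \<beta> = n \<or> region_at q (Suc (Suc \<beta>)) c u)"

definition least_cert_code :: "baire => nat => nat => nat => nat" where
  "least_cert_code q n c u = (LEAST f. level_code q n c u < n --> cert_code q n c (level_code q n c u) f u)"

definition strat_code :: "baire => nat => nat => nat => bool" where
  "strat_code q n c u = (if level_code q n c u < n \<and>
      (cert_code q n c (level_code q n c u) (least_cert_code q n c u) (lsnoc u 0) \<or>
       cert_code q n c (level_code q n c u) (least_cert_code q n c u) (lsnoc u 1))
     then cert_code q n c (level_code q n c u) (least_cert_code q n c u) (lsnoc u 1)
     else \<not> region_at q (Suc (level_code q n c u)) c (lsnoc u 1))"

definition win_code :: "baire => nat => nat => nat => bool" where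
  "win_code q n c u \<longleftrightarrow> (level_code q n c u mod 2 \<noteq> n mod 2) = (upper_name (name_of q) c 0 = 0)"

definition value_code :: "baire => nat => nat => nat" where
  "value_code q n u = (LEAST c. c = name_of q (pr 0 0) \<or>
     (win_code q n c u \<and> (\<forall>b<name_of q (pr 0 0). name_pref (name_of q) c b --> \<not> win_code q n b u)))"

definition eq_strat_code :: "baire => nat => nat => bool" where
  "eq_strat_code q n u = (if name_of q (pr 1 u) = 1 then strat_code q n (value_code q n u) u
     else (\<exists>d<name_of q (pr 0 0). name_pref (name_of q) (value_code q n u) d) \<and>
       strat_code q n (next_outcome (name_of q) (value_code q n u)) u)"

lemma comp_on_level_code [comp_intros]:
  assumes "comp_on D C" "comp_on D U"
  shows "comp_on D (\<lambda>q x. level_code q n (C q x) (U q x))"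
  unfolding level_code_def by (intro comp_intros assms[THEN comp_on_subst]) auto

lemma comp_on_win_code [comp_intros]:
  assumes "comp_on D C" "comp_on D U"
  shows "comp_on D (\<lambda>q x. of_bool (win_code q n (C q x) (U q x)))"
  unfolding win_code_def by (intro comp_intros assms)

lemma comp_on_value_code [comp_intros]:
  assumes "comp_on D U" shows "comp_on D (\<lambda>q x. value_code q n (U q x))"
  unfolding value_code_def by (intro comp_intros assms[THEN comp_on_subst]) auto

lemma comp_on_next_outcome [comp_intros]:
  assumes "comp_on D C" shows "comp_on D (\<lambda>q x. next_outcome (name_of q) (C q x))"
  unfolding next_outcome_def by (intro comp_intros assms[THEN comp_on_subst]) auto

text \<open>The searches for level, value and next outcome carry a default bound. This one ends
  because the regions in the oracle are genuine, which confines the moves to oracles of the form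
  \<open>lim_oracle p n n\<close>.\<close>

lemma cert_code_ex:
  assumes "q \<in> range (\<lambda>p. lim_oracle p n n)"
  shows "\<exists>f. level_code q n c u < n --> cert_code q n c (level_code q n c u) f u"
proof (cases "level_code q n c u < n")
  case True
  from assms obtain p where q: "q = lim_oracle p n n" by auto
  have "region_at q (Suc (Suc (level_code q n c u))) c u"
    using LeastI[of "\<lambda>\<beta>. \<beta> = n \<or> region_at q (Suc (Suc \<beta>)) c u" n] True unfolding level_code_def by auto
  then obtain w where w: "u = wcode w" "w \<in> name_region p n c (Suc (Suc (level_code q n c u)))"
    unfolding q using True region_at_lim_oracle[of "Suc (Suc (level_code q n c u))" n p n c u] q by auto
  then obtain f where "w \<in> region_cert (name_turn p) (attacker p c) n (entered p c) (level_code q n c u) f"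
    unfolding region.simps(3) attr_def region_cert_def by auto
  then show ?thesis using cert_code_iff[of "level_code q n c u" n p n c f w] True q w(1) by auto
qed simp

lemma comp_on_least_cert_code:
  assumes "comp_on (range (\<lambda>p. lim_oracle p n n)) C" "comp_on (range (\<lambda>p. lim_oracle p n n)) U"
  shows "comp_on (range (\<lambda>p. lim_oracle p n n)) (\<lambda>q x. least_cert_code q n (C q x) (U q x))"
  unfolding least_cert_code_def by (intro comp_intros assms[THEN comp_on_subst] cert_code_ex)

lemma comp_on_strat_code:
  assumes "comp_on (range (\<lambda>p. lim_oracle p n n)) C" "comp_on (range (\<lambda>p. lim_oracle p n n)) U"
  shows "comp_on (range (\<lambda>p. lim_oracle p n n)) (\<lambda>q x. of_bool (strat_code q n (C q x) (U q x)))"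
  unfolding strat_code_def by (intro comp_intros comp_on_least_cert_code assms)

lemma comp_on_eq_strat_code: "comp_on (range (\<lambda>p. lim_oracle p n n)) (\<lambda>q x. of_bool (eq_strat_code q n x))"
  unfolding eq_strat_code_def by (intro comp_intros comp_on_strat_code)

text \<open>The oracle stops at region \<open>n + 1\<close>, so the two predicates are compared only
  up to \<open>n\<close>; since \<open>n\<close> satisfies both, that covers both minima.\<close>

lemma level_code_lim_oracle: "level_code (lim_oracle p n n) n c (wcode w) = name_level p n c w"
proof -
  let ?P = "\<lambda>\<beta>. \<beta> = n \<or> region_at (lim_oracle p n n) (Suc (Suc \<beta>)) c (wcode w)"
  let ?Q = "\<lambda>\<beta>. \<beta> = n \<or> w \<in> name_region p n c (Suc (Suc \<beta>))"
  have eq: "?P \<beta> \<longleftrightarrow> ?Q \<beta>" if "\<beta> \<le> n" for \<beta>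
    using that region_at_lim_oracle[of "Suc (Suc \<beta>)" n p n c "wcode w"] by (cases "\<beta> = n") (auto simp: inj_wcode)
  have P: "?P (LEAST \<beta>. ?P \<beta>)" "(LEAST \<beta>. ?P \<beta>) \<le> n" by (rule LeastI[of ?P n], simp, rule Least_le, simp)
  have Q: "?Q (LEAST \<beta>. ?Q \<beta>)" "(LEAST \<beta>. ?Q \<beta>) \<le> n" by (rule LeastI[of ?Q n], simp, rule Least_le, simp)
  have "(LEAST \<beta>. ?P \<beta>) \<le> (LEAST \<beta>. ?Q \<beta>)" by (rule Least_le) (use Q eq in blast)
  moreover have "(LEAST \<beta>. ?Q \<beta>) \<le> (LEAST \<beta>. ?P \<beta>)" by (rule Least_le) (use P eq in blast)
  ultimately show ?thesis unfolding level_code_def level_def by simp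
qed

lemma lsnoc_wcode_01: "lsnoc (wcode w) 0 = wcode (w @ [False])" "lsnoc (wcode w) 1 = wcode (w @ [True])"
  using lsnoc_wcode[of w False] lsnoc_wcode[of w True] by simp_all

lemma strat_code_lim_oracle: "strat_code (lim_oracle p n n) n c (wcode w) = name_strat p n c w"
proof -
  let ?l = "name_level p n c w"
  have le: "?l \<le> n" unfolding level_def by (rule Least_le) simp
  have cert: "cert_code (lim_oracle p n n) n c ?l f (wcode v) \<longleftrightarrow> v \<in> region_cert (name_turn p) (attacker p c) n (entered p c) ?l f" for f v
    by (rule cert_code_iff[OF le])
  have region_at: "region_at (lim_oracle p n n) (Suc ?l) c (wcode v) \<longleftrightarrow> v \<in> name_region p n c (Suc ?l)" for v
    using region_at_lim_oracle[of "Suc ?l" n p n c "wcode v"] le by (simp add: inj_wcode)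
  show ?thesis
    unfolding strat_code_def lstrat_def least_cert_code_def least_cert_def level_code_lim_oracle lsnoc_wcode_01 cert region_at Let_def ..
qed

lemma win_code_lim_oracle: "win_code (lim_oracle p n n) n c (wcode w) \<longleftrightarrow> w \<in> win_region p n c"
  by (simp add: win_code_def win_region_def level_code_lim_oracle)

lemma value_code_lim_oracle: "value_code (lim_oracle p n n) n (wcode w) = name_value p n w"
  by (simp add: value_code_def name_value_def win_code_lim_oracle)

lemma eq_strat_code_lim_oracle: "eq_strat_code (lim_oracle p n n) n (wcode w) = eq_strat p n w"
  by (simp add: eq_strat_code_def eq_strat_def value_code_lim_oracle strat_code_lim_oracle name_turn_def)

theorem limcomp_SPE:
  "\<exists>F. limcomp n UNIV F \<and> (\<forall>p G. game_name n p G --> F p \<in> SPE_prob n p)"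
proof (intro exI[of _ "\<lambda>p x. of_bool (eq_strat_code (lim_oracle p n n) n x)"] conjI allI impI)
  show "limcomp n UNIV (\<lambda>p x. of_bool (eq_strat_code (lim_oracle p n n) n x))"
    by (rule limcomp_post[OF comp_on_eq_strat_code limcomp_lim_oracle]) simp
next
  fix p G assume "game_name n p G"
  moreover from this have "is_SPE G (eq_strat p n)" by (rule is_SPE_eq_strat)
  moreover have "strat_name (\<lambda>x. of_bool (eq_strat_code (lim_oracle p n n) n x)) (eq_strat p n)"
    by (simp add: strat_name_def eq_strat_code_lim_oracle)
  ultimately show "(\<lambda>x. of_bool (eq_strat_code (lim_oracle p n n) n x)) \<in> SPE_prob n p"
    unfolding SPE_prob_def by blast
qed

lemma SPE_prob_le_lim_iter: "SPE_prob n \<le>\<^sub>W lim_iter n"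
proof -
  obtain F where F: "limcomp n UNIV F" "\<And>p G. game_name n p G ==> F p \<in> SPE_prob n p"
    using limcomp_SPE[of n] by blast
  show ?thesis
  proof (rule W_le_lim_iterI[of n _ F])
    show "limcomp n {p. SPE_prob n p \<noteq> {}} F" using F(1) by (rule limcomp_subset) simp
    show "F p \<in> SPE_prob n p" if "SPE_prob n p \<noteq> {}" for p
      using that F(2)[of p] unfolding SPE_prob_def by blast
  qed
qed

section \<open>Alternating normal form of iterated limits\<close>

text \<open>The class Sigma_n relative to \<open>p\<close>, uniformly on \<open>D\<close>. A
  negation under the quantifier replaces the dual class, so that a single recursion suffices and
  mirrors the alternation of players.\<close>

primrec Sig :: "baire set => nat => (baire => nat => bool) => bool" where
  "Sig D 0 A \<longleftrightarrow> comp_on D (\<lambda>p x. of_bool (A p x))"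
| "Sig D (Suc n) A \<longleftrightarrow> (\<exists>B. Sig D n B \<and> (\<forall>p\<in>D. \<forall>x. A p x \<longleftrightarrow> (\<exists>m. \<not> B p (pr x m))))"

declare Sig.simps(2) [simp del]

lemma Sig_SucI: "Sig D n B ==> (\<And>p x. p \<in> D ==> A p x \<longleftrightarrow> (\<exists>m. \<not> B p (pr x m))) ==> Sig D (Suc n) A"
  unfolding Sig.simps(2) by blast

lemma Sig_SucE:
  assumes "Sig D (Suc n) A"
  obtains B where "Sig D n B" "\<And>p x. p \<in> D ==> A p x \<longleftrightarrow> (\<exists>m. \<not> B p (pr x m))"
  using assms unfolding Sig.simps(2) by blast

primrec alternation :: "nat => (nat => bool) => nat => bool" where
  "alternation 0 R x = R x"
| "alternation (Suc n) R x = (\<exists>m. \<not> alternation n R (pr x m))"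

lemma Sig_alternation:
  "Sig D n A ==> \<exists>R. comp_on D (\<lambda>p x. of_bool (R p x)) \<and> (\<forall>p\<in>D. \<forall>x. A p x \<longleftrightarrow> alternation n (R p) x)"
proof (induction n arbitrary: A)
  case (Suc n)
  from Suc.prems(1) obtain B where B: "Sig D n B" "\<And>p x. p \<in> D ==> A p x \<longleftrightarrow> (\<exists>m. \<not> B p (pr x m))"
    by (rule Sig_SucE) blast
  from Suc.IH[OF B(1)] obtain R where R: "comp_on D (\<lambda>p x. of_bool (R p x))"
    "\<forall>p\<in>D. \<forall>x. B p x \<longleftrightarrow> alternation n (R p) x" by blast
  show ?case by (rule exI[of _ R]) (use B R in simp)
qed auto

lemma Sig_cong: "Sig D n A ==> (\<And>p x. p \<in> D ==> A p x = B p x) ==> Sig D n B"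
proof (cases n)
  case 0
  assume "Sig D n A" "\<And>p x. p \<in> D ==> A p x = B p x"
  then show ?thesis using 0 comp_on_cong[of D "\<lambda>p x. of_bool (A p x)" "\<lambda>p x. of_bool (B p x)"] by simp
next
  case (Suc m)
  assume "Sig D n A" and eq: "\<And>p x. p \<in> D ==> A p x = B p x"
  then show ?thesis unfolding Suc Sig.simps(2) by blast
qed

lemma Sig_subst: "Sig D n A ==> comp_on D f ==> Sig D n (\<lambda>p x. A p (f p x))"
proof (induction n arbitrary: A f)
  case 0
  then show ?case using comp_on_subst[of D "\<lambda>p x. of_bool (A p x)" f] by simp
next
  case (Suc n)
  from Suc.prems(1) obtain B where B: "Sig D n B" "\<And>p x. p \<in> D ==> A p x \<longleftrightarrow> (\<exists>m. \<not> B p (pr x m))"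
    by (rule Sig_SucE) blast
  have "Sig D n (\<lambda>p z. B p (pr (f p (pfst z)) (psnd z)))"
    by (rule Suc.IH[OF B(1), of "\<lambda>p z. pr (f p (pfst z)) (psnd z)"])
      (intro comp_intros comp_on_subst[OF Suc.prems(2)])
  then show ?case by (rule Sig_SucI) (use B(2) in simp)
qed

lemma Sig_not: "Sig D n A ==> Sig D (Suc n) (\<lambda>p x. \<not> A p x)"
proof -
  assume "Sig D n A"
  then have "Sig D n (\<lambda>p z. A p (pfst z))"
    by (rule Sig_subst[where f = "\<lambda>p z. pfst z"]) (rule comp_on_pfst[OF comp_on_id])
  then show ?thesis by (rule Sig_SucI) simp
qed

lemma Sig_Suc: "Sig D n A ==> Sig D (Suc n) A"
proof (induction n arbitrary: A)
  case 0
  then have "Sig D 0 (\<lambda>p x. \<not> A p x)" by (simp add: comp_on_not)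
  from Sig_not[OF this] show ?case by simp
next
  case (Suc n)
  from Suc.prems(1) obtain B where B: "Sig D n B" "\<And>p x. p \<in> D ==> A p x \<longleftrightarrow> (\<exists>m. \<not> B p (pr x m))"
    by (rule Sig_SucE) blast
  show ?case by (rule Sig_SucI[OF Suc.IH[OF B(1)] B(2)])
qed

lemma Sig_decidable: "comp_on D (\<lambda>p x. of_bool (A p x)) ==> Sig D n A"
  by (induction n) (auto intro: Sig_Suc)

text \<open>The negation under the quantifier exchanges the two connectives from one level to the
  next, so they are treated together. A conjunction needs a pair of witnesses, a disjunction can
  share one.\<close>

lemma Sig_conj_disj:
  "Sig D n A ==> Sig D n B ==> Sig D n (\<lambda>p x. A p x \<and> B p x) \<and> Sig D n (\<lambda>p x. A p x \<or> B p x)"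
proof (induction n arbitrary: A B)
  case 0
  then show ?case unfolding Sig.simps by (intro conjI comp_on_conj comp_on_disj)
next
  case (Suc n)
  from Suc.prems(1) obtain A' where A': "Sig D n A'" "\<And>p x. p \<in> D ==> A p x \<longleftrightarrow> (\<exists>m. \<not> A' p (pr x m))"
    by (rule Sig_SucE) blast
  from Suc.prems(2) obtain B' where B': "Sig D n B'" "\<And>p x. p \<in> D ==> B p x \<longleftrightarrow> (\<exists>m. \<not> B' p (pr x m))"
    by (rule Sig_SucE) blast
  let ?C = "\<lambda>p z. A' p (pr (pfst z) (pfst (psnd z))) \<or> B' p (pr (pfst z) (psnd (psnd z)))"
  have "Sig D n ?C"
    by (rule conjunct2[OF Suc.IH]) (intro Sig_subst[OF A'(1)] Sig_subst[OF B'(1)] comp_intros)+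
  moreover have "(A p x \<and> B p x) \<longleftrightarrow> (\<exists>m. \<not> ?C p (pr x m))" if p: "p \<in> D" for p x
  proof
    assume "A p x \<and> B p x"
    then obtain k l where "\<not> A' p (pr x k)" "\<not> B' p (pr x l)" using A'(2)[OF p] B'(2)[OF p] by blast
    then show "\<exists>m. \<not> ?C p (pr x m)" by (intro exI[of _ "pr k l"]) simp
  qed (use A'(2)[OF p] B'(2)[OF p] in auto)
  ultimately have "Sig D (Suc n) (\<lambda>p x. A p x \<and> B p x)" by (rule Sig_SucI)
  moreover have "Sig D n (\<lambda>p z. A' p z \<and> B' p z)" using Suc.IH[OF A'(1) B'(1)] by blast
  then have "Sig D (Suc n) (\<lambda>p x. A p x \<or> B p x)"
    by (rule Sig_SucI) (use A'(2) B'(2) in auto)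
  ultimately show ?case by blast
qed

text \<open>Two adjacent existential quantifiers merge by pairing their witnesses.\<close>

lemma Sig_ex:
  assumes "Sig D (Suc n) (\<lambda>p z. A p (pfst z) (psnd z))"
  shows "Sig D (Suc n) (\<lambda>p x. \<exists>m. A p x m)"
proof -
  from assms obtain B where B: "Sig D n B" "\<And>p z. p \<in> D ==> A p (pfst z) (psnd z) \<longleftrightarrow> (\<exists>m. \<not> B p (pr z m))"
    by (rule Sig_SucE) blast
  let ?C = "\<lambda>p z. B p (pr (pr (pfst z) (pfst (psnd z))) (psnd (psnd z)))"
  have "Sig D n ?C" by (intro Sig_subst[OF B(1)] comp_intros)
  moreover have "(\<exists>m. A p x m) \<longleftrightarrow> (\<exists>m. \<not> ?C p (pr x m))" if p: "p \<in> D" for p x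
  proof
    assume "\<exists>m. A p x m"
    then obtain m where "A p (pfst (pr x m)) (psnd (pr x m))" by auto
    then obtain k where "\<not> B p (pr (pr x m) k)" using B(2)[OF p] by blast
    then show "\<exists>m. \<not> ?C p (pr x m)" by (intro exI[of _ "pr m k"]) simp
  next
    assume "\<exists>m. \<not> ?C p (pr x m)"
    then obtain m where "\<not> B p (pr (pr x (pfst m)) (psnd m))" by auto
    then have "A p (pfst (pr x (pfst m))) (psnd (pr x (pfst m)))" using B(2)[OF p] by blast
    then show "\<exists>m. A p x m" by auto
  qed
  ultimately show ?thesis by (rule Sig_SucI)
qed

section \<open>Quantifier complexity of iterated limits\<close>

lemma limN_Suc_right: "limN (Suc n) p r \<longleftrightarrow> (\<exists>s. limN n p s \<and> is_lim s r)"
proof (induction n arbitrary: p)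
  case (Suc n)
  have "limN (Suc (Suc n)) p r \<longleftrightarrow> (\<exists>s. is_lim p s \<and> (\<exists>u. limN n s u \<and> is_lim u r))"
    unfolding limN.simps(2)[of "Suc n"] Suc.IH ..
  then show ?case unfolding limN.simps(2)[of n] by blast
qed simp

text \<open>\<open>g (pr k j) \<noteq> v\<close> for some \<open>j \<ge> i\<close>, phrased via the graph of \<open>g\<close>.\<close>
definition changes :: "baire => nat => nat => nat => bool" where
  "changes g k i v \<longleftrightarrow> (\<exists>j w. i \<le> j \<and> w \<noteq> v \<and> g (pr k j) = w)"

lemma changes_iff: "\<not> changes g k i v \<longleftrightarrow> (\<forall>j\<ge>i. g (pr k j) = v)"
  unfolding changes_def by blast

lemma Sig_changes:
  assumes G: "Sig D (Suc n) (\<lambda>p x. G p (pfst x) = psnd x)" and "comp_on D K" "comp_on D I" "comp_on D X"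
  shows "Sig D (Suc n) (\<lambda>p x. changes (G p) (K p x) (I p x) (X p x))"
proof -
  have 1: "Sig D (Suc n) (\<lambda>p z. I p (pfst (pfst z)) \<le> psnd (pfst z))"
    by (intro Sig_decidable comp_intros assms(2-4)[THEN comp_on_subst])
  have 2: "Sig D (Suc n) (\<lambda>p z. psnd z \<noteq> X p (pfst (pfst z)))"
    by (intro Sig_decidable comp_intros assms(2-4)[THEN comp_on_subst])
  have "comp_on D (\<lambda>p z. pr (pr (K p (pfst (pfst z))) (psnd (pfst z))) (psnd z))"
    by (intro comp_intros assms(2-4)[THEN comp_on_subst])
  from Sig_subst[OF G this]
  have 3: "Sig D (Suc n) (\<lambda>p z. G p (pr (K p (pfst (pfst z))) (psnd (pfst z))) = psnd z)" by simp
  show ?thesis unfolding changes_def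
    by (intro Sig_ex conjunct1[OF Sig_conj_disj] 1 2 3)
qed

lemma is_lim_iff_changes: "is_lim g r \<longleftrightarrow> (\<forall>k. \<exists>i. \<not> changes g k i (r k))"
  unfolding is_lim_def changes_iff eventually_sequentially ..

lemma is_lim_eqI: "is_lim g r ==> \<not> changes g k i v ==> r k = v"
proof -
  assume "is_lim g r" "\<not> changes g k i v"
  then obtain i' where "\<forall>j\<ge>i'. g (pr k j) = r k" "\<forall>j\<ge>i. g (pr k j) = v"
    unfolding is_lim_iff_changes changes_iff by blast
  then have "g (pr k (max i i')) = r k" "g (pr k (max i i')) = v" using max.cobounded1 max.cobounded2 by blast+
  then show "r k = v" by metis
qed

text \<open>A change in the inner limit is expressed through the graph of that limit without raising
  the level; that no change occurs from some stage on then costs one more quantifier.\<close>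

lemma Sig_graph_limN:
  "(\<And>p. p \<in> D ==> limN n p (F p)) ==> Sig D (Suc n) (\<lambda>p x. F p (pfst x) = psnd x)"
proof (induction n arbitrary: F)
  case 0
  have "Sig D (Suc 0) (\<lambda>p x. p (pfst x) = psnd x)" by (intro Sig_decidable comp_intros)
  then show ?case by (rule Sig_cong) (use 0 in simp)
next
  case (Suc n)
  have "\<forall>p\<in>D. \<exists>s. limN n p s \<and> is_lim s (F p)" using Suc.prems unfolding limN_Suc_right by blast
  then obtain G where G: "\<And>p. p \<in> D ==> limN n p (G p)" "\<And>p. p \<in> D ==> is_lim (G p) (F p)" by metis
  let ?B = "\<lambda>p z. changes (G p) (pfst (pfst z)) (psnd z) (psnd (pfst z))"
  have "Sig D (Suc n) ?B" by (intro Sig_changes Suc.IH G(1) comp_intros)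
  moreover have "F p (pfst x) = psnd x \<longleftrightarrow> (\<exists>i. \<not> ?B p (pr x i))" if "p \<in> D" for p x
  proof
    assume eq: "F p (pfst x) = psnd x"
    from G(2)[OF that] obtain i where "\<not> changes (G p) (pfst x) i (F p (pfst x))"
      unfolding is_lim_iff_changes by blast
    then show "\<exists>i. \<not> ?B p (pr x i)" unfolding eq by (intro exI[of _ i]) simp
  qed (use is_lim_eqI[OF G(2)[OF that], of "pfst x" _ "psnd x"] in auto)
  ultimately show ?case by (rule Sig_SucI)
qed

text \<open>The graph of an \<open>n + 1\<close>-fold limit would take one quantifier more. Instead
  \<open>z\<close> pairs a stage with a candidate value, and \<open>Q\<close> asks whether the inner
  limit still differs from the candidate after that stage; any negative answer identifies the
  value.\<close>

lemma limN_queries: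
  assumes "\<And>p. p \<in> D ==> limN (Suc n) p (F p)"
  shows "\<exists>Q. Sig D (Suc n) Q \<and> (\<forall>p\<in>D. \<forall>k.
    (\<exists>z. \<not> Q p (pr k z)) \<and> (\<forall>z. \<not> Q p (pr k z) --> F p k = psnd z))"
proof -
  have "\<forall>p\<in>D. \<exists>s. limN n p s \<and> is_lim s (F p)" using assms unfolding limN_Suc_right by blast
  then obtain G where G: "\<And>p. p \<in> D ==> limN n p (G p)" "\<And>p. p \<in> D ==> is_lim (G p) (F p)" by metis
  let ?Q = "\<lambda>p x. changes (G p) (pfst x) (pfst (psnd x)) (psnd (psnd x))"
  have "Sig D (Suc n) ?Q" by (intro Sig_changes Sig_graph_limN G(1) comp_intros)
  moreover have "\<exists>z. \<not> ?Q p (pr k z)" if "p \<in> D" for p k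
  proof -
    from G(2)[OF that] obtain i where "\<not> changes (G p) k i (F p k)" unfolding is_lim_iff_changes by blast
    then show ?thesis by (intro exI[of _ "pr i (F p k)"]) simp
  qed
  moreover have "F p k = psnd z" if "p \<in> D" "\<not> ?Q p (pr k z)" for p k z
    using is_lim_eqI[OF G(2)[OF that(1)]] that(2) by simp
  ultimately show ?thesis by (intro exI[of _ ?Q]) blast
qed

section \<open>A game that answers alternating queries\<close>

text \<open>A play is read as blocks \<open>0\<^sup>m 1\<close>; a state consists of the number \<open>j\<close> of completed blocks, the
  argument built so far and the length of the current block. The first block selects the argument \<open>x\<close>.
  In the second one, player 1 either opts out with \<open>m = 0\<close> (state \<open>n + 2\<close>) or names the first witness \<open>m - 1\<close>.
  From then on the players name witnesses in turn, until \<open>n\<close> of them have been named (state \<open>n + 1\<close>).\<close>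
definition step_code :: "nat => nat => nat => nat" where
  "step_code n s b = (if n < pfst s then s
     else if b = 0 then pr (pfst s) (pr (pfst (psnd s)) (Suc (psnd (psnd s))))
     else if pfst s = 0 then pr 1 (pr (psnd (psnd s)) 0)
     else if pfst s = 1 then (if psnd (psnd s) = 0 then pr (n + 2) (pr (pfst (psnd s)) 0)
       else pr 2 (pr (pr (pfst (psnd s)) (psnd (psnd s) - 1)) 0))
     else pr (Suc (pfst s)) (pr (pr (pfst (psnd s)) (psnd (psnd s))) 0))"

definition state_code :: "nat => nat => nat" where
  "state_code n u = rec_nat (pr 0 (pr 0 0)) (\<lambda>i s. step_code n s (lnth u i)) (llen u)"

definition block_state :: "nat => bool list => nat" where "block_state n w = state_code n (wcode w)"

definition blocks :: "nat => bool list => nat" where "blocks n w = pfst (block_state n w)"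

text \<open>A play that stops at \<open>j\<close> completed blocks,
  \<open>1 \<le> j \<le> n\<close>, gets first index \<open>n + 1 - j\<close>, whose parity makes
  the player who never ends the block lose. Index 0 is reserved for the evaluation of
  \<open>R\<close> after the last block.\<close>

definition index_state :: "nat => (nat => bool) => nat => nat => bool" where
  "index_state n R \<beta> s \<longleftrightarrow> (if \<beta> = 0 then pfst s = Suc n \<and> \<not> R (pfst (psnd s))
     else Suc n - \<beta> \<le> pfst s \<and> pfst s \<le> Suc n)"

text \<open>\<open>t\<close> stands for the plays of value at least \<open>t\<close>. Index
  \<open>n - 1\<close> has the parity that puts a play into the named set, so enlarging the last
  open set yields the whole space for \<open>t = 0\<close> and adds the opt-outs for
  \<open>t = 1\<close>; for \<open>t = 3\<close> all sets are empty.\<close>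

definition threshold_state :: "nat => (nat => bool) => nat => nat => nat => bool" where
  "threshold_state n R t \<beta> s \<longleftrightarrow> (t = 0 \<and> Suc \<beta> = n) \<or> (t = 1 \<and> (index_state n R \<beta> s \<or> Suc \<beta> = n \<and> pfst s = n + 2)) \<or>
     (t = 2 \<and> index_state n R \<beta> s)"

definition thr_open :: "nat => (nat => bool) => nat => nat => cantor set" where
  "thr_open n R t \<beta> = {x. \<exists>k. threshold_state n R t \<beta> (block_state n (pre x k))}"

definition opts_out :: "nat => cantor => bool" where "opts_out n x \<longleftrightarrow> (\<exists>k. blocks n (pre x k) = n + 2)"

definition query_val :: "nat => (nat => bool) => cantor => nat" where
  "query_val n R x = (if opts_out n x then 1 else if first_idx n (thr_open n R 2) x mod 2 \<noteq> n mod 2 then 2 else 0)"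

text \<open>Outcomes 0, 1 and 2 mean lost, opted out and won for player 1. All arguments sit in one
  game, as the subgames after a first block, and subgame perfection constrains each of them.\<close>

definition query_game :: "nat => (nat => bool) => game" where
  "query_game n R = \<lparr>noutc = 3, turn = (\<lambda>w. if even (blocks n w) then 2 else 1), pref1 = (<), val = query_val n R\<rparr>"

lemma query_game_simps [simp]: "noutc (query_game n R) = 3" "turn (query_game n R) w = (if even (blocks n w) then 2 else 1)"
  "pref1 (query_game n R) = (<)" "val (query_game n R) = query_val n R"
  by (simp_all add: query_game_def)

lemma gst_Nil: "block_state n [] = pr 0 (pr 0 0)"
  by (simp add: block_state_def state_code_def)

lemma block_state_snoc: "block_state n (w @ [b]) = step_code n (block_state n w) (of_bool b)"
proof -
  have "i \<le> length w ==> rec_nat (pr 0 (pr 0 0)) (\<lambda>i s. step_code n s (lnth (wcode (w @ [b])) i)) i =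
      rec_nat (pr 0 (pr 0 0)) (\<lambda>i s. step_code n s (lnth (wcode w) i)) i" for i
    by (induction i) (simp_all add: lnth_wcode nth_append)
  then show ?thesis by (simp add: block_state_def state_code_def lnth_wcode)
qed

lemma block_state_pre_Suc: "block_state n (pre x (Suc k)) = step_code n (block_state n (pre x k)) (of_bool (x k))"
  by (simp add: pre_Suc block_state_snoc)

lemma blocks_step: "blocks n (pre x k) \<le> blocks n (pre x (Suc k))"
  unfolding blocks_def block_state_pre_Suc by (auto simp: step_code_def)

lemma blocks_mono: "k \<le> l ==> blocks n (pre x k) \<le> blocks n (pre x l)"
  by (induction l rule: dec_induct) (auto intro: order.trans blocks_step)

lemma block_state_absorbing: "k \<le> l ==> n < blocks n (pre x k) ==> block_state n (pre x l) = block_state n (pre x k)"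
proof (induction l rule: dec_induct)
  case (step l)
  then show ?case unfolding block_state_pre_Suc blocks_def by (auto simp: step_code_def)
qed simp

lemma blocks_witness_phase:
  "k \<le> l ==> 2 \<le> blocks n (pre x k) \<and> blocks n (pre x k) \<le> Suc n ==> 2 \<le> blocks n (pre x l) \<and> blocks n (pre x l) \<le> Suc n"
proof (induction l rule: dec_induct)
  case (step l)
  then show ?case unfolding blocks_def block_state_pre_Suc by (auto simp: step_code_def)
qed simp

text \<open>Opting out jumps from 1 completed block to the count \<open>n + 2\<close>, so such a
  play never has a count between 2 and \<open>n + 1\<close>.\<close>

lemma opts_out_not_thr_open:
  assumes "opts_out n x" "\<beta> < n" shows "x \<notin> thr_open n R 2 \<beta>"
proof
  assume "x \<in> thr_open n R 2 \<beta>"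
  then obtain l where l: "index_state n R \<beta> (block_state n (pre x l))" by (auto simp: thr_open_def threshold_state_def)
  then have b: "2 \<le> blocks n (pre x l)" "blocks n (pre x l) \<le> Suc n"
    using assms(2) unfolding index_state_def blocks_def by (auto split: if_splits)
  obtain k where k: "blocks n (pre x k) = n + 2" using assms(1) by (auto simp: opts_out_def)
  show False
  proof (cases "l \<le> k")
    case True
    then show False using blocks_witness_phase[OF True, of n x] b k by simp
  next
    case False
    then show False using blocks_mono[of k l n x] k b by simp
  qed
qed

lemma first_idx_None: "(\<And>\<beta>. \<beta> < n ==> x \<notin> U \<beta>) ==> first_idx n U x = n"
  by (auto simp: first_idx_def)

lemma first_idx_eq: "\<beta> < n ==> x \<in> U \<beta> ==> (\<And>\<gamma>. \<gamma> < \<beta> ==> x \<notin> U \<gamma>) ==> first_idx n U x = \<beta>"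
proof -
  assume a: "\<beta> < n" "x \<in> U \<beta>" "\<And>\<gamma>. \<gamma> < \<beta> ==> x \<notin> U \<gamma>"
  have "(LEAST \<gamma>. \<gamma> < n \<and> x \<in> U \<gamma>) = \<beta>"
    by (rule Least_equality) (use a in \<open>meson not_less\<close>)+
  then show ?thesis using a unfolding first_idx_def by auto
qed

lemma first_idx_cong: "(\<And>\<beta>. \<beta> < n ==> x \<in> U \<beta> \<longleftrightarrow> x \<in> U' \<beta>) ==> first_idx n U x = first_idx n U' x"
proof -
  assume *: "\<And>\<beta>. \<beta> < n ==> x \<in> U \<beta> \<longleftrightarrow> x \<in> U' \<beta>"
  have "(\<lambda>\<beta>. \<beta> < n \<and> x \<in> U \<beta>) = (\<lambda>\<beta>. \<beta> < n \<and> x \<in> U' \<beta>)" using * by auto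
  then show ?thesis unfolding first_idx_def by (simp only:)
qed

lemma query_val_thresholds:
  assumes "1 \<le> n" "t \<le> 3"
  shows "{x. first_idx n (thr_open n R t) x mod 2 \<noteq> n mod 2} = {x. t \<le> query_val n R x}"
proof -
  have "(first_idx n (thr_open n R t) x mod 2 \<noteq> n mod 2) = (t \<le> query_val n R x)" for x
  proof -
    have last: "first_idx n (thr_open n R t) x mod 2 \<noteq> n mod 2" if "first_idx n (thr_open n R t) x = n - 1"
    proof -
      obtain k where "n = Suc k" using assms(1) by (cases n) auto
      then show ?thesis unfolding that by (simp add: mod_Suc)
    qed
    consider "t = 0" | "t = 1" "opts_out n x" | "t = 1" "\<not> opts_out n x" | "t = 2" "opts_out n x" | "t = 2" "\<not> opts_out n x" | "t = 3"
      using assms(2) by linarith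
    then show ?thesis
    proof cases
      case 1
      then have "first_idx n (thr_open n R t) x = n - 1"
        by (intro first_idx_eq) (use assms(1) in \<open>auto simp: thr_open_def threshold_state_def\<close>)
      then show ?thesis using last 1 by simp
    next
      case 2
      have "first_idx n (thr_open n R t) x = n - 1"
      proof (rule first_idx_eq)
        show "x \<in> thr_open n R t (n - 1)" using 2 assms(1) unfolding thr_open_def threshold_state_def opts_out_def blocks_def by auto
        show "x \<notin> thr_open n R t \<gamma>" if "\<gamma> < n - 1" for \<gamma>
          using opts_out_not_thr_open[OF 2(2), of \<gamma> R] that 2(1) unfolding thr_open_def threshold_state_def by auto
      qed (use assms(1) in simp)
      then show ?thesis using last 2 by (simp add: query_val_def)
    next
      case 3
      have "first_idx n (thr_open n R t) x = first_idx n (thr_open n R 2) x"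
        by (rule first_idx_cong) (use 3 in \<open>auto simp: thr_open_def threshold_state_def opts_out_def blocks_def\<close>)
      then show ?thesis using 3 by (simp add: query_val_def)
    next
      case 4
      then have "first_idx n (thr_open n R t) x = n" using opts_out_not_thr_open[OF 4(2)] by (intro first_idx_None) auto
      then show ?thesis using 4 by (simp add: query_val_def)
    next
      case 5
      then show ?thesis by (simp add: query_val_def)
    next
      case 6
      then have "first_idx n (thr_open n R t) x = n" by (intro first_idx_None) (auto simp: thr_open_def threshold_state_def)
      then show ?thesis using 6 by (simp add: query_val_def)
    qed
  qed
  then show ?thesis by blast
qed

lemma query_val_stuck:
  assumes J: "1 \<le> J" "J \<le> n" and ev: "\<And>k. k0 \<le> k ==> blocks n (pre x k) = J"
  shows "query_val n R x = (if even J then 2 else 0)"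
proof -
  have le: "blocks n (pre x k) \<le> J" for k
    using blocks_mono[of k "max k k0" n x] ev[of "max k k0"] by simp
  have "blocks n (pre x k) \<noteq> n + 2" for k using le[of k] J by simp
  then have no: "\<not> opts_out n x" by (simp add: opts_out_def)
  have iff: "x \<in> thr_open n R 2 \<beta> \<longleftrightarrow> 1 \<le> \<beta> \<and> Suc n - \<beta> \<le> J" for \<beta>
  proof
    assume "x \<in> thr_open n R 2 \<beta>"
    then obtain k where "index_state n R \<beta> (block_state n (pre x k))" by (auto simp: thr_open_def threshold_state_def)
    then show "1 \<le> \<beta> \<and> Suc n - \<beta> \<le> J" using le[of k] J(2) unfolding index_state_def blocks_def by (auto split: if_splits)
  next
    assume "1 \<le> \<beta> \<and> Suc n - \<beta> \<le> J"
    then have "index_state n R \<beta> (block_state n (pre x k0))" using ev[of k0] J(2) by (simp add: index_state_def blocks_def)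
    then show "x \<in> thr_open n R 2 \<beta>" by (auto simp: thr_open_def threshold_state_def)
  qed
  have "first_idx n (thr_open n R 2) x = Suc n - J"
  proof (cases "J = 1")
    case True
    have "x \<notin> thr_open n R 2 \<beta>" if "\<beta> < n" for \<beta> using iff[of \<beta>] True that by auto
    with first_idx_None[of n x "thr_open n R 2"] True show ?thesis by simp
  next
    case False
    show ?thesis by (rule first_idx_eq) (use False J iff in auto)
  qed
  moreover obtain d where "Suc n = J + d" using J(2) by (metis le_SucI le_Suc_ex)
  moreover have "(d mod 2 \<noteq> n mod 2) = even J" using \<open>Suc n = J + d\<close> by presburger
  ultimately show ?thesis using no by (simp add: query_val_def)
qed

lemma query_val_finished:
  assumes n: "1 \<le> n" and st: "block_state n (pre x k) = pr (Suc n) (pr c m)"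
  shows "query_val n R x = (if R c = even n then 2 else 0)"
proof -
  have jk: "blocks n (pre x k) = Suc n" using st by (simp add: blocks_def)
  have abs: "block_state n (pre x l) = pr (Suc n) (pr c m)" if "blocks n (pre x l) = Suc n" for l
    using block_state_absorbing[of l k n x] block_state_absorbing[of k l n x] that jk st by (cases "l \<le> k") auto
  have le: "blocks n (pre x l) \<le> Suc n" for l
    using blocks_mono[of l k n x] block_state_absorbing[of k l n x] jk st by (cases "l \<le> k") (auto simp: blocks_def)
  have "blocks n (pre x l) \<noteq> n + 2" for l using le[of l] by simp
  then have no: "\<not> opts_out n x" by (simp add: opts_out_def)
  have U0: "x \<in> thr_open n R 2 0 \<longleftrightarrow> \<not> R c"
  proof
    assume "x \<in> thr_open n R 2 0"
    then obtain l where "blocks n (pre x l) = Suc n" "\<not> R (pfst (psnd (block_state n (pre x l))))"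
      by (auto simp: thr_open_def threshold_state_def index_state_def blocks_def)
    then show "\<not> R c" using abs by auto
  next
    assume "\<not> R c"
    then have "index_state n R 0 (block_state n (pre x k))" using st by (simp add: index_state_def)
    then show "x \<in> thr_open n R 2 0" by (auto simp: thr_open_def threshold_state_def)
  qed
  have U: "x \<in> thr_open n R 2 1"
  proof -
    have "index_state n R 1 (block_state n (pre x k))" using st by (simp add: index_state_def)
    then show ?thesis by (auto simp: thr_open_def threshold_state_def)
  qed
  have "first_idx n (thr_open n R 2) x = (if R c then 1 else 0)"
  proof (cases "R c")
    case False
    then show ?thesis using first_idx_eq[of 0 n x "thr_open n R 2"] n U0 by simp
  next
    case True
    show ?thesis
    \<comment> \<open>For \<open>n = 1\<close> index 1 belongs to no set but is the default of
      \<open>first_idx\<close>, with the same effect.\<close>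
    proof (cases "n = 1")
      case n1: True
      then show ?thesis using first_idx_None[of n x "thr_open n R 2"] U0 True by simp
    next
      case n1: False
      then show ?thesis using first_idx_eq[of 1 n x "thr_open n R 2"] U0 U True n by simp
    qed
  qed
  moreover have "((1::nat) mod 2 \<noteq> n mod 2) = even n" "((0::nat) mod 2 \<noteq> n mod 2) = odd n" by presburger+
  ultimately show ?thesis using no by (cases "R c") (simp_all only: query_val_def if_True if_False, simp_all)
qed

lemma query_val_opted: "blocks n (pre x k) = n + 2 ==> query_val n R x = 1"
  unfolding query_val_def opts_out_def by auto

lemma query_val_less: "query_val n R x < 3"
  by (simp add: query_val_def)

lemma wf_query_game: "wf_game (query_game n R)"
  unfolding wf_game_def by (auto simp: query_val_less)

section \<open>Equilibria of the query game\<close>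

text \<open>If player \<open>i\<close> owns all positions along \<open>v\<close>, then playing
  \<open>v\<close> and returning to \<open>s\<close> is a deviation of \<open>i\<close> alone, so
  the equilibrium property at \<open>w\<close> applies to it.\<close>

lemma deviation_not_preferred:
  assumes "nash_at G w s" and "i \<in> {1, 2}" and turn: "\<And>k. k < length v ==> turn G (w @ take k v) = i"
  shows "\<not> prefers G i (val G (play s w)) (val G (play s (w @ v)))"
proof -
  define s' where "s' u = (if \<exists>k<length v. u = w @ take k v then v ! (length u - length w) else s u)" for u
  let ?x = "play s (w @ v)"
  have "play s' w = ?x"
  proof (rule play_unique)
    show "?x k = w ! k" if "k < length w" for k using that by (subst play_rec) (simp add: nth_append)
    show "?x k = s' (pre ?x k)" if k: "length w \<le> k" for k
    proof (cases "k < length (w @ v)")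
      case True
      then have "pre ?x k = w @ take (k - length w) v"
        using take_pre[of k "length (w @ v)" ?x] k pre_play_length[of s "w @ v"] by simp
      moreover have "k - length w < length v" using True k by auto
      ultimately have "s' (pre ?x k) = v ! (k - length w)" using k by (auto simp: s'_def)
      moreover have "?x k = v ! (k - length w)" using True k by (subst play_rec) (simp add: nth_append)
      ultimately show ?thesis by simp
    next
      case False
      then have "s' (pre ?x k) = s (pre ?x k)" unfolding s'_def by (auto dest: arg_cong[where f = length])
      moreover have "?x k = s (pre ?x k)" using False by (subst play_rec) simp
      ultimately show ?thesis by simp
    qed
  qed
  moreover have "s' u = s u" if "turn G u \<noteq> i" for u using that turn unfolding s'_def by auto
  ultimately show ?thesis using assms(1,2) unfolding nash_at_def by metis
qed

lemma block_state_replicate: "block_state n w = pr j (pr c m) ==> j \<le> n ==> block_state n (w @ replicate i False) = pr j (pr c (m + i))"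
proof (induction i)
  case (Suc i)
  then have "block_state n ((w @ replicate i False) @ [False]) = pr j (pr c (m + Suc i))" unfolding block_state_snoc by (simp add: step_code_def)
  then show ?case by (simp add: replicate_append_same)
qed simp

lemma block_state_block:
  assumes "block_state n w = pr j (pr c 0)" "j \<le> n"
  shows "block_state n (w @ replicate m False @ [True]) = step_code n (pr j (pr c m)) 1"
  using block_state_snoc[of n "w @ replicate m False" True] block_state_replicate[OF assms, of m] by simp

lemma play_block_cases:
  obtains m where "pre (play s w) (length w + Suc m) = w @ replicate m False @ [True]"
  | "\<And>m. pre (play s w) (length w + m) = w @ replicate m False"
proof (cases "\<exists>m. play s w (length w + m)")
  case False
  have "pre (play s w) (length w + m) = w @ replicate m False" for m
    by (induction m) (use False in \<open>auto simp: pre_Suc replicate_append_same\<close>)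
  then show thesis by (rule that(2))
next
  case True
  define m where "m = (LEAST m. play s w (length w + m))"
  have m: "play s w (length w + m)" unfolding m_def using True by (rule LeastI_ex)
  have lt: "\<not> play s w (length w + i)" if "i < m" for i using that not_less_Least unfolding m_def by blast
  have "i \<le> m ==> pre (play s w) (length w + i) = w @ replicate i False" for i
    by (induction i) (use lt in \<open>auto simp: pre_Suc replicate_append_same\<close>)
  from this[OF order.refl] have "pre (play s w) (length w + Suc m) = w @ replicate m False @ [True]"
    using m by (simp add: pre_Suc)
  then show thesis by (rule that(1))
qed

lemma play_after_block:
  assumes "pre (play s w) (length w + k) = w'"
  shows "play s w = play s w'"
  using play_from_prefix[of w "length w + k" s] assms by simp

lemma query_val_all_False:
  assumes "\<And>m. pre x (length w + m) = w @ replicate m False" "block_state n w = pr j (pr c 0)" "1 \<le> j" "j \<le> n"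
  shows "query_val n R x = (if even j then 2 else 0)"
proof (rule query_val_stuck[OF assms(3,4), of "length w"])
  fix k assume "length w \<le> k"
  then obtain m where "k = length w + m" by (metis le_Suc_ex)
  then show "blocks n (pre x k) = j" using assms(1)[of m] block_state_replicate[OF assms(2,4), of m] by (simp add: blocks_def)
qed

text \<open>Backward induction on the number \<open>d\<close> of blocks left. The owner of block
  \<open>j\<close>, player 1 for odd \<open>j\<close>, wins iff the alternation is true: naming a
  witness then secures the win, while without a witness every block that is ended loses, and so does
  never ending it.\<close>

lemma SPE_value_witness_phase:
  assumes n: "1 \<le> n" and SPE: "is_SPE (query_game n R) s"
  shows "block_state n w = pr j (pr c 0) ==> 2 \<le> j ==> j + d = Suc n ==>
    query_val n R (play s w) = (if alternation d R c = odd j then 2 else 0)"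
proof (induction d arbitrary: w j c)
  case 0
  then have "block_state n (pre (play s w) (length w)) = pr (Suc n) (pr c 0)" by simp
  from query_val_finished[OF n this] show ?case using 0 by auto
next
  case (Suc d)
  then have j: "j \<le> n" "1 \<le> j" by auto
  define i :: nat where "i = (if odd j then 1 else 2)"
  have next_val: "query_val n R (play s (w @ replicate m False @ [True])) = (if alternation d R (pr c m) = even j then 2 else 0)" for m
  proof -
    have "block_state n (w @ replicate m False @ [True]) = pr (Suc j) (pr (pr c m) 0)"
      unfolding block_state_block[OF Suc.prems(1) j(1)] using Suc.prems(2) j by (simp add: step_code_def)
    from Suc.IH[OF this] show ?thesis using Suc.prems(2,3) by simp
  qed
  show ?case
  proof (cases "alternation (Suc d) R c")
    case True
    then obtain m where m: "\<not> alternation d R (pr c m)" by auto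
    have "\<not> prefers (query_game n R) i (val (query_game n R) (play s w))
        (val (query_game n R) (play s (w @ (replicate m False @ [True]))))"
    proof (rule deviation_not_preferred)
      show "nash_at (query_game n R) w s" using SPE by (simp add: is_SPE_def)
      fix k assume "k < length (replicate m False @ [True])"
      then have "take k (replicate m False @ [True]) = replicate k False" by simp
      then show "turn (query_game n R) (w @ take k (replicate m False @ [True])) = i"
        using block_state_replicate[OF Suc.prems(1) j(1), of k] by (simp add: blocks_def i_def)
    qed (simp add: i_def)
    then have "\<not> prefers (query_game n R) i (query_val n R (play s w)) (if odd j then 2 else 0)"
      using next_val[of m] m by simp
    then show ?thesis using True query_val_less[of n R "play s w"] by (auto simp: prefers_def i_def split: if_splits)
  next
    case False
    have all: "alternation d R (pr c m)" for m using False by auto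
    show ?thesis
    proof (cases rule: play_block_cases[of s w])
      case (1 m)
      from play_after_block[OF 1] next_val[of m] show ?thesis using all False by simp
    next
      case 2
      from query_val_all_False[OF 2 Suc.prems(1) j(2,1)] show ?thesis using False by simp
    qed
  qed
qed

text \<open>Opting out yields 1, strictly between 2, which playing on can secure if the query is
  true, and 0, the only result of playing on if it is false. So player 1 is never
  indifferent.\<close>

lemma SPE_answers_query:
  assumes n: "1 \<le> n" and SPE: "is_SPE (query_game n R) s"
  shows "s (replicate x False @ [True]) \<longleftrightarrow> \<not> alternation n R x"
proof -
  define w where "w = replicate x False @ [True]"
  have w: "block_state n w = pr 1 (pr x 0)"
    using block_state_block[of n "[]" 0 0 x] by (simp add: w_def gst_Nil step_code_def)
  have nash: "nash_at (query_game n R) w s" using SPE by (simp add: is_SPE_def)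
  obtain d where d: "n = Suc d" using n by (cases n) auto
  \<comment> \<open>A block of length 0 is the opt-out, so the witness \<open>m\<close> is named by
    a block of length \<open>Suc m\<close>.\<close>
  have next_val: "query_val n R (play s (w @ replicate (Suc m) False @ [True])) = (if alternation d R (pr x m) then 0 else 2)" for m
  proof -
    have "block_state n (w @ replicate (Suc m) False @ [True]) = pr 2 (pr (pr x m) 0)"
      unfolding block_state_block[OF w n] using n by (simp add: step_code_def)
    from SPE_value_witness_phase[OF n SPE this, of d] show ?thesis using d by simp
  qed
  have opt: "query_val n R (play s' w') = 1" if "w' = w @ [True]" for s' w'
  proof (rule query_val_opted)
    show "blocks n (pre (play s' w') (length w')) = n + 2"
      unfolding pre_play_length that using w n by (simp add: blocks_def block_state_snoc step_code_def)
  qed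
  have opt_play: "query_val n R (play s w) = 1" if "s w"
  proof -
    have "pre (play s w) (length w + 1) = w @ [True]" using that play_rec[of s w "length w"] by (simp add: pre_Suc)
    from play_after_block[OF this] show ?thesis using opt by simp
  qed
  have "s w \<longleftrightarrow> \<not> alternation n R x"
  proof (cases "alternation n R x")
    case True
    then obtain m where m: "\<not> alternation d R (pr x m)" unfolding d by auto
    have "\<not> prefers (query_game n R) 1 (val (query_game n R) (play s w))
        (val (query_game n R) (play s (w @ (replicate (Suc m) False @ [True]))))"
    proof (rule deviation_not_preferred[OF nash])
      fix k assume "k < length (replicate (Suc m) False @ [True])"
      then have "take k (replicate (Suc m) False @ [True]) = replicate k False"
        by (simp add: take_Cons' del: replicate.simps)
      then show "turn (query_game n R) (w @ take k (replicate (Suc m) False @ [True])) = 1"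
        using block_state_replicate[OF w n, of k] by (simp add: blocks_def del: replicate.simps)
    qed simp
    then have "\<not> query_val n R (play s w) < 2" using next_val[of m] m by (simp add: prefers_def del: replicate.simps)
    then show ?thesis using opt_play True by auto
  next
    case False
    then have all: "alternation d R (pr x m)" for m unfolding d by auto
    have "s w"
    proof (rule ccontr)
      assume ns: "\<not> s w"
      have "query_val n R (play s w) = 0"
      proof (cases rule: play_block_cases[of s w])
        case (1 m)
        have "\<not> play s w (length w)" using ns play_rec[of s w "length w"] by simp
        have "m \<noteq> 0"
        proof
          assume "m = 0"
          then have "pre (play s w) (Suc (length w)) ! length w" using 1 by (simp add: nth_append)
          then show False using \<open>\<not> play s w (length w)\<close> by (simp add: pre_Suc nth_append)
        qed
        then obtain l where "m = Suc l" by (cases m) auto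
        from play_after_block[OF 1] next_val[of l] this show ?thesis using all by simp
      next
        case 2
        from query_val_all_False[OF 2 w] n show ?thesis by simp
      qed
      moreover have "\<not> prefers (query_game n R) 1 (val (query_game n R) (play s w)) (val (query_game n R) (play s (w @ [True])))"
        by (rule deviation_not_preferred[OF nash]) (use w in \<open>auto simp: blocks_def\<close>)
      ultimately show False using opt by (simp add: prefers_def)
    qed
    with False show ?thesis by simp
  qed
  then show ?thesis by (simp add: w_def)
qed

text \<open>The upper sets of player 1 in the game below are \<open>{t..<3}\<close>, those of player 2 their complements;
  \<open>threshold\<close> recovers \<open>t\<close> from the code of the set.\<close>
definition threshold :: "nat => nat => nat" where
  "threshold i c = (if i = 1 then (if c = 0 then 3 else if c = 4 then 2 else if c = 6 then 1 else 0)
     else (if c = 0 then 0 else if c = 1 then 1 else if c = 3 then 2 else 3))"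

text \<open>The upper sets of both players are named through the sets of plays of value at least
  \<open>t\<close>: with tag 0 for player 1 and, as complements, with tag 1 for player 2. The entry
  at the code of a word enumerates that word itself or nothing.\<close>

definition query_name :: "nat => (nat => bool) => baire" where
  "query_name n R z = (if pfst z = 0 then 3
     else if pfst z = 1 then (if even (pfst (state_code n (psnd z))) then 2 else 1)
     else if pfst z = 2 then of_bool (pfst (psnd z) < psnd (psnd z))
     else if psnd (psnd z) = 0 then pfst (pfst (psnd z)) - 1
     else if threshold_state n R (threshold (pfst (pfst (psnd z))) (psnd (pfst (psnd z))))
         (pfst (psnd (psnd z) - 1)) (state_code n (psnd (psnd (psnd z) - 1)))
       then Suc (psnd (psnd (psnd z) - 1)) else 0)"

lemma comp_on_state_code [comp_intros]:
  assumes "comp_on D U" shows "comp_on D (\<lambda>p x. state_code n (U p x))"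
  unfolding state_code_def step_code_def by (intro comp_intros assms assms[THEN comp_on_subst])

lemma comp_on_query_name:
  assumes R: "comp_on D (\<lambda>p x. of_bool (R p x))"
  shows "comp_on D (\<lambda>p. query_name n (R p))"
proof -
  have R': "comp_on D F ==> comp_on D (\<lambda>p x. of_bool (R p (F p x)))" for F
    using comp_on_subst[OF R, of F] by simp
  show ?thesis unfolding query_name_def threshold_state_def index_state_def threshold_def by (intro comp_intros R')
qed

lemma upper_set_query_game:
  assumes "i \<in> {1, 2}" "upper_set (query_game n R) i U"
  shows "threshold i (set_encode U) \<le> 3" "i = 1 ==> U = {threshold i (set_encode U)..<3}"
    "i = 2 ==> U = {..<threshold i (set_encode U)}"
proof -
  have sub: "U \<subseteq> {0, 1, 2}" using assms(2) unfolding upper_set_def by (auto simp: less_Suc_eq numeral_3_eq_3)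
  have cl: "a \<in> U ==> b < 3 ==> prefers (query_game n R) i a b ==> b \<in> U" for a b
    using assms(2) unfolding upper_set_def by auto
  have "i = 1 ==> U \<in> {{}, {2}, {1, 2}, {0, 1, 2}}"
  proof -
    assume "i = 1"
    then have "0 \<in> U ==> 1 \<in> U" "1 \<in> U ==> 2 \<in> U" using cl[of 0 1] cl[of 1 2] by (auto simp: prefers_def)
    then show ?thesis using sub by auto
  qed
  moreover have "i = 2 ==> U \<in> {{}, {0}, {0, 1}, {0, 1, 2}}"
  proof -
    assume "i = 2"
    then have "1 \<in> U ==> 0 \<in> U" "2 \<in> U ==> 1 \<in> U" using cl[of 1 0] cl[of 2 1] by (auto simp: prefers_def)
    then show ?thesis using sub by auto
  qed
  ultimately show "i = 1 ==> U = {threshold i (set_encode U)..<3}" "i = 2 ==> U = {..<threshold i (set_encode U)}"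
    by (auto simp: threshold_def)
  show "threshold i (set_encode U) \<le> 3" by (simp add: threshold_def)
qed

lemma game_name_query_name:
  assumes n: "1 \<le> n"
  shows "game_name n (query_name n R) (query_game n R)"
  unfolding game_name_def
proof (intro conjI ballI allI impI wf_query_game)
  show "bproj 0 (query_name n R) 0 = noutc (query_game n R)" by (simp add: bproj_def query_name_def)
  show "bproj 1 (query_name n R) (wcode w) = turn (query_game n R) w" for w
    by (simp add: bproj_def query_name_def blocks_def block_state_def)
  show "bproj 2 (query_name n R) (pr a b) = of_bool (pref1 (query_game n R) a b)" for a b
    by (simp add: bproj_def query_name_def)
next
  fix i U assume i: "i \<in> {1, 2 :: nat}" and U: "upper_set (query_game n R) i U"
  define t where "t = threshold i (set_encode U)"
  define q where "q = bproj (pr i (set_encode U)) (bproj 3 (query_name n R))"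
  have q: "q 0 = i - 1" "q (Suc y) = (if threshold_state n R t (pfst y) (state_code n (psnd y)) then Suc (psnd y) else 0)" for y
    by (simp_all add: q_def bproj_def query_name_def t_def)
  have "open_name (bproj \<beta> (tail q)) (thr_open n R t \<beta>)" for \<beta>
  proof -
    have "(\<exists>u. bproj \<beta> (tail q) u = Suc (wcode w)) \<longleftrightarrow> threshold_state n R t \<beta> (block_state n w)" for w
      unfolding block_state_def by (auto simp: bproj_def tail_def q split: if_splits intro!: exI[of _ "wcode w"])
    then have "\<Union>{cyl w |w. \<exists>u. bproj \<beta> (tail q) u = Suc (wcode w)} = \<Union>{cyl w |w. threshold_state n R t \<beta> (block_state n w)}" by simp
    also have "\<dots> = thr_open n R t \<beta>" by (rule set_eqI) (simp only: mem_Union_cyl thr_open_def mem_Collect_eq)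
    finally show ?thesis unfolding open_name_def by simp
  qed
  then have D: "D_name n (tail q) {x. t \<le> query_val n R x}"
    unfolding D_name_def query_val_thresholds[OF n upper_set_query_game(1)[OF i U, folded t_def], symmetric]
    by (intro exI[of _ "thr_open n R t"]) simp
  show "DcoD_name n (bproj (pr i (set_encode U)) (bproj 3 (query_name n R))) (val (query_game n R) -` U)"
    unfolding q_def[symmetric] DcoD_name_def
  proof (cases "i = 1")
    case True
    then have "val (query_game n R) -` U = {x. t \<le> query_val n R x}"
      using upper_set_query_game(2)[OF i U, folded t_def] query_val_less by auto
    then show "q 0 = 0 \<and> D_name n (tail q) (val (query_game n R) -` U) \<or>
        q 0 = 1 \<and> D_name n (tail q) (- (val (query_game n R) -` U))" using D q(1) True by simp
  next
    case False
    then have "i = 2" using i by simp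
    then have "- (val (query_game n R) -` U) = {x. t \<le> query_val n R x}"
      using upper_set_query_game(3)[OF i U, folded t_def] by auto
    then show "q 0 = 0 \<and> D_name n (tail q) (val (query_game n R) -` U) \<or>
        q 0 = 1 \<and> D_name n (tail q) (- (val (query_game n R) -` U))" using D q(1) \<open>i = 2\<close> by simp
  qed
qed

section \<open>Uniqueness of the named game, and the reduction of iterated limits\<close>

lemma D_name_unique: "D_name n q A ==> D_name n q B ==> A = B"
proof -
  assume "D_name n q A" "D_name n q B"
  then obtain U X where U: "\<forall>i<n. open_name (bproj i q) (U i)" "A = {x. first_idx n U x mod 2 \<noteq> n mod 2}"
    and X: "\<forall>i<n. open_name (bproj i q) (X i)" "B = {x. first_idx n X x mod 2 \<noteq> n mod 2}"
    unfolding D_name_def by blast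
  have "U i = X i" if "i < n" for i using U(1) X(1) that unfolding open_name_def by simp
  then have "first_idx n U x = first_idx n X x" for x by (intro first_idx_cong) simp
  then show "A = B" unfolding U(2) X(2) by simp
qed

lemma DcoD_name_unique: "DcoD_name n q A ==> DcoD_name n q B ==> A = B"
  unfolding DcoD_name_def using D_name_unique[of n "tail q"] by (metis double_complement zero_neq_one)

text \<open>\<open>SPE_prob\<close> accepts an equilibrium of any game with the given name. Such
  games agree on turns and on preferences between outcomes by the tables, and on the valuation
  because the preimages of the sets \<open>at_least G c\<close> determine it.\<close>

lemma is_SPE_game_name_cong:
  assumes G: "game_name n p G" and G': "game_name n p G'" and SPE: "is_SPE G s"
  shows "is_SPE G' s"
proof -
  have wf: "wf_game G" "wf_game G'" using G G' unfolding game_name_def by blast+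
  have N: "noutc G = noutc G'" using G G' unfolding game_name_def by (metis (no_types))
  have turn: "turn G w = turn G' w" for w using G G' unfolding game_name_def by (metis (no_types))
  have pf: "pref1 G b c \<longleftrightarrow> pref1 G' b c" if "b < noutc G" "c < noutc G" for b c
  proof -
    have "(of_bool (pref1 G b c) :: nat) = of_bool (pref1 G' b c)"
      using G G' that N unfolding game_name_def by (metis (no_types))
    then show ?thesis by (simp only: of_bool_eq_iff)
  qed
  have al: "at_least G c = at_least G' c" if "c < noutc G" for c
    unfolding at_least_def using pf N that by auto
  have pre_eq: "val G -` at_least G c = val G' -` at_least G c" if c: "c < noutc G" for c
  proof (rule DcoD_name_unique)
    let ?q = "bproj (pr 1 (set_encode (at_least G c))) (bproj 3 p)"
    show "DcoD_name n ?q (val G -` at_least G c)"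
      using G upper_set_at_least[OF wf(1) c] unfolding game_name_def by blast
    have "upper_set G' 1 (at_least G c)" unfolding al[OF c] using upper_set_at_least[OF wf(2)] c N by simp
    then show "DcoD_name n ?q (val G' -` at_least G c)"
      using G' unfolding game_name_def by blast
  qed
  have val: "val G x = val G' x" for x
  proof (rule ccontr)
    assume ne: "val G x \<noteq> val G' x"
    have l: "val G x < noutc G" "val G' x < noutc G" using wf_game_val wf N by metis+
    have "val G x \<in> at_least G (val G x)" "val G' x \<in> at_least G (val G' x)" using l by (auto simp: at_least_def)
    then have "val G' x \<in> at_least G (val G x)" "val G x \<in> at_least G (val G' x)"
      using pre_eq[OF l(1)] pre_eq[OF l(2)] by blast+
    then have "pref1 G (val G x) (val G' x)" "pref1 G (val G' x) (val G x)" using ne by (auto simp: at_least_def)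
    then show False using wf_game_trans[OF wf(1) l(1,2,1)] wf_game_irrefl[OF wf(1) l(1)] by blast
  qed
  show ?thesis unfolding is_SPE_def nash_at_def
  proof (intro allI ballI impI)
    fix h i s' assume i: "i \<in> {1, 2 :: nat}" and s': "\<forall>w. turn G' w \<noteq> i --> s' w = s w"
    then have "\<not> prefers G i (val G (play s h)) (val G (play s' h))"
      using SPE unfolding is_SPE_def nash_at_def turn by blast
    then show "\<not> prefers G' i (val G' (play s h)) (val G' (play s' h))"
      using pf wf_game_val[OF wf(1)] val unfolding prefers_def by (auto split: if_splits)
  qed
qed

text \<open>The outer function reads the strategy only at the positions that end a first block. For
  each \<open>k\<close> it looks for the first \<open>z\<close> at which player 1 opts out; this
  answers the query negatively, so \<open>psnd z\<close> is the \<open>k\<close>-th entry of the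
  limit.\<close>

lemma lim_iter_le_SPE_prob:
  assumes n: "1 \<le> n"
  shows "lim_iter n \<le>\<^sub>W SPE_prob n"
proof -
  define D where "D = {p. lim_iter n p \<noteq> {}}"
  define F where "F p = (SOME r. limN n p r)" for p
  have F: "limN n p (F p)" if "p \<in> D" for p
  proof -
    from that obtain r where "limN n p r" by (auto simp: D_def lim_iter_iff[symmetric])
    then show ?thesis unfolding F_def by (rule someI[of "limN n p"])
  qed
  obtain m where m: "n = Suc m" using n by (cases n) auto
  from limN_queries[of D m F] F obtain Q where Q: "Sig D n Q"
    "\<And>p k. p \<in> D ==> \<exists>z. \<not> Q p (pr k z)" "\<And>p k z. p \<in> D ==> \<not> Q p (pr k z) ==> F p k = psnd z"
    unfolding m by blast
  from Sig_alternation[OF Q(1)] obtain R where R: "comp_on D (\<lambda>p x. of_bool (R p x))"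
    "\<And>p x. p \<in> D ==> Q p x \<longleftrightarrow> alternation n (R p) x" by blast
  let ?H = "\<lambda>p. if p \<in> D then Some (query_name n (R p)) else None"
  define node where "node x = lsnoc (list_encode (map (\<lambda>_. 0) [0..<x])) 1" for x
  have node: "node x = wcode (replicate x False @ [True])" for x
  proof -
    have "list_encode (map (\<lambda>_. 0) [0..<x]) = wcode (replicate x False)"
      by (simp add: wcode_def map_replicate_const)
    then show ?thesis using lsnoc_wcode[of "replicate x False" True] by (simp add: node_def)
  qed
  let ?ok = "\<lambda>x k z. bsnd x (node (pr k z)) = 1"
  let ?K = "\<lambda>x. if \<forall>k. \<exists>z. ?ok x k z then Some (\<lambda>k. psnd (LEAST z. ?ok x k z)) else None"
  show ?thesis unfolding W_le_def
  proof (rule exI[of _ ?K], rule exI[of _ ?H], intro conjI allI impI)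
    let ?E = "{x. \<forall>k. \<exists>z. ?ok x k z}"
    have "comp_on ?E (\<lambda>x k. psnd (LEAST z. ?ok x k z))"
      unfolding bsnd_def node_def by (intro comp_intros) (auto simp: bsnd_def node_def)
    moreover have "dom ?K = ?E" by (auto simp: dom_def)
    ultimately show "computable ?K" unfolding computable_iff_comp_on
      by (auto elim!: comp_on_cong)
  next
    have "dom ?H = D" by (auto simp: dom_def)
    then show "computable ?H" unfolding computable_iff_comp_on
      using comp_on_cong[OF comp_on_query_name[OF R(1)], where G = "\<lambda>p. the (?H p)"] by simp
  next
    fix G assume G: "realizer G (SPE_prob n)"
    show "realizer (\<lambda>p. Option.bind (?H p) (\<lambda>h. Option.bind (G h) (\<lambda>q. ?K (bpair p q)))) (lim_iter n)"
      unfolding realizer_def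
    proof (intro allI impI)
      fix p assume "lim_iter n p \<noteq> {}"
      then have p: "p \<in> D" by (simp add: D_def)
      have name: "game_name n (query_name n (R p)) (query_game n (R p))" by (rule game_name_query_name[OF n])
      then have "SPE_prob n (query_name n (R p)) \<noteq> {}" using limcomp_SPE[of n] by blast
      then obtain q where q: "G (query_name n (R p)) = Some q" "q \<in> SPE_prob n (query_name n (R p))"
        using G unfolding realizer_def by blast
      then obtain G' s where G': "game_name n (query_name n (R p)) G'" "is_SPE G' s" and s: "strat_name q s"
        unfolding SPE_prob_def by blast
      have SPE: "is_SPE (query_game n (R p)) s" by (rule is_SPE_game_name_cong[OF G'(1) name G'(2)])
      have ok: "?ok (bpair p q) k z \<longleftrightarrow> \<not> Q p (pr k z)" for k z
        using s SPE_answers_query[OF n SPE, of "pr k z"] R(2)[OF p]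
        unfolding strat_name_def node bsnd_bpair by simp
      have "\<forall>k. \<exists>z. ?ok (bpair p q) k z" unfolding ok using Q(2)[OF p] by blast
      moreover have "psnd (LEAST z. ?ok (bpair p q) k z) = F p k" for k
      proof -
        have "\<not> Q p (pr k (LEAST z. \<not> Q p (pr k z)))" using Q(2)[OF p] by (rule LeastI_ex)
        from Q(3)[OF p this] show ?thesis unfolding ok by simp
      qed
      ultimately have "?K (bpair p q) = Some (F p)" by simp
      moreover have "F p \<in> lim_iter n p" using F[OF p] by (simp add: lim_iter_iff)
      ultimately show "\<exists>r. Option.bind (?H p) (\<lambda>h. Option.bind (G h) (\<lambda>q. ?K (bpair p q))) = Some r \<and> r \<in> lim_iter n p"
        using p q(1) by simp
    qed
  qed
qed

theorem theorem31:
  fixes n :: nat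
  assumes "n \<ge> 1"
  shows "SPE_prob n \<equiv>\<^sub>W lim_pow n"
  using SPE_prob_le_lim_iter[of n] lim_iter_le_SPE_prob[OF assms] lim_pow_eq_lim_iter[of n] W_le_trans unfolding W_eq_def by blast

end
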